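(* Assume Assumption A (stated in the context) holds and let $1<p<\infty$. Then problem (P) has a unique solution $u\in W^{1,p}(0,T;L^2(\Omega))\cap L^p(0,T;\check H^2(\Omega))$, and there is a constant $Q>0$ (independent of $f$ and $u_0$) such that $$\|u\|_{W^{1,p}(0,T;L^2(\Omega))}+\|u\|_{L^p(0,T;\check H^2(\Omega))}\le Q\big(\|f\|_{L^p(0,T;L^2(\Omega))}+\|\Delta u_0\|_{L^2(\Omega)}\big).$$
   Context: Let $\Omega\subset\mathbb R^d$, $1\le d\le 3$, be an open bounded domain with smooth boundary, $T>0$, $\mu>0$, $\zeta>0$. Let $\alpha:[0,T]\to(0,1]$ and define the variable-exponent Abel kernel $k(t)=\dfrac{t^{\alpha(t)-1}}{\Gamma(\alpha(t))}$ for $t>0$, and $(k*\varphi)(t)=\int_0^t k(t-s)\varphi(s)\,ds$. Problem (P) is: find $u(\bm x,t)$ with $$\partial_t u(\bm x,t)-\mu\Delta u(\bm x,t)-\zeta\int_0^t k(t-s)\Delta u(\bm x,s)\,ds=f(\bm x,t),\quad \bm x\in\Omega,\ 0<t\le T,$$ $u(\bm x,0)=u_0(\bm x)$ on $\overline\Omega$, and $u(\bm x,t)=0$ for $\bm x\in\partial\Omega$, $0<t\le T$. Let $\{\lambda_i,\phi_i\}_{i\ge1}$ be the eigenpairs of $-\Delta$ on $\Omega$ with homogeneous Dirichlet conditions ($\phi_i$ orthonormal in $L^2(\Omega)$). For $s\ge0$, $\check H^s(\Omega)=\{v\in L^2(\Omega):\|v\|_{\check H^s}^2=\sum_i\lambda_i^s(v,\phi_i)^2<\infty\}$;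 in particular $\check H^0=L^2$ and $\check H^2=H^2\cap H^1_0$. $W^{m,p}(0,T;\mathcal X)$ denotes the Bochner–Sobolev space with values in the Banach space $\mathcal X$. Assumption A: (i) $0<\alpha_*\le\alpha(t)\le1$ on $[0,T]$ for some constant $\alpha_*$, $\alpha(0)=1$, and $|\alpha'(t)|,|\alpha''(t)|\le Q$ on $[0,T]$; (ii) $f\in L^p(0,T;L^2(\Omega))$ and $\Delta u_0\in L^2(\Omega)$.
   Formalization: The condition Δu₀ ∈ L²(Ω) is taken as u₀ ∈ Ȟ²(Ω) = H²∩H¹₀, with ‖Δu₀‖ the Ȟ² norm; without zero boundary values the estimate fails (u₀ ≡ 1, f = 0 gives right side 0 but u ≠ 0). *)

theory Defs
  imports "HOL-Analysis.Analysis"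
begin

definition has_partial :: "'n::finite \<Rightarrow> (real^'n \<Rightarrow> real) \<Rightarrow> real^'n \<Rightarrow> bool" where
  "has_partial i f x \<longleftrightarrow> (\<lambda>t. f (x + t *\<^sub>R axis i 1)) differentiable (at 0)"

definition partial_dir :: "'n::finite \<Rightarrow> (real^'n \<Rightarrow> real) \<Rightarrow> real^'n \<Rightarrow> real" where
  "partial_dir i f x = deriv (\<lambda>t. f (x + t *\<^sub>R axis i 1)) 0"

definition laplacian :: "(real^'n::finite \<Rightarrow> real) \<Rightarrow> real^'n \<Rightarrow> real" where
  "laplacian f x = (\<Sum>i\<in>UNIV. partial_dir i (partial_dir i f) x)"

definition C2_on :: "(real^'n::finite) set \<Rightarrow> (real^'n \<Rightarrow> real) \<Rightarrow> bool" where
  "C2_on \<Omega> f \<longleftrightarrow> continuous_on \<Omega> f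
     \<and> (\<forall>i. \<forall>x\<in>\<Omega>. has_partial i f x) \<and> (\<forall>i. continuous_on \<Omega> (partial_dir i f))
     \<and> (\<forall>i j. \<forall>x\<in>\<Omega>. has_partial j (partial_dir i f) x)
     \<and> (\<forall>i j. continuous_on \<Omega> (partial_dir j (partial_dir i f)))"

fun Ck :: "nat \<Rightarrow> (real^'n::finite \<Rightarrow> real) \<Rightarrow> bool" where
  "Ck 0 f \<longleftrightarrow> continuous_on UNIV f"
| "Ck (Suc k) f \<longleftrightarrow> continuous_on UNIV f \<and> (\<forall>i x. has_partial i f x) \<and> (\<forall>i. Ck k (partial_dir i f))"

definition smooth_fun :: "(real^'n::finite \<Rightarrow> real) \<Rightarrow> bool" where
  "smooth_fun f \<longleftrightarrow> (\<forall>k. Ck k f)"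

text \<open>Smooth (C^infinity) boundary: near every boundary point, after an orthogonal change of
  coordinates, Omega is the region below the graph of a smooth function of the remaining coordinates.\<close>
definition smooth_boundary :: "(real^'n::finite) set \<Rightarrow> bool" where
  "smooth_boundary \<Omega> \<longleftrightarrow> (\<forall>z\<in>frontier \<Omega>. \<exists>r>0. \<exists>(R::real^'n \<Rightarrow> real^'n) k \<gamma>.
      orthogonal_transformation R \<and> smooth_fun \<gamma> \<and> (\<forall>x s. \<gamma> (x + s *\<^sub>R axis k 1) = \<gamma> x)
      \<and> (\<forall>x\<in>ball z r. x \<in> \<Omega> \<longleftrightarrow> (R x) $ k < \<gamma> (R x)))"

definition in_L2 :: "(real^'n::finite) set \<Rightarrow> (real^'n \<Rightarrow> real) \<Rightarrow> bool" where
  "in_L2 \<Omega> v \<longleftrightarrow> set_borel_measurable lebesgue \<Omega> v \<and> set_integrable lebesgue \<Omega> (\<lambda>x. (v x)\<^sup>2)"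

definition L2_inner :: "(real^'n::finite) set \<Rightarrow> (real^'n \<Rightarrow> real) \<Rightarrow> (real^'n \<Rightarrow> real) \<Rightarrow> real" where
  "L2_inner \<Omega> v w = (LINT x:\<Omega>|lebesgue. v x * w x)"

definition L2_norm :: "(real^'n::finite) set \<Rightarrow> (real^'n \<Rightarrow> real) \<Rightarrow> real" where
  "L2_norm \<Omega> v = sqrt (LINT x:\<Omega>|lebesgue. (v x)\<^sup>2)"

definition dirichlet_eigensystem ::
  "(real^'n::finite) set \<Rightarrow> (nat \<Rightarrow> real) \<Rightarrow> (nat \<Rightarrow> real^'n \<Rightarrow> real) \<Rightarrow> bool" where
  "dirichlet_eigensystem \<Omega> lam \<phi> \<longleftrightarrow>
     (\<forall>i. C2_on \<Omega> (\<phi> i) \<and> continuous_on (closure \<Omega>) (\<phi> i)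
          \<and> (\<forall>x\<in>frontier \<Omega>. \<phi> i x = 0)
          \<and> (\<forall>x\<in>\<Omega>. - laplacian (\<phi> i) x = lam i * \<phi> i x))
   \<and> (\<forall>i j. L2_inner \<Omega> (\<phi> i) (\<phi> j) = (if i = j then 1 else 0))
   \<and> (\<forall>v. in_L2 \<Omega> v \<and> (\<forall>i. L2_inner \<Omega> v (\<phi> i) = 0) \<longrightarrow> (AE x in lebesgue. x \<in> \<Omega> \<longrightarrow> v x = 0))"

definition in_Hs :: "(real^'n::finite) set \<Rightarrow> (nat \<Rightarrow> real) \<Rightarrow> (nat \<Rightarrow> real^'n \<Rightarrow> real)
    \<Rightarrow> real \<Rightarrow> (real^'n \<Rightarrow> real) \<Rightarrow> bool" where
  "in_Hs \<Omega> lam \<phi> s v \<longleftrightarrow> in_L2 \<Omega> v \<and> summable (\<lambda>i. lam i powr s * (L2_inner \<Omega> v (\<phi> i))\<^sup>2)"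

definition Hs_norm :: "(real^'n::finite) set \<Rightarrow> (nat \<Rightarrow> real) \<Rightarrow> (nat \<Rightarrow> real^'n \<Rightarrow> real)
    \<Rightarrow> real \<Rightarrow> (real^'n \<Rightarrow> real) \<Rightarrow> real" where
  "Hs_norm \<Omega> lam \<phi> s v = sqrt (\<Sum>i. lam i powr s * (L2_inner \<Omega> v (\<phi> i))\<^sup>2)"

text \<open>Weak measurability of t |-> w t as an L^2(Omega)-valued map (equivalent to strong
  measurability by Pettis' theorem, L^2 being separable).\<close>
definition weakly_meas_L2 :: "(real^'n::finite) set \<Rightarrow> real \<Rightarrow> (real \<Rightarrow> real^'n \<Rightarrow> real) \<Rightarrow> bool" where
  "weakly_meas_L2 \<Omega> T w \<longleftrightarrow>
     (\<forall>h. in_L2 \<Omega> h \<longrightarrow> (\<lambda>t. L2_inner \<Omega> (w t) h) \<in> borel_measurable (lebesgue_on {0..T}))"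

definition Lp_L2 :: "(real^'n::finite) set \<Rightarrow> real \<Rightarrow> real \<Rightarrow> (real \<Rightarrow> real^'n \<Rightarrow> real) \<Rightarrow> bool" where
  "Lp_L2 \<Omega> p T w \<longleftrightarrow> weakly_meas_L2 \<Omega> T w
     \<and> (AE t in lebesgue_on {0..T}. in_L2 \<Omega> (w t))
     \<and> integrable (lebesgue_on {0..T}) (\<lambda>t. L2_norm \<Omega> (w t) powr p)"

definition Lp_L2_norm :: "(real^'n::finite) set \<Rightarrow> real \<Rightarrow> real \<Rightarrow> (real \<Rightarrow> real^'n \<Rightarrow> real) \<Rightarrow> real" where
  "Lp_L2_norm \<Omega> p T w = (integral\<^sup>L (lebesgue_on {0..T}) (\<lambda>t. L2_norm \<Omega> (w t) powr p)) powr (1/p)"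

definition Lp_H2 :: "(real^'n::finite) set \<Rightarrow> (nat \<Rightarrow> real) \<Rightarrow> (nat \<Rightarrow> real^'n \<Rightarrow> real)
    \<Rightarrow> real \<Rightarrow> real \<Rightarrow> (real \<Rightarrow> real^'n \<Rightarrow> real) \<Rightarrow> bool" where
  "Lp_H2 \<Omega> lam \<phi> p T w \<longleftrightarrow> weakly_meas_L2 \<Omega> T w
     \<and> (AE t in lebesgue_on {0..T}. in_Hs \<Omega> lam \<phi> 2 (w t))
     \<and> integrable (lebesgue_on {0..T}) (\<lambda>t. Hs_norm \<Omega> lam \<phi> 2 (w t) powr p)"

definition Lp_H2_norm :: "(real^'n::finite) set \<Rightarrow> (nat \<Rightarrow> real) \<Rightarrow> (nat \<Rightarrow> real^'n \<Rightarrow> real)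
    \<Rightarrow> real \<Rightarrow> real \<Rightarrow> (real \<Rightarrow> real^'n \<Rightarrow> real) \<Rightarrow> real" where
  "Lp_H2_norm \<Omega> lam \<phi> p T w =
     (integral\<^sup>L (lebesgue_on {0..T}) (\<lambda>t. Hs_norm \<Omega> lam \<phi> 2 (w t) powr p)) powr (1/p)"

definition abel_kernel :: "(real \<Rightarrow> real) \<Rightarrow> real \<Rightarrow> real" where
  "abel_kernel \<alpha> t = t powr (\<alpha> t - 1) / Gamma (\<alpha> t)"

text \<open>u is a solution of (P) in W^{1,p}(0,T;L^2) \<inter> L^p(0,T;check-H^2), with weak time
  derivative g in L^p(0,T;L^2).  u is taken as its continuous L^2-valued representative
  (u t = u0 + int_0^t g), so u(0) = u0 in L^2; the homogeneous Dirichlet condition is encoded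
  by u(t) in check-H^2 = H^2 cap H^1_0; the equation, an identity in L^2(Omega) for a.e. t, is
  written by testing against the complete orthonormal eigenbasis, where (Delta v, phi_i) = -lam_i (v, phi_i).\<close>
definition is_solution ::
  "(real^'n::finite) set \<Rightarrow> (nat \<Rightarrow> real) \<Rightarrow> (nat \<Rightarrow> real^'n \<Rightarrow> real) \<Rightarrow> real \<Rightarrow> real
   \<Rightarrow> (real \<Rightarrow> real) \<Rightarrow> real \<Rightarrow> real \<Rightarrow> (real \<Rightarrow> real^'n \<Rightarrow> real) \<Rightarrow> (real^'n \<Rightarrow> real)
   \<Rightarrow> (real \<Rightarrow> real^'n \<Rightarrow> real) \<Rightarrow> (real \<Rightarrow> real^'n \<Rightarrow> real) \<Rightarrow> bool" where
  "is_solution \<Omega> lam \<phi> \<mu> \<zeta> \<alpha> p T f u0 u g \<longleftrightarrow>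
     Lp_L2 \<Omega> p T u \<and> Lp_L2 \<Omega> p T g \<and> Lp_H2 \<Omega> lam \<phi> p T u
   \<and> (\<forall>t\<in>{0..T}. in_L2 \<Omega> (u t)
        \<and> (\<forall>i. L2_inner \<Omega> (u t) (\<phi> i)
               = L2_inner \<Omega> u0 (\<phi> i) + (LINT s:{0..t}|lebesgue. L2_inner \<Omega> (g s) (\<phi> i))))
   \<and> (AE t in lebesgue_on {0..T}. \<forall>i.
        set_integrable lebesgue {0..t} (\<lambda>s. abel_kernel \<alpha> (t - s) * L2_inner \<Omega> (u s) (\<phi> i))
      \<and> L2_inner \<Omega> (g t) (\<phi> i) + \<mu> * lam i * L2_inner \<Omega> (u t) (\<phi> i)
          + \<zeta> * lam i * (LINT s:{0..t}|lebesgue. abel_kernel \<alpha> (t - s) * L2_inner \<Omega> (u s) (\<phi> i))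
        = L2_inner \<Omega> (f t) (\<phi> i))"

end

theory Submission
  imports Defs
begin

text \<open>
  Expanding in the eigenbasis turns the problem into scalar Volterra equations
  \<open>y' + \<mu> \<lambda> y + \<zeta> \<lambda> (k * y) = f\<close>, one for each eigenvalue \<open>\<lambda>\<close>. Since \<open>\<alpha> 0 = 1\<close> and \<open>\<alpha>\<close> is Lipschitz,
  the kernel \<open>k\<close> is bounded on \<open>(0, T]\<close>, so the memory term is a Gronwall perturbation of the heat
  equation, and all that is needed is maximal \<open>L\<^sup>p\<close> regularity of the latter, with a constant
  independent of the number of modes: the operators \<open>S\<^sub>l f t = \<integral>\<^sub>0\<^sup>t l e\<^bsup>-l(t-s)\<^esup> f s ds\<close> satisfy
  \<open>\<parallel>(\<Sum>\<^sub>i |S\<^bsub>l\<^sub>i\<^esub> f\<^sub>i|\<^sup>2)\<^bsup>1/2\<^esup>\<parallel>\<^sub>p \<le> C\<^sub>p \<parallel>(\<Sum>\<^sub>i |f\<^sub>i|\<^sup>2)\<^bsup>1/2\<^esup>\<parallel>\<^sub>p\<close>.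

  For \<open>p > 2\<close> put \<open>v\<^sub>i = S\<^bsub>l\<^sub>i\<^esub> f\<^sub>i\<close> and test with the weight \<open>h = |v|\<^bsup>p-2\<^esup>\<close>. The kernels of \<open>S\<^sub>l\<close> are
  subprobability densities, so \<open>|S\<^sub>l f|\<^sup>2 \<le> S\<^sub>l |f|\<^sup>2\<close>, and by duality \<open>\<integral> |v|\<^sup>2 h \<le> \<integral> \<Sum>\<^sub>i |f\<^sub>i|\<^sup>2 S\<^bsub>l\<^sub>i\<^esub>\<^sup>* h
  \<le> \<integral> |f|\<^sup>2 M h\<close> with the maximal function \<open>M h = sup\<^sub>i S\<^bsub>l\<^sub>i\<^esub>\<^sup>* h\<close>, which is bounded on \<open>L\<^sup>q\<close>, \<open>q = p/(p-2)\<close>.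
  The case \<open>p < 2\<close> follows by duality. A uniform lower bound on the eigenvalues comes from the
  maximum principle.
\<close>

section \<open>A maximal inequality for exponential averages\<close>

text \<open>For p other than 2, bounds for the single modes do not add up to a bound for the square
  function over all modes, even if their constants do not depend on the rates; hence whole families
  are estimated at once. Positivity of the exponential kernels takes the place of singular integral
  theory. The memory term carries the same factor \<lambda> as the diffusion, so it is not of lower
  order in space. It is of lower order in time only: for w = \<lambda> y, boundedness of the kernel
  gives |k * w| (t) \<le> K times the integral of |w| over [0, t]. So maximal regularity has to hold
  on every [0, t] with one constant, and Gronwall's inequality acts on the integral of |w|^p over
  [0, t], with |w| the square function, instead of on |w| itself. The estimates are proved for
  finitely many modes, with Borel forcing and continuous solutions; the infinite system is reached
  by monotone convergence of truncated norms and by the Riesz-Fischer theorem. The spectral lower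
  bound is what turns control of \<lambda> y into control of y.\<close>

lemma continuous_on_Max:
  fixes f :: "'i \<Rightarrow> 'a::topological_space \<Rightarrow> real"
  assumes "finite I" "\<And>i. i \<in> I \<Longrightarrow> continuous_on S (f i)"
  shows "continuous_on S (\<lambda>x. Max (insert 0 ((\<lambda>i. f i x) ` I)))"
  using assms
proof (induction I rule: finite_induct)
  case (insert j I)
  have "(\<lambda>x. Max (insert 0 ((\<lambda>i. f i x) ` insert j I)))
      = (\<lambda>x. max (f j x) (Max (insert 0 ((\<lambda>i. f i x) ` I))))"
    using insert.hyps by (subst image_insert, subst insert_commute) (simp add: max.commute)
  then show ?case
    by (simp only:) (intro continuous_on_max insert; simp)
qed simp

text \<open>For a slope d > 0 the set of y with \<open>G a \<le> G y + d * (y - a)\<close> is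
  compact and contains a; a largest element below b would be exceeded, by the hypothesis with e = d.
  The Dini form is chosen because the potential to which this is applied is an integral of maxima:
  its growth to the right can be bounded from below although no derivative is at hand.\<close>

lemma nondecreasing_if_lower_right_Dini_nonneg:
  fixes G :: "real \<Rightarrow> real"
  assumes "a \<le> b" and cont: "continuous_on {a..b} G"
    and dini: "\<And>x e. a \<le> x \<Longrightarrow> x < b \<Longrightarrow> 0 < e \<Longrightarrow>
      eventually (\<lambda>y. G x - e * (y - x) \<le> G y) (at x within {x..b})"
  shows "G a \<le> G b"
proof (rule field_le_epsilon)
  fix e :: real assume "0 < e"
  \<comment> \<open>Gives d * (b - a) \<le> e; the added 1 covers a = b.\<close>
  define d where "d = e / (b - a + 1)"
  have "0 < d" using \<open>0 < e\<close> \<open>a \<le> b\<close> by (simp add: d_def)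
  define K where "K = {y \<in> {a..b}. G a \<le> G y + d * (y - a)}"
  have "closed K"
  proof -
    have "K = {a..b} \<inter> (\<lambda>y. G y + d * (y - a)) -` {G a..}" by (auto simp: K_def)
    then show ?thesis
      by (simp only:) (intro continuous_closed_preimage continuous_intros cont; simp)
  qed
  moreover have "K \<subseteq> {a..b}" by (auto simp: K_def)
  ultimately have "compact K"
    using compact_Int_closed[OF compact_Icc] by (metis inf.absorb2)
  moreover have "K \<noteq> {}" using \<open>a \<le> b\<close> by (auto simp: K_def intro!: exI[of _ a])
  ultimately obtain c where c: "c \<in> K" "\<And>y. y \<in> K \<Longrightarrow> y \<le> c"
    using compact_attains_sup[of K] by metis
  have "c = b"
  proof (rule ccontr)
    assume "c \<noteq> b"
    then have "a \<le> c" "c < b" using c(1) by (auto simp: K_def)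
    have "eventually (\<lambda>y. G c - d * (y - c) \<le> G y) (at c within {c..b})"
      using dini \<open>a \<le> c\<close> \<open>c < b\<close> \<open>0 < d\<close> by blast
    moreover have "eventually (\<lambda>y. y \<in> {c<..b}) (at c within {c..b})"
      by (auto simp: eventually_at_filter)
    moreover have "at c within {c..b} \<noteq> bot"
      using \<open>c < b\<close> by (simp add: at_within_Icc_at_right)
    ultimately obtain y where y: "G c - d * (y - c) \<le> G y" "y \<in> {c<..b}"
      using eventually_happens'[OF _ eventually_conj, of "at c within {c..b}"
        "\<lambda>y. G c - d * (y - c) \<le> G y" "\<lambda>y. y \<in> {c<..b}"] by auto
    then have "y \<in> K" using c(1) by (auto simp: K_def algebra_simps)
    then show False using c(2) \<open>y \<in> {c<..b}\<close> by force
  qed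
  then have "G a \<le> G b + d * (b - a)" using c(1) by (simp add: K_def)
  also have "d * (b - a) \<le> e"
    using \<open>0 < e\<close> \<open>a \<le> b\<close> by (simp add: d_def field_simps)
  finally show "G a \<le> G b + e" by simp
qed

lemma integral_powr_0:
  fixes a m :: real
  assumes "0 < a" "0 \<le> m"
  shows "((\<lambda>r. r powr a) has_integral (m powr (a + 1) / (a + 1))) {0..m}"
proof -
  have "((\<lambda>r. r powr a) has_integral (m powr (a + 1) / (a + 1) - 0 powr (a + 1) / (a + 1))) {0..m}"
  proof (rule fundamental_theorem_of_calculus_interior)
    show "continuous_on {0..m} (\<lambda>r. r powr (a + 1) / (a + 1))"
      using assms by (intro continuous_intros continuous_on_powr') auto
    fix x assume "x \<in> {0<..<m}"
    then show "((\<lambda>r. r powr (a + 1) / (a + 1)) has_vector_derivative x powr a) (at x)"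
      using assms by (auto intro!: derivative_eq_intros simp flip: has_real_derivative_iff_has_vector_derivative)
  qed (use assms in auto)
  then show ?thesis by simp
qed

lemma continuous_on_powr_nonneg:
  fixes f :: "'a::topological_space \<Rightarrow> real"
  assumes "continuous_on S f" "\<And>x. x \<in> S \<Longrightarrow> 0 \<le> f x" "0 < a"
  shows "continuous_on S (\<lambda>x. f x powr a)"
  using assms by (intro continuous_on_powr') auto

text \<open>A Bellman-type potential: with \<open>U \<theta> s = max\<^sub>i (H\<^sub>i s - \<theta>)\<^sup>+ / l\<^sub>i\<close>, the equation
  \<open>H\<^sub>i' = l\<^sub>i (H\<^sub>i - h)\<close> gives \<open>- U' \<le> h - \<theta>\<close> on \<open>{U > 0} = {M > \<theta>}\<close> whatever the rates \<open>l\<^sub>i\<close> are.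
  Integrating in the level \<open>\<theta> = r powr (1/(q-1))\<close> makes the right-hand side continuous in \<open>s\<close>.\<close>
lemma maximal_inequality_weighted:
  fixes h :: "real \<Rightarrow> real" and H :: "nat \<Rightarrow> real \<Rightarrow> real" and l :: "nat \<Rightarrow> real"
  assumes T: "0 \<le> T" and q: "1 < q" and fin: "finite I"
    and h: "continuous_on {0..T} h" and l: "\<And>i. i \<in> I \<Longrightarrow> 0 < l i"
    and H: "\<And>i t. i \<in> I \<Longrightarrow> t \<in> {0..T} \<Longrightarrow>
      (H i has_real_derivative l i * (H i t - h t)) (at t within {0..T})"
    and HT: "\<And>i. i \<in> I \<Longrightarrow> H i T = 0"
  defines "M \<equiv> \<lambda>t. Max (insert 0 ((\<lambda>i. H i t) ` I))"
  shows "(q - 1) / q * integral {0..T} (\<lambda>t. M t powr q)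
    \<le> integral {0..T} (\<lambda>t. h t * M t powr (q - 1))"
proof -
  have Hc: "continuous_on {0..T} (H i)" if "i \<in> I" for i
    using H[OF that] by (rule DERIV_continuous_on)
  have Mc: "continuous_on {0..T} M"
    unfolding M_def using fin Hc by (rule continuous_on_Max)
  have M0: "0 \<le> M t" for t unfolding M_def using fin by simp
  have HM: "H i t \<le> M t" if "i \<in> I" for i t unfolding M_def using fin that by simp
  \<comment> \<open>The level is \<theta> = r^a, so dr = (q - 1) \<theta>^(q - 2) d\<theta>.
    Integrating h - \<theta> over the levels below M gives exactly
    \<open>h * M powr (q - 1) - (q - 1) / q * M powr q\<close>, the two terms of the claim.\<close>
  define a where "a = 1 / (q - 1)"
  have a: "0 < a" using q by (simp add: a_def)
  \<comment> \<open>R bounds the levels r = M^(q - 1) on all of [0, T], so that B can integrate over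
    a fixed range: beyond the level of M x the potential vanishes at x.\<close>
  obtain R where R: "\<And>t. t \<in> {0..T} \<Longrightarrow> M t powr (q - 1) \<le> R" "0 < R"
  proof -
    have "compact ((\<lambda>t. M t powr (q - 1)) ` {0..T})"
      by (intro compact_continuous_image continuous_on_powr_nonneg Mc M0) (use q in auto)
    then have "bounded ((\<lambda>t. M t powr (q - 1)) ` {0..T})" by (rule compact_imp_bounded)
    then show ?thesis using that unfolding bounded_pos by force
  qed
  define U where "U \<theta> s = Max (insert 0 ((\<lambda>i. (H i s - \<theta>) / l i) ` I))" for \<theta> s
  have U0: "0 \<le> U \<theta> s" for \<theta> s unfolding U_def using fin by simp
  have Ui: "(H i s - \<theta>) / l i \<le> U \<theta> s" if "i \<in> I" for i \<theta> s unfolding U_def using fin that by simp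
  have Ucases: "U \<theta> s = 0 \<or> (\<exists>i\<in>I. U \<theta> s = (H i s - \<theta>) / l i)" for \<theta> s
  proof -
    have "U \<theta> s \<in> insert 0 ((\<lambda>i. (H i s - \<theta>) / l i) ` I)"
      unfolding U_def using fin by (intro Max_in) auto
    then show ?thesis by auto
  qed
  define B where "B s = integral (cbox 0 R) (\<lambda>r. U (r powr a) s)" for s
  have Ucont: "continuous_on ({0..T} \<times> cbox 0 R) (\<lambda>(s, r). U (r powr a) s)"
    unfolding U_def case_prod_beta
  proof (intro continuous_on_Max fin)
    fix i assume "i \<in> I"
    show "continuous_on ({0..T} \<times> cbox 0 R) (\<lambda>p. (H i (fst p) - snd p powr a) / l i)"
      using a l[OF \<open>i \<in> I\<close>] 
      by (intro continuous_intros continuous_on_powr_nonneg continuous_on_compose2[OF Hc[OF \<open>i \<in> I\<close>]])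
         auto
  qed
  have Bc: "continuous_on {0..T} B"
    unfolding B_def using Ucont by (rule integral_continuous_on_param)
  have Uint: "(\<lambda>r. U (r powr a) s) integrable_on {c..d}" if "s \<in> {0..T}" "0 \<le> c" "d \<le> R" for s c d
  proof (rule integrable_continuous_real)
    show "continuous_on {c..d} (\<lambda>r. U (r powr a) s)"
    proof -
      have "continuous_on {c..d} (\<lambda>r. case (s, r) of (s, r) \<Rightarrow> U (r powr a) s)"
        by (rule continuous_on_compose2[OF Ucont, of "{c..d}" "\<lambda>r. (s, r)"])
           (use that in \<open>auto intro!: continuous_on_Pair continuous_on_const continuous_on_id\<close>)
      then show ?thesis by simp
    qed
  qed
  \<comment> \<open>k is the integral of h - r^a over 0 \<le> r \<le> M^(q - 1). The inequality - B'
    \<le> k, in Dini form, says that B plus the integral of k is nondecreasing.\<close>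
  define k where "k t = h t * M t powr (q - 1) - (q - 1) / q * M t powr q" for t
  have kc: "continuous_on {0..T} k"
    unfolding k_def using q by (intro continuous_intros h continuous_on_powr_nonneg Mc M0) auto
  define G where "G s = B s + integral {0..s} k" for s
  have "G 0 \<le> G T"
  proof (rule nondecreasing_if_lower_right_Dini_nonneg[OF T])
    show "continuous_on {0..T} G"
      unfolding G_def using kc
      by (intro continuous_intros Bc indefinite_integral_continuous_1 integrable_continuous_real)
    fix x e :: real assume x: "0 \<le> x" "x < T" and "0 < e"
    define m where "m = M x powr (q - 1)"
    have m: "0 \<le> m" "m \<le> R" using R(1)[of x] x by (auto simp: m_def)
    have ma: "m powr a = M x" using M0[of x] q by (simp add: m_def a_def powr_powr)
    have ma1: "m powr (a + 1) / (a + 1) = (q - 1) / q * M x powr q"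
    proof -
      have "(q - 1) * (a + 1) = q" "a + 1 = q / (q - 1)" using q by (auto simp: a_def field_simps)
      then show ?thesis using q by (simp add: m_def powr_powr)
    qed
    define P where "P = (q - 1) / q * M x powr q"
    \<comment> \<open>Each derivative is used with an error d in the slope. The error enters once
      through the integral of k and once for every level in [0, m], which makes d * (m + 1) = e in
      total.\<close>
    define d where "d = e / (m + 1)"
    have d: "0 < d" "d * (m + 1) = e" using \<open>0 < e\<close> m by (auto simp: d_def)
    have sub: "at x within {x..T} \<le> at x within {0..T}" using x by (intro at_le) auto
    have lower: "eventually (\<lambda>y. f x + (D - d) * (y - x) \<le> f y) (at x within {x..T})"
      if "(f has_real_derivative D) (at x within {0..T})" for f D
    proof -
      have "((\<lambda>y. (f y - f x) / (y - x)) \<longlongrightarrow> D) (at x within {x..T})"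
        using that sub unfolding has_field_derivative_iff by (rule tendsto_mono[rotated])
      then have "eventually (\<lambda>y. D - d < (f y - f x) / (y - x)) (at x within {x..T})"
        by (rule order_tendstoD) (use d in simp)
      moreover have "eventually (\<lambda>y. y \<in> {x<..T}) (at x within {x..T})"
        by (auto simp: eventually_at_filter)
      ultimately show ?thesis
        by eventually_elim (auto simp: field_simps)
    qed
    have "eventually (\<lambda>y. integral {0..x} k + (k x - d) * (y - x) \<le> integral {0..y} k) (at x within {x..T})"
      using x by (intro lower integral_has_real_derivative kc) auto
    moreover have "eventually (\<lambda>y. \<forall>i\<in>I. H i x / l i + ((H i x - h x) - d) * (y - x) \<le> H i y / l i) (at x within {x..T})"
    proof (intro eventually_ball_finite fin ballI)
      fix i assume i: "i \<in> I"
      have "((\<lambda>y. H i y / l i) has_real_derivative l i * (H i x - h x) / l i) (at x within {0..T})"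
        using H[OF i] x by (intro DERIV_cdivide) auto
      then have "((\<lambda>y. H i y / l i) has_real_derivative H i x - h x) (at x within {0..T})"
        using l[OF i] by simp
      then show "eventually (\<lambda>y. H i x / l i + ((H i x - h x) - d) * (y - x) \<le> H i y / l i) (at x within {x..T})"
        by (rule lower)
    qed
    moreover have "eventually (\<lambda>y. y \<in> {x<..T}) (at x within {x..T})"
      by (auto simp: eventually_at_filter)
    ultimately show "eventually (\<lambda>y. G x - e * (y - x) \<le> G y) (at x within {x..T})"
    proof eventually_elim
      case (elim y)
      have yT: "y \<in> {0..T}" "x < y" using elim(3) x by auto
      \<comment> \<open>The index i attains U \<theta> x if that is nonzero, and M x otherwise; in
        both cases H i x \<ge> \<theta>. Since H i / l i has derivative H i - h, free of the rate, U
        \<theta> grows at least with slope \<theta> - h x, up to the error d.\<close>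
      have step: "U \<theta> x + (\<theta> - h x - d) * (y - x) \<le> U \<theta> y" if "\<theta> \<le> M x" "0 < M x" for \<theta>
      proof -
        have "\<exists>i\<in>I. U \<theta> x \<le> (H i x - \<theta>) / l i \<and> \<theta> \<le> H i x"
        proof -
          have "M x \<in> insert 0 ((\<lambda>i. H i x) ` I)" unfolding M_def using fin by (intro Max_in) auto
          then obtain j where j: "j \<in> I" "M x = H j x" using \<open>0 < M x\<close> by auto
          show ?thesis
          proof (cases "U \<theta> x = 0")
            case True
            then show ?thesis using j \<open>\<theta> \<le> M x\<close> l[OF j(1)] by (intro bexI[of _ j]) auto
          next
            case False
            then obtain i where i: "i \<in> I" "U \<theta> x = (H i x - \<theta>) / l i" using Ucases by blast
            then have "0 \<le> (H i x - \<theta>) / l i" using U0[of \<theta> x] by simp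
            then have "\<theta> \<le> H i x" using l[OF i(1)] by (simp add: zero_le_divide_iff)
            then show ?thesis using i by auto
          qed
        qed
        then obtain i where i: "i \<in> I" "U \<theta> x \<le> (H i x - \<theta>) / l i" "\<theta> \<le> H i x" by blast
        have "(\<theta> - h x - d) * (y - x) \<le> (H i x - h x - d) * (y - x)"
          using i(3) yT by (intro mult_right_mono) auto
        then have "U \<theta> x + (\<theta> - h x - d) * (y - x) \<le> H i x / l i - \<theta> / l i + (H i x - h x - d) * (y - x)"
          using i(2) by (simp add: diff_divide_distrib)
        also have "\<dots> \<le> (H i y - \<theta>) / l i"
          using elim(2) i(1) by (auto simp: diff_divide_distrib)
        also have "\<dots> \<le> U \<theta> y" using i(1) by (rule Ui)
        finally show ?thesis .
      qed
      have Usup: "U \<theta> x = 0" if "M x \<le> \<theta>" for \<theta>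
      proof -
        have "(H i x - \<theta>) / l i \<le> 0" if "i \<in> I" for i
          using HM[OF that, of x] l[OF that] \<open>M x \<le> \<theta>\<close> by (simp add: divide_le_0_iff)
        then show ?thesis using Ucases[of \<theta> x] U0[of \<theta> x] by force
      qed
      have split: "B s = integral {0..m} (\<lambda>r. U (r powr a) s) + integral {m..R} (\<lambda>r. U (r powr a) s)"
        if "s \<in> {0..T}" for s
        unfolding B_def cbox_interval using m Uint[OF that, of 0 R]
        by (simp add: Henstock_Kurzweil_Integration.integral_combine)
      have "integral {m..R} (\<lambda>r. U (r powr a) x) = 0"
      proof -
        have "U (r powr a) x = 0" if "r \<in> {m..R}" for r
          using that m a ma by (intro Usup) (metis atLeastAtMost_iff less_imp_le powr_mono2)
        then show ?thesis by (subst integral_cong[where g="\<lambda>_. 0"]) auto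
      qed
      \<comment> \<open>Levels above m may become active at y > x. They can only increase B, so
        nonnegativity suffices for a lower bound.\<close>
      moreover have "0 \<le> integral {m..R} (\<lambda>r. U (r powr a) y)"
        using U0 yT m by (intro integral_nonneg Uint) auto
      moreover have "integral {0..m} (\<lambda>r. U (r powr a) x) +
          ((q - 1) / q * M x powr q - (h x + d) * m) * (y - x) \<le> integral {0..m} (\<lambda>r. U (r powr a) y)"
      proof (cases "M x = 0")
        case True
        then show ?thesis using q by (simp add: m_def)
      next
        case False
        then have "0 < M x" using M0[of x] by simp
        have "((\<lambda>r. U (r powr a) x + (r powr a - (h x + d)) * (y - x)) has_integral
            (integral {0..m} (\<lambda>r. U (r powr a) x) + (m powr (a + 1) / (a + 1) - (h x + d) * m) * (y - x))) {0..m}"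
          using has_integral_const_real[of "h x + d" 0 m] m
          by (intro has_integral_add has_integral_mult_left has_integral_diff integral_powr_0
              integrable_integral Uint a) (use x in \<open>auto simp: mult.commute\<close>)
        then show ?thesis
          unfolding ma1
        proof (rule has_integral_le)
          show "((\<lambda>r. U (r powr a) y) has_integral integral {0..m} (\<lambda>r. U (r powr a) y)) {0..m}"
            using yT m by (intro integrable_integral Uint) auto
          fix r assume "r \<in> {0..m}"
          then have "r powr a \<le> M x" using a ma by (metis atLeastAtMost_iff less_imp_le powr_mono2)
          then show "U (r powr a) x + (r powr a - (h x + d)) * (y - x) \<le> U (r powr a) y"
            using step[of "r powr a"] \<open>0 < M x\<close> by (simp add: algebra_simps)
        qed
      qed
      ultimately have "B x + (P - (h x + d) * m) * (y - x) \<le> B y"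
        using split[of x] split[of y] x yT by (simp add: P_def)
      moreover have "k x * (y - x) = (h x * m - P) * (y - x)" by (simp add: k_def m_def P_def)
      moreover have "e * (y - x) = (d * m + d) * (y - x)" using d(2) by (simp add: algebra_simps)
      ultimately show ?case using elim(1) unfolding G_def by (simp add: algebra_simps)
    qed
  qed
  moreover have "B T = 0"
  proof -
    have "U (r powr a) T = 0" for r
    proof -
      have "(H i T - r powr a) / l i \<le> 0" if "i \<in> I" for i
        using HT[OF that] l[OF that] by (simp add: divide_le_0_iff)
      then show ?thesis using Ucases[of "r powr a" T] U0[of "r powr a" T] by force
    qed
    then show ?thesis by (simp add: B_def)
  qed
  moreover have "0 \<le> B 0"
    unfolding B_def cbox_interval using U0 T by (intro integral_nonneg Uint) auto
  ultimately have "0 \<le> integral {0..T} k" by (simp add: G_def)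
  also have "integral {0..T} k = integral {0..T} (\<lambda>t. h t * M t powr (q - 1)) -
      (q - 1) / q * integral {0..T} (\<lambda>t. M t powr q)"
    unfolding k_def using q
    by (subst Henstock_Kurzweil_Integration.integral_diff)
       (auto intro!: integrable_continuous_real continuous_intros h continuous_on_powr_nonneg Mc M0)
  finally show ?thesis by simp
qed

lemma Young_eps:
  fixes q r e :: real
  assumes "1 < q" "1 < r" "1 / q + 1 / r = 1" "0 < e"
  shows "\<exists>C>0. \<forall>a\<ge>0. \<forall>b\<ge>0. a * b \<le> e * a powr q + C * b powr r"
proof -
  \<comment> \<open>With this scaling the first Young term (c a)^q / q is exactly e a^q.\<close>
  define c where "c = (e * q) powr (1 / q)"
  have c: "0 < c" "c powr q = e * q" using assms by (auto simp: c_def powr_powr)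
  have "a * b \<le> e * a powr q + (1 / c) powr r / r * b powr r" if "0 \<le> a" "0 \<le> b" for a b
  proof -
    have "a * b = (c * a) * (b / c)" using c by simp
    also have "\<dots> \<le> (c * a) powr q / q + (b / c) powr r / r"
      using assms c that by (intro Youngs_inequality) auto
    also have "(c * a) powr q / q = e * a powr q"
      using c that assms by (simp add: powr_mult)
    also have "(b / c) powr r / r = (1 / c) powr r / r * b powr r"
      using c that by (simp add: powr_divide)
    finally show ?thesis .
  qed
  moreover have "0 < (1 / c) powr r / r" using c assms by simp
  ultimately show ?thesis by blast
qed

text \<open>C is fixed before T, the index set and the rates; this uniformity is the point of the
  notion. The averages H are given through the terminal value problem that they solve, since that is
  all the potential argument refers to.\<close>

definition maximal_bound :: "real \<Rightarrow> real \<Rightarrow> bool" where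
  "maximal_bound q C \<longleftrightarrow> (\<forall>T\<ge>0. \<forall>I::nat set. \<forall>h H l. finite I \<longrightarrow>
     continuous_on {0..T} h \<longrightarrow> (\<forall>t\<in>{0..T}. 0 \<le> h t) \<longrightarrow>
     (\<forall>i\<in>I. 0 < l i \<and> H i T = 0 \<and>
       (\<forall>t\<in>{0..T}. (H i has_real_derivative l i * (H i t - h t)) (at t within {0..T}))) \<longrightarrow>
     integral {0..T} (\<lambda>t. Max (insert 0 ((\<lambda>i. H i t) ` I)) powr q) \<le> C * integral {0..T} (\<lambda>t. h t powr q))"

text \<open>Young's inequality with exponents q / (q - 1) and q splits h M^(q - 1). As e is half of
  (q - 1) / q, the left side absorbs the term in M, whose integral is finite because M is continuous
  on a compact interval.\<close>

lemma maximal_inequality: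
  assumes q: "1 < q"
  shows "\<exists>C>0. maximal_bound q C"
proof -
  define e where "e = (q - 1) / (2 * q)"
  have "2 * e = (q - 1) / q" using q by (simp add: e_def field_simps)
  have "0 < e" using q by (simp add: e_def)
  moreover have "1 < q / (q - 1)" "1 / (q / (q - 1)) + 1 / q = 1" using q by (auto simp: field_simps)
  ultimately obtain C where C: "0 < C"
    "\<And>a b. 0 \<le> a \<Longrightarrow> 0 \<le> b \<Longrightarrow> a * b \<le> e * a powr (q / (q - 1)) + C * b powr q"
    using Young_eps[of "q / (q - 1)" q e] q by blast
  show ?thesis
    unfolding maximal_bound_def
  proof (intro exI[of _ "C / e"] conjI allI impI)
    show "0 < C / e" using \<open>0 < C\<close> \<open>0 < e\<close> by simp
    fix T :: real and I :: "nat set" and h :: "real \<Rightarrow> real" and H :: "nat \<Rightarrow> real \<Rightarrow> real" and l :: "nat \<Rightarrow> real"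
    assume T: "0 \<le> T" and fin: "finite I" and h: "continuous_on {0..T} h" and h0: "\<forall>t\<in>{0..T}. 0 \<le> h t"
      and *: "\<forall>i\<in>I. 0 < l i \<and> H i T = 0 \<and>
       (\<forall>t\<in>{0..T}. (H i has_real_derivative l i * (H i t - h t)) (at t within {0..T}))"
    define M where "M t = Max (insert 0 ((\<lambda>i. H i t) ` I))" for t
    have M0: "0 \<le> M t" for t unfolding M_def using fin by simp
    have Mc: "continuous_on {0..T} M"
      unfolding M_def
    proof (intro continuous_on_Max fin)
      fix i assume "i \<in> I"
      then show "continuous_on {0..T} (H i)"
        using * by (intro DERIV_continuous_on[where D="\<lambda>t. l i * (H i t - h t)"]) auto
    qed
    have int: "(\<lambda>t. M t powr q) integrable_on {0..T}" "(\<lambda>t. h t powr q) integrable_on {0..T}"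
       "(\<lambda>t. h t * M t powr (q - 1)) integrable_on {0..T}"
      using q h0 by (auto intro!: integrable_continuous_real continuous_intros h continuous_on_powr_nonneg Mc M0)
    have "2 * e * integral {0..T} (\<lambda>t. M t powr q) \<le> integral {0..T} (\<lambda>t. h t * M t powr (q - 1))"
      using maximal_inequality_weighted[OF T q fin h, of l H] * \<open>2 * e = (q - 1) / q\<close> unfolding M_def by simp
    also have "\<dots> \<le> integral {0..T} (\<lambda>t. e * M t powr q + C * h t powr q)"
    proof (intro integral_le int integrable_add integrable_on_mult_right)
      fix t assume "t \<in> {0..T}"
      then have "M t powr (q - 1) * h t \<le> e * (M t powr (q - 1)) powr (q / (q - 1)) + C * h t powr q"
        using h0 by (intro C) auto
      then show "h t * M t powr (q - 1) \<le> e * M t powr q + C * h t powr q"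
        using q by (simp add: powr_powr mult.commute)
    qed
    also have "\<dots> = e * integral {0..T} (\<lambda>t. M t powr q) + C * integral {0..T} (\<lambda>t. h t powr q)"
      using int by (subst Henstock_Kurzweil_Integration.integral_add) (auto intro!: integrable_on_mult_right)
    finally show "integral {0..T} (\<lambda>t. Max (insert 0 ((\<lambda>i. H i t) ` I)) powr q) \<le> C / e * integral {0..T} (\<lambda>t. h t powr q)"
      using \<open>0 < e\<close> unfolding M_def by (simp add: field_simps)
  qed
qed

section \<open>Relaxation operators and maximal regularity\<close>

lemma absolutely_integrable_continuous_mult:
  fixes f g :: "real \<Rightarrow> real"
  assumes "continuous_on {a..b} g" "f absolutely_integrable_on {a..b}"
  shows "(\<lambda>s. g s * f s) absolutely_integrable_on {a..b}"
  using assms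
  by (intro absolutely_integrable_bounded_measurable_product_real continuous_imp_measurable_on_sets_lebesgue
      compact_imp_bounded compact_continuous_image) auto

lemma borel_absolutely_integrable_lborel:
  fixes f :: "real \<Rightarrow> real"
  assumes [measurable]: "f \<in> borel_measurable borel" and "f absolutely_integrable_on {a..b}"
  shows "integrable lborel (\<lambda>x. indicator {a..b} x * f x)"
    and "integral\<^sup>L lborel (\<lambda>x. indicator {a..b} x * f x) = integral {a..b} f"
proof -
  have "integrable lebesgue (\<lambda>x. indicator {a..b} x * f x)"
    using assms(2) by (simp add: set_integrable_def)
  then show *: "integrable lborel (\<lambda>x. indicator {a..b} x * f x)"
    by (subst (asm) integrable_completion) auto
  then show "integral\<^sup>L lborel (\<lambda>x. indicator {a..b} x * f x) = integral {a..b} f"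
    using set_borel_integral_eq_integral(2)[of "{a..b}" f]
    by (simp add: set_integrable_def set_lebesgue_integral_def)
qed

text \<open>Fubini's theorem on the triangle s \<le> t. The Borel assumption on f provides
  measurability for the product of two copies of \<open>lborel\<close>; this is why forcing terms
  are kept Borel from here on. The factor g is controlled on [0, T] only and is cut off by an
  indicator.\<close>

lemma integral_triangle_swap:
  fixes f g :: "real \<Rightarrow> real"
  assumes [measurable]: "f \<in> borel_measurable borel" and f: "f absolutely_integrable_on {0..T}"
    and g: "continuous_on {0..T} g"
  shows "integral {0..T} (\<lambda>t. integral {0..t} f * g t) = integral {0..T} (\<lambda>s. f s * integral {s..T} g)"
proof -
  interpret lborel_pair: pair_sigma_finite lborel lborel ..
  define F where "F s = indicator {0..T} s * f s" for s
  define G where "G t = indicator {0..T} t * g t" for t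
  have gm: "(\<lambda>t. indicator {0..T} t *\<^sub>R g t) \<in> borel_measurable borel"
    using borel_measurable_continuous_on_indicator[OF _ g] by simp
  have Gm [measurable]: "G \<in> borel_measurable borel" using gm unfolding G_def[abs_def] by simp
  have Fm [measurable]: "F \<in> borel_measurable borel" unfolding F_def by measurable
  have Fi: "integrable lborel F"
    unfolding F_def using borel_absolutely_integrable_lborel(1)[OF assms(1,2)] by simp
  have Ga: "G absolutely_integrable_on {0..T}"
    using absolutely_integrable_continuous_real[OF g]
    by (subst set_integrable_cong[where f'=g]) (auto simp: G_def)
  have Gi: "integrable lborel G"
    using borel_absolutely_integrable_lborel(1)[OF Gm Ga]
    by (rule back_subst[where P="integrable lborel"]) (auto simp: G_def fun_eq_iff indicator_def)
  define k where "k = (\<lambda>(s, t). if s \<le> t then F s * G t else 0)"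
  have km [measurable]: "k \<in> borel_measurable (lborel \<Otimes>\<^sub>M lborel)"
    unfolding k_def by measurable
  have kint: "integrable (lborel \<Otimes>\<^sub>M lborel) k"
  proof (rule Bochner_Integration.integrable_bound)
    show "integrable (lborel \<Otimes>\<^sub>M lborel) (\<lambda>(s, t). F s * G t)"
    proof (rule lborel_pair.Fubini_integrable)
      show "(\<lambda>(s, t). F s * G t) \<in> borel_measurable (lborel \<Otimes>\<^sub>M lborel)" by measurable
      show "integrable lborel (\<lambda>s. \<integral> t. norm (case (s, t) of (s, t) \<Rightarrow> F s * G t) \<partial>lborel)"
        using Fi Gi by (simp add: abs_mult)
      show "AE s in lborel. integrable lborel (\<lambda>t. case (s, t) of (s, t) \<Rightarrow> F s * G t)"
        using Gi by simp
    qed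
    show "AE x in lborel \<Otimes>\<^sub>M lborel. norm (k x) \<le> norm (case x of (s, t) \<Rightarrow> F s * G t)"
      by (auto simp: k_def indicator_def)
  qed (fact km)
  have 1: "(\<integral>s. k (s, t) \<partial>lborel) = indicator {0..T} t * (integral {0..t} f * g t)" for t
  proof (cases "t \<in> {0..T}")
    case True
    then have "f absolutely_integrable_on {0..t}"
      using f by (auto intro: absolutely_integrable_on_subinterval)
    then have "(\<integral>s. indicator {0..t} s * f s \<partial>lborel) = integral {0..t} f"
      by (intro borel_absolutely_integrable_lborel assms)
    moreover have "k (s, t) = (indicator {0..t} s * f s) * g t" for s
      using True by (auto simp: k_def F_def G_def indicator_def)
    ultimately show ?thesis using True by simp
  next
    case False
    then have "k (s, t) = 0" for s by (auto simp: k_def G_def)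
    then show ?thesis using False by simp
  qed
  have 2: "(\<integral>t. k (s, t) \<partial>lborel) = indicator {0..T} s * (f s * integral {s..T} g)" for s
  proof (cases "s \<in> {0..T}")
    case True
    then have "G absolutely_integrable_on {s..T}"
      using Ga by (auto intro: absolutely_integrable_on_subinterval)
    then have "(\<integral>t. indicator {s..T} t * G t \<partial>lborel) = integral {s..T} G"
      by (intro borel_absolutely_integrable_lborel) auto
    moreover have "integral {s..T} G = integral {s..T} g"
      using True by (intro integral_cong) (auto simp: G_def)
    moreover have "k (s, t) = f s * (indicator {s..T} t * G t)" for t
      using True by (auto simp: k_def F_def G_def indicator_def)
    ultimately show ?thesis using True by simp
  next
    case False
    then have "k (s, t) = 0" for t by (auto simp: k_def F_def)
    then show ?thesis using False by simp
  qed
  have "continuous_on {0..T} (\<lambda>t. integral {0..t} f * g t)"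
    using f g by (intro continuous_intros indefinite_integral_continuous_1) (auto simp: absolutely_integrable_on_def)
  then have "set_integrable lborel {0..T} (\<lambda>t. integral {0..t} f * g t)"
    by (rule borel_integrable_atLeastAtMost'[unfolded set_integrable_def[symmetric]])
  from set_borel_integral_eq_integral(2)[OF this]
  have "integral {0..T} (\<lambda>t. integral {0..t} f * g t) = (\<integral>t. (\<integral>s. k (s, t) \<partial>lborel) \<partial>lborel)"
    by (simp add: 1 set_lebesgue_integral_def)
  also have "\<dots> = (\<integral>s. (\<integral>t. k (s, t) \<partial>lborel) \<partial>lborel)"
    using lborel_pair.Fubini_integral[of "\<lambda>s t. k (s, t)"] kint by simp
  also have "\<dots> = integral {0..T} (\<lambda>s. f s * integral {s..T} g)"
  proof -
    have "integrable lborel (\<lambda>s. \<integral>t. k (s, t) \<partial>lborel)"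
      using lborel_pair.integrable_fst[of "\<lambda>s t. k (s, t)"] kint by simp
    then have "set_integrable lborel {0..T} (\<lambda>s. f s * integral {s..T} g)"
      by (simp add: 2 set_integrable_def)
    from set_borel_integral_eq_integral(2)[OF this] show ?thesis
      by (simp add: 2 set_lebesgue_integral_def)
  qed
  finally show ?thesis .
qed

text \<open>The solution operators of \<open>v' = l (f - v)\<close>, \<open>v 0 = 0\<close> and of the adjoint problem
  \<open>H' = l (H - h)\<close>, \<open>H T = 0\<close>.\<close>

definition relax :: "real \<Rightarrow> (real \<Rightarrow> real) \<Rightarrow> real \<Rightarrow> real" where
  "relax l f t = l * exp (- (l * t)) * integral {0..t} (\<lambda>s. exp (l * s) * f s)"

definition relax_adj :: "real \<Rightarrow> real \<Rightarrow> (real \<Rightarrow> real) \<Rightarrow> real \<Rightarrow> real" where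
  "relax_adj l T h s = l * exp (l * s) * integral {s..T} (\<lambda>t. exp (- (l * t)) * h t)"

lemma absolutely_integrable_exp_mult:
  fixes f :: "real \<Rightarrow> real"
  assumes "f absolutely_integrable_on {a..b}"
  shows "(\<lambda>s. exp (l * s) * f s) absolutely_integrable_on {a..b}"
  using assms by (intro absolutely_integrable_continuous_mult continuous_intros)

lemma relax_continuous:
  assumes "f absolutely_integrable_on {0..T}"
  shows "continuous_on {0..T} (relax l f)"
  unfolding relax_def using absolutely_integrable_exp_mult[OF assms, of l]
  by (intro continuous_intros indefinite_integral_continuous_1) (simp add: absolutely_integrable_on_def)

lemma relax_mono_integrand:
  assumes "f absolutely_integrable_on {0..t}" "g absolutely_integrable_on {0..t}"
    "\<And>s. s \<in> {0..t} \<Longrightarrow> f s \<le> g s" "0 < l"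
  shows "relax l f t \<le> relax l g t"
  unfolding relax_def
  using assms absolutely_integrable_exp_mult[OF assms(1), of l] absolutely_integrable_exp_mult[OF assms(2), of l]
  by (intro mult_left_mono integral_le) (auto simp: absolutely_integrable_on_def)

text \<open>The factor 1 - exp (- l t) is the total mass of the kernel of \<open>relax l\<close>, at
  most 1 whatever the rate is.\<close>

lemma relax_const:
  assumes "0 \<le> t" "0 < l"
  shows "relax l (\<lambda>_. c) t = c * (1 - exp (- (l * t)))"
proof -
  have "((\<lambda>s. exp (l * s) * c) has_integral (exp (l * t) * c / l - exp (l * 0) * c / l)) {0..t}"
    using assms by (intro fundamental_theorem_of_calculus)
      (auto intro!: derivative_eq_intros simp flip: has_real_derivative_iff_has_vector_derivative)
  from integral_unique[OF this]
  have eq: "integral {0..t} (\<lambda>s. exp (l * s) * c) = exp (l * t) * c / l - c / l"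
    by (simp only: mult_zero_right exp_zero mult_1)
  show ?thesis
    unfolding relax_def eq using assms by (simp add: field_simps flip: exp_add)
qed

lemma relax_square_le:
  assumes "0 \<le> t" "0 < l" and f: "f absolutely_integrable_on {0..t}"
    and f2: "(\<lambda>s. (f s)\<^sup>2) absolutely_integrable_on {0..t}"
  shows "(relax l f t)\<^sup>2 \<le> relax l (\<lambda>s. (f s)\<^sup>2) t"
proof -
  define c where "c = relax l f t"
  have e1: "(\<lambda>s. exp (l * s) * f s) integrable_on {0..t}"
    using absolutely_integrable_exp_mult[OF f, of l] by (simp add: absolutely_integrable_on_def)
  have "relax l (\<lambda>s. 2 * c * f s - c\<^sup>2) t \<le> relax l (\<lambda>s. (f s)\<^sup>2) t"
  proof (rule relax_mono_integrand)
    show "(\<lambda>s. 2 * c * f s - c\<^sup>2) absolutely_integrable_on {0..t}"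
      using f by (intro set_integral_diff set_integrable_mult_right absolutely_integrable_on_const) auto
    fix s
    have "0 \<le> (f s - c)\<^sup>2" by simp
    then show "2 * c * f s - c\<^sup>2 \<le> (f s)\<^sup>2" by (simp add: power2_eq_square algebra_simps)
  qed (use assms in auto)
  moreover have "relax l (\<lambda>s. 2 * c * f s - c\<^sup>2) t = 2 * c * relax l f t - relax l (\<lambda>_. c\<^sup>2) t"
  proof -
    have "integral {0..t} (\<lambda>s. exp (l * s) * (2 * c * f s - c\<^sup>2))
        = integral {0..t} (\<lambda>s. 2 * c * (exp (l * s) * f s) - exp (l * s) * c\<^sup>2)"
      by (intro integral_cong) (simp add: algebra_simps)
    also have "\<dots> = 2 * c * integral {0..t} (\<lambda>s. exp (l * s) * f s) - integral {0..t} (\<lambda>s. exp (l * s) * c\<^sup>2)"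
      by (subst Henstock_Kurzweil_Integration.integral_diff)
         (rule integrable_on_mult_right[OF e1], rule integrable_continuous_real, intro continuous_intros, simp)
    finally have eq: "integral {0..t} (\<lambda>s. exp (l * s) * (2 * c * f s - c\<^sup>2)) =
      2 * c * integral {0..t} (\<lambda>s. exp (l * s) * f s) - integral {0..t} (\<lambda>s. exp (l * s) * c\<^sup>2)" .
    show ?thesis unfolding relax_def eq by (simp add: algebra_simps)
  qed
  moreover have "relax l (\<lambda>_. c\<^sup>2) t \<le> c\<^sup>2"
    using assms by (simp add: relax_const mult_left_le)
  ultimately show ?thesis by (simp add: c_def power2_eq_square)
qed

lemma relax_adj_deriv:
  assumes "continuous_on {0..T} h" "t \<in> {0..T}"
  shows "(relax_adj l T h has_real_derivative l * (relax_adj l T h t - h t)) (at t within {0..T})"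
proof -
  have "((\<lambda>s. integral {s..T} (\<lambda>t. exp (- (l * t)) * h t)) has_real_derivative - (exp (- (l * t)) * h t)) (at t within {0..T})"
    using assms by (intro integral_has_real_derivative' continuous_intros)
  then show ?thesis
    unfolding relax_adj_def
    by (auto intro!: derivative_eq_intros simp: algebra_simps simp flip: exp_add)
qed

lemma has_integral_flip:
  fixes f :: "real \<Rightarrow> real"
  assumes "(f has_integral I) {a..b}"
  shows "((\<lambda>x. f (c - x)) has_integral I) {c - b..c - a}"
proof -
  have "(\<lambda>x. - x + c) ` {a..b} = {c - b..c - a}"
    by (auto simp: image_iff intro!: bexI[of _ "c - _"])
  then show ?thesis
    using has_integral_affinity[of f I a b "-1" c] assms by (simp add: algebra_simps)
qed

lemma integral_flip:
  fixes f :: "real \<Rightarrow> real"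
  assumes "f integrable_on {a..b}"
  shows "integral {c - b..c - a} (\<lambda>x. f (c - x)) = integral {a..b} f"
  using has_integral_flip[OF integrable_integral[OF assms], of c] by (rule integral_unique)

text \<open>Time reversal turns the adjoint problem into the forward one, so that mass and norm
  bounds for \<open>relax\<close> carry over to \<open>relax_adj\<close>.\<close>

lemma relax_adj_flip:
  assumes "s \<in> {0..T}" "continuous_on {0..T} h"
  shows "relax_adj l T h s = relax l (\<lambda>t. h (T - t)) (T - s)"
proof -
  have "continuous_on {s..T} (\<lambda>t. exp (- (l * t)) * h t)"
    using assms by (intro continuous_intros) (auto intro: continuous_on_subset)
  then have "integral {s..T} (\<lambda>t. exp (- (l * t)) * h t) = integral {0..T - s} (\<lambda>t. exp (- (l * (T - t))) * h (T - t))"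
    using integral_flip[of "\<lambda>t. exp (- (l * t)) * h t" s T T] by (simp add: integrable_continuous_real)
  also have "\<dots> = integral {0..T - s} (\<lambda>t. exp (- (l * T)) * (exp (l * t) * h (T - t)))"
    by (intro integral_cong) (simp add: algebra_simps exp_diff exp_minus field_simps)
  also have "\<dots> = exp (- (l * T)) * integral {0..T - s} (\<lambda>t. exp (l * t) * h (T - t))"
    by simp
  finally show ?thesis
    by (simp add: relax_adj_def relax_def algebra_simps exp_diff exp_minus field_simps)
qed

lemma relax_duality:
  assumes "f \<in> borel_measurable borel" "f absolutely_integrable_on {0..T}" "continuous_on {0..T} h"
  shows "integral {0..T} (\<lambda>t. relax l f t * h t) = integral {0..T} (\<lambda>s. f s * relax_adj l T h s)"
proof -
  have "integral {0..T} (\<lambda>t. relax l f t * h t) =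
      l * integral {0..T} (\<lambda>t. integral {0..t} (\<lambda>s. exp (l * s) * f s) * (exp (- (l * t)) * h t))"
    unfolding relax_def by (simp add: mult_ac flip: integral_mult_right)
  also have "\<dots> = l * integral {0..T} (\<lambda>s. exp (l * s) * f s * integral {s..T} (\<lambda>t. exp (- (l * t)) * h t))"
    using assms by (subst integral_triangle_swap)
      (auto intro!: absolutely_integrable_exp_mult continuous_intros borel_measurable_times
        borel_measurable_continuous_onI)
  also have "\<dots> = integral {0..T} (\<lambda>s. f s * relax_adj l T h s)"
    unfolding relax_adj_def by (simp add: mult_ac flip: integral_mult_right)
  finally show ?thesis .
qed

lemma borel_measurable_lebesgue_on:
  fixes f :: "'a::euclidean_space \<Rightarrow> 'b::euclidean_space"
  assumes "f \<in> borel_measurable borel"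
  shows "f \<in> borel_measurable (lebesgue_on S)"
  using assms by (intro measurable_restrict_space1 measurable_completion) simp

lemma integrable_const_Icc: "(\<lambda>_. c) integrable_on {a..b}" for a c :: real
  by (rule integrable_continuous_real[OF continuous_on_const])

lemma powr_le_1_plus_powr:
  fixes x a b :: real
  assumes "0 \<le> x" "0 \<le> a" "a \<le> b"
  shows "x powr a \<le> 1 + x powr b"
proof (cases "x \<le> 1")
  case True
  then have "x powr a \<le> 1" using assms by (intro powr_le1) auto
  then show ?thesis by (simp add: add_increasing2)
next
  case False
  then have "x powr a \<le> x powr b" using assms by (intro powr_mono) auto
  then show ?thesis by simp
qed

section \<open>Finite families of functions with the Euclidean norm\<close>

abbreviation l2 :: "'i set \<Rightarrow> ('i \<Rightarrow> 'a \<Rightarrow> real) \<Rightarrow> 'a \<Rightarrow> real" where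
  "l2 I f t \<equiv> L2_set (\<lambda>i. f i t) I"

lemma borel_measurable_L2_set [measurable]:
  assumes "\<And>i. i \<in> I \<Longrightarrow> f i \<in> borel_measurable M"
  shows "(\<lambda>t. l2 I f t) \<in> borel_measurable M"
  unfolding L2_set_def using assms by measurable

lemma continuous_on_L2_set:
  assumes "\<And>i. i \<in> I \<Longrightarrow> continuous_on S (f i)"
  shows "continuous_on S (\<lambda>t. l2 I f t)"
  unfolding L2_set_def using assms by (intro continuous_intros)

lemma abs_le_L2_set: "finite I \<Longrightarrow> i \<in> I \<Longrightarrow> \<bar>f i\<bar> \<le> L2_set f I"
  using member_le_L2_set[of I i "\<lambda>i. \<bar>f i\<bar>"] by (simp add: L2_set_def)

lemma L2_set_square: "(L2_set f I)\<^sup>2 = (\<Sum>i\<in>I. (f i)\<^sup>2)"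
  by (simp add: L2_set_def sum_nonneg)

lemma Lp_family_absolutely_integrable:
  fixes f :: "'i \<Rightarrow> real \<Rightarrow> real"
  assumes "\<And>i. i \<in> I \<Longrightarrow> f i \<in> borel_measurable borel" "finite I" "1 \<le> p"
    and "(\<lambda>t. l2 I f t powr p) integrable_on {0..T}" "i \<in> I"
  shows "f i absolutely_integrable_on {0..T}"
proof (rule measurable_bounded_by_integrable_imp_absolutely_integrable)
  show "(\<lambda>t. 1 + l2 I f t powr p) integrable_on {0..T}"
    by (intro integrable_add integrable_const_Icc assms)
  show "norm (f i t) \<le> 1 + l2 I f t powr p" for t
    using abs_le_L2_set[of I i "\<lambda>i. f i t"] powr_le_1_plus_powr[of "l2 I f t" 1 p] assms
    by simp
qed (use assms in \<open>auto intro: borel_measurable_lebesgue_on\<close>)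

lemma Lp_family_square_absolutely_integrable:
  fixes f :: "'i \<Rightarrow> real \<Rightarrow> real"
  assumes "\<And>i. i \<in> I \<Longrightarrow> f i \<in> borel_measurable borel" "finite I" "2 \<le> p"
    and "(\<lambda>t. l2 I f t powr p) integrable_on {0..T}" "i \<in> I"
  shows "(\<lambda>t. (f i t)\<^sup>2) absolutely_integrable_on {0..T}"
proof (rule measurable_bounded_by_integrable_imp_absolutely_integrable)
  show "(\<lambda>t. 1 + l2 I f t powr p) integrable_on {0..T}"
    by (intro integrable_add integrable_const_Icc assms)
  show "norm ((f i t)\<^sup>2) \<le> 1 + l2 I f t powr p" for t
  proof -
    have "(f i t)\<^sup>2 \<le> (l2 I f t)\<^sup>2"
      using abs_le_L2_set[of I i "\<lambda>i. f i t"] assms by (simp flip: abs_le_square_iff)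
    also have "\<dots> \<le> 1 + l2 I f t powr p"
      using powr_le_1_plus_powr[of "l2 I f t" 2 p] assms by simp
    finally show ?thesis by simp
  qed
qed (use assms in \<open>auto intro!: borel_measurable_lebesgue_on\<close>)

lemma relax_weighted_square_le:
  fixes f :: "nat \<Rightarrow> real \<Rightarrow> real"
  assumes fin: "finite I" and T: "0 \<le> T" and l: "\<And>i. i \<in> I \<Longrightarrow> 0 < l i"
    and fm: "\<And>i. i \<in> I \<Longrightarrow> f i \<in> borel_measurable borel"
    and f: "\<And>i. i \<in> I \<Longrightarrow> f i absolutely_integrable_on {0..T}"
    and f2: "\<And>i. i \<in> I \<Longrightarrow> (\<lambda>t. (f i t)\<^sup>2) absolutely_integrable_on {0..T}"
    and h: "continuous_on {0..T} h" and h0: "\<And>t. t \<in> {0..T} \<Longrightarrow> 0 \<le> h t"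
  shows "integral {0..T} (\<lambda>t. (L2_set (\<lambda>i. relax (l i) (f i) t) I)\<^sup>2 * h t)
    \<le> integral {0..T} (\<lambda>t. \<Sum>i\<in>I. (f i t)\<^sup>2 * relax_adj (l i) T h t)"
proof -
  have adj: "continuous_on {0..T} (relax_adj (l i) T h)" for i
    by (rule DERIV_continuous_on[OF relax_adj_deriv[OF h]])
  have "integral {0..T} (\<lambda>t. (L2_set (\<lambda>i. relax (l i) (f i) t) I)\<^sup>2 * h t)
      = integral {0..T} (\<lambda>t. \<Sum>i\<in>I. (relax (l i) (f i) t)\<^sup>2 * h t)"
    by (simp add: L2_set_square sum_distrib_right)
  also have "\<dots> = (\<Sum>i\<in>I. integral {0..T} (\<lambda>t. (relax (l i) (f i) t)\<^sup>2 * h t))"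
    using fin f h by (intro integral_sum integrable_continuous_real continuous_intros relax_continuous)
  also have "\<dots> \<le> (\<Sum>i\<in>I. integral {0..T} (\<lambda>t. relax (l i) (\<lambda>s. (f i s)\<^sup>2) t * h t))"
  proof (intro sum_mono integral_le integrable_continuous_real continuous_intros relax_continuous f f2 h)
    fix i t assume i: "i \<in> I" and t: "t \<in> {0..T}"
    then have "f i absolutely_integrable_on {0..t}" "(\<lambda>t. (f i t)\<^sup>2) absolutely_integrable_on {0..t}"
      using f[OF i] f2[OF i] by (auto intro: absolutely_integrable_on_subinterval)
    then show "(relax (l i) (f i) t)\<^sup>2 * h t \<le> relax (l i) (\<lambda>s. (f i s)\<^sup>2) t * h t"
      using l i t h0 by (intro mult_right_mono relax_square_le) auto
  qed
  also have "\<dots> = (\<Sum>i\<in>I. integral {0..T} (\<lambda>t. (f i t)\<^sup>2 * relax_adj (l i) T h t))"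
    using fm by (intro sum.cong refl relax_duality f2 h) auto
  also have "\<dots> = integral {0..T} (\<lambda>t. \<Sum>i\<in>I. (f i t)\<^sup>2 * relax_adj (l i) T h t)"
  proof (rule integral_sum[symmetric, OF fin])
    fix i assume "i \<in> I"
    from absolutely_integrable_continuous_mult[OF adj f2[OF this]]
    show "(\<lambda>t. (f i t)\<^sup>2 * relax_adj (l i) T h t) integrable_on {0..T}"
      by (simp add: absolutely_integrable_on_def mult.commute)
  qed
  finally show ?thesis .
qed

text \<open>One constant serves all intervals, finite families and rates; a Gronwall argument on
  growing intervals depends on the freedom in T. For p > 1 the integrand on the left is continuous,
  so no integrability is asserted there.\<close>

definition Lp_relax_bound :: "real \<Rightarrow> real \<Rightarrow> bool" where
  "Lp_relax_bound p C \<longleftrightarrow> (\<forall>T\<ge>0. \<forall>I::nat set. \<forall>l f. finite I \<longrightarrow> (\<forall>i\<in>I. 0 < l i \<and> f i \<in> borel_measurable borel) \<longrightarrow>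
     (\<lambda>t. l2 I f t powr p) integrable_on {0..T} \<longrightarrow>
     integral {0..T} (\<lambda>t. L2_set (\<lambda>i. relax (l i) (f i) t) I powr p)
       \<le> C * integral {0..T} (\<lambda>t. l2 I f t powr p))"

text \<open>For p = 2 the weight is the constant 1. Its adjoint averages are kernel masses, so the
  number 1 replaces the maximal function.\<close>

lemma Lp_relax_bound_2: "Lp_relax_bound 2 1"
  unfolding Lp_relax_bound_def
proof (intro allI impI)
  fix T :: real and I :: "nat set" and l :: "nat \<Rightarrow> real" and f :: "nat \<Rightarrow> real \<Rightarrow> real"
  assume T: "0 \<le> T" and fin: "finite I" and lf: "\<forall>i\<in>I. 0 < l i \<and> f i \<in> borel_measurable borel"
    and int: "(\<lambda>t. l2 I f t powr 2) integrable_on {0..T}"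
  have f2: "(\<lambda>t. (f i t)\<^sup>2) absolutely_integrable_on {0..T}" if "i \<in> I" for i
    by (rule Lp_family_square_absolutely_integrable[OF _ fin _ int that]) (use lf in auto)
  have f1: "f i absolutely_integrable_on {0..T}" if "i \<in> I" for i
    by (rule Lp_family_absolutely_integrable[OF _ fin _ int that]) (use lf in auto)
  have adj: "relax_adj (l i) T (\<lambda>_. 1) t \<le> 1" if "i \<in> I" "t \<in> {0..T}" for i t
    using that lf by (simp add: relax_adj_flip relax_const)
  have "continuous_on {0..T} (relax_adj (l i) T (\<lambda>_. 1))" for i
    by (rule DERIV_continuous_on[OF relax_adj_deriv]) auto
  from absolutely_integrable_continuous_mult[OF this f2]
  have i1: "(\<lambda>t. (f i t)\<^sup>2 * relax_adj (l i) T (\<lambda>_. 1) t) integrable_on {0..T}" if "i \<in> I" for i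
    using that by (simp add: absolutely_integrable_on_def mult.commute)
  have "integral {0..T} (\<lambda>t. (L2_set (\<lambda>i. relax (l i) (f i) t) I)\<^sup>2 * 1)
      \<le> integral {0..T} (\<lambda>t. \<Sum>i\<in>I. (f i t)\<^sup>2 * relax_adj (l i) T (\<lambda>_. 1) t)"
    by (rule relax_weighted_square_le) (use lf f1 f2 T fin in auto)
  also have "\<dots> \<le> integral {0..T} (\<lambda>t. \<Sum>i\<in>I. (f i t)\<^sup>2)"
    using i1 f2 adj by (intro integral_le integrable_sum fin sum_mono)
      (auto simp: absolutely_integrable_on_def mult_left_le)
  finally show "integral {0..T} (\<lambda>t. L2_set (\<lambda>i. relax (l i) (f i) t) I powr 2)
       \<le> 1 * integral {0..T} (\<lambda>t. l2 I f t powr 2)"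
    by (simp add: L2_set_square)
qed

lemma Lp_relax_bound_gt_2:
  assumes p: "2 < p"
  shows "\<exists>C>0. Lp_relax_bound p C"
proof -
  \<comment> \<open>q is conjugate to p / 2, and (p - 2) q = p makes h^q equal to n^p: the maximal
    inequality returns the very norm that is being estimated.\<close>
  define q where "q = p / (p - 2)"
  have q: "1 < q" "1 < p / 2" "1 / q + 1 / (p / 2) = 1" "(p - 2) * q = p"
    using p by (auto simp: q_def field_simps)
  obtain D where D: "0 < D" "maximal_bound q D"
    using maximal_inequality[OF q(1)] by blast
  \<comment> \<open>The coefficient 1 / (2 D) cancels the maximal constant D and leaves half of the
    integral of n^p, which the left side absorbs.\<close>
  obtain C where C: "0 < C"
    "\<And>a b. 0 \<le> a \<Longrightarrow> 0 \<le> b \<Longrightarrow> a * b \<le> 1 / (2 * D) * a powr q + C * b powr (p / 2)"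
    using Young_eps[OF q(1,2,3), of "1 / (2 * D)"] D by auto
  have "Lp_relax_bound p (2 * C)"
    unfolding Lp_relax_bound_def
  proof (intro allI impI)
    fix T :: real and I :: "nat set" and l :: "nat \<Rightarrow> real" and f :: "nat \<Rightarrow> real \<Rightarrow> real"
    assume T: "0 \<le> T" and fin: "finite I" and lf: "\<forall>i\<in>I. 0 < l i \<and> f i \<in> borel_measurable borel"
      and int: "(\<lambda>t. l2 I f t powr p) integrable_on {0..T}"
    have f2: "(\<lambda>t. (f i t)\<^sup>2) absolutely_integrable_on {0..T}" if "i \<in> I" for i
      by (rule Lp_family_square_absolutely_integrable[OF _ fin _ int that]) (use lf p in auto)
    have f1: "f i absolutely_integrable_on {0..T}" if "i \<in> I" for i
      by (rule Lp_family_absolutely_integrable[OF _ fin _ int that]) (use lf p in auto)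
    define n where "n t = L2_set (\<lambda>i. relax (l i) (f i) t) I" for t
    have n0: "0 \<le> n t" for t by (simp add: n_def)
    have nc: "continuous_on {0..T} n"
      unfolding n_def by (intro continuous_on_L2_set relax_continuous f1)
    define h where "h t = n t powr (p - 2)" for t
    have h: "continuous_on {0..T} h" "\<forall>t\<in>{0..T}. 0 \<le> h t"
      unfolding h_def using p by (auto intro!: continuous_on_powr_nonneg nc n0)
    define H where "H i = relax_adj (l i) T h" for i
    define M where "M t = Max (insert 0 ((\<lambda>i. H i t) ` I))" for t
    have H: "(H i has_real_derivative l i * (H i t - h t)) (at t within {0..T})" if "t \<in> {0..T}" for i t
      unfolding H_def using h that by (intro relax_adj_deriv)
    have Hc: "continuous_on {0..T} (H i)" for i by (rule DERIV_continuous_on[OF H])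
    have Mc: "continuous_on {0..T} M" unfolding M_def by (intro continuous_on_Max fin Hc)
    have M0: "0 \<le> M t" for t unfolding M_def using fin by simp
    have HM: "H i t \<le> M t" if "i \<in> I" for i t unfolding M_def using fin that by simp
    have hq: "h t powr q = n t powr p" for t
      using q by (simp add: h_def powr_powr)
    have Mint: "(\<lambda>t. M t powr q) integrable_on {0..T}"
      using q by (intro integrable_continuous_real continuous_on_powr_nonneg Mc M0) auto
    have MD: "integral {0..T} (\<lambda>t. M t powr q) \<le> D * integral {0..T} (\<lambda>t. n t powr p)"
    proof -
      have "\<forall>i\<in>I. 0 < l i \<and> H i T = 0 \<and>
          (\<forall>t\<in>{0..T}. (H i has_real_derivative l i * (H i t - h t)) (at t within {0..T}))"
        using lf H by (simp add: H_def relax_adj_def)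
      then have "integral {0..T} (\<lambda>t. M t powr q) \<le> D * integral {0..T} (\<lambda>t. h t powr q)"
        unfolding M_def using D(2) T fin h unfolding maximal_bound_def by blast
      then show ?thesis by (simp add: hq)
    qed
    have nsq: "n t powr p = (n t)\<^sup>2 * h t" for t
    proof (cases "n t = 0")
      case False
      then have "0 < n t" using n0[of t] by simp
      then have "(n t)\<^sup>2 = n t powr 2" by simp
      then show ?thesis unfolding h_def by (simp flip: powr_add)
    qed simp
    have i1: "(\<lambda>t. (f i t)\<^sup>2 * H i t) integrable_on {0..T}" if "i \<in> I" for i
      using absolutely_integrable_continuous_mult[OF Hc f2[OF that]]
      by (simp add: absolutely_integrable_on_def mult.commute)
    have "integral {0..T} (\<lambda>t. n t powr p) = integral {0..T} (\<lambda>t. (n t)\<^sup>2 * h t)"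
      by (simp add: nsq)
    also have "\<dots> \<le> integral {0..T} (\<lambda>t. \<Sum>i\<in>I. (f i t)\<^sup>2 * H i t)"
      unfolding n_def H_def by (rule relax_weighted_square_le) (use lf f1 f2 T fin h in auto)
    also have "\<dots> \<le> integral {0..T} (\<lambda>t. 1 / (2 * D) * M t powr q + C * l2 I f t powr p)"
    proof (intro integral_le integrable_add integrable_on_mult_right integrable_sum fin i1 int Mint)
      fix t assume "t \<in> {0..T}"
      have "(\<Sum>i\<in>I. (f i t)\<^sup>2 * H i t) \<le> (\<Sum>i\<in>I. (f i t)\<^sup>2 * M t)"
        by (intro sum_mono mult_left_mono HM) auto
      also have "\<dots> = M t * (l2 I f t)\<^sup>2"
        by (simp add: L2_set_square sum_distrib_left mult.commute)
      also have "\<dots> \<le> 1 / (2 * D) * M t powr q + C * (l2 I f t)\<^sup>2 powr (p / 2)"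
        by (intro C M0) auto
      also have "(l2 I f t)\<^sup>2 powr (p / 2) = l2 I f t powr p"
      proof -
        have "(l2 I f t)\<^sup>2 = l2 I f t powr 2" by simp
        then show ?thesis by (simp only: powr_powr) simp
      qed
      finally show "(\<Sum>i\<in>I. (f i t)\<^sup>2 * H i t) \<le> 1 / (2 * D) * M t powr q + C * l2 I f t powr p" .
    qed
    also have "\<dots> = 1 / (2 * D) * integral {0..T} (\<lambda>t. M t powr q) + C * integral {0..T} (\<lambda>t. l2 I f t powr p)"
      by (subst Henstock_Kurzweil_Integration.integral_add[OF integrable_on_mult_right[OF Mint] integrable_on_mult_right[OF int]]) simp
    also have "1 / (2 * D) * integral {0..T} (\<lambda>t. M t powr q) \<le> 1 / 2 * integral {0..T} (\<lambda>t. n t powr p)"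
      using MD D by (simp add: field_simps)
    finally show "integral {0..T} (\<lambda>t. L2_set (\<lambda>i. relax (l i) (f i) t) I powr p)
       \<le> 2 * C * integral {0..T} (\<lambda>t. l2 I f t powr p)"
      unfolding n_def by simp
  qed
  then show ?thesis using C(1) by (intro exI[of _ "2 * C"]) simp
qed

text \<open>For a < 1 the power is unbounded near the zeros of n. There
  \<open>\<bar>f x\<bar> \<le> n x\<close> bounds the product by \<open>n x powr a\<close>, which
  tends to 0, and at a zero of n the product is 0 because f vanishes as well.\<close>

lemma continuous_on_mult_powr:
  fixes f n :: "real \<Rightarrow> real"
  assumes f: "continuous_on S f" and n: "continuous_on S n" and le: "\<And>x. x \<in> S \<Longrightarrow> \<bar>f x\<bar> \<le> n x" and a: "0 < a"
  shows "continuous_on S (\<lambda>x. f x * n x powr (a - 1))"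
  unfolding continuous_on_eq_continuous_within
proof
  fix x assume x: "x \<in> S"
  show "continuous (at x within S) (\<lambda>x. f x * n x powr (a - 1))"
  proof (cases "n x = 0")
    case False
    then show ?thesis
      using f n x by (auto simp: continuous_on_eq_continuous_within continuous_within intro!: tendsto_intros)
  next
    case True
    then have fx: "f x = 0" using le[OF x] by simp
    have "((\<lambda>y. n y powr a) \<longlongrightarrow> 0 powr a) (at x within S)"
    proof -
      have "continuous_on S (\<lambda>y. n y powr a)"
        by (rule continuous_on_powr_nonneg[OF n _ a]) (use le in force)
      then show ?thesis using x True by (auto simp: continuous_on_def)
    qed
    then have "((\<lambda>y. n y powr a) \<longlongrightarrow> 0) (at x within S)" by simp
    moreover have "eventually (\<lambda>y. norm (f y * n y powr (a - 1)) \<le> n y powr a) (at x within S)"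
    proof -
      have "\<bar>f y\<bar> * n y powr (a - 1) \<le> n y powr a" if "y \<in> S" for y
      proof (cases "n y = 0")
        case False
        then have ny: "0 < n y" using le[OF that] by linarith
        have "\<bar>f y\<bar> * n y powr (a - 1) \<le> n y * n y powr (a - 1)"
          by (rule mult_right_mono[OF le[OF that]]) simp
        also have "\<dots> = n y powr a" using ny by (simp add: powr_mult_base)
        finally show ?thesis .
      qed simp
      then show ?thesis by (auto simp: eventually_at_filter abs_mult)
    qed
    ultimately have "((\<lambda>y. f y * n y powr (a - 1)) \<longlongrightarrow> 0) (at x within S)"
      by (rule Lim_null_comparison[rotated])
    then show ?thesis by (simp add: continuous_within fx)
  qed
qed

text \<open>Below exponent 2 the bound follows by duality, testing with \<open>v |v| powr (p - 2)\<close>.\<close>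
lemma Lp_relax_bound_lt_2:
  assumes p: "1 < p" "p < 2"
  shows "\<exists>C>0. Lp_relax_bound p C"
proof -
  \<comment> \<open>The conjugate exponent exceeds 2, so the bound already proved applies to the
    dual problem.\<close>
  define r where "r = p / (p - 1)"
  have r: "2 < r" "1 < r" "1 / r + 1 / p = 1" "(p - 1) * r = p"
    using p by (auto simp: r_def field_simps)
  obtain D where D: "0 < D" "Lp_relax_bound r D"
    using Lp_relax_bound_gt_2[OF r(1)] by blast
  obtain C where C: "0 < C"
    "\<And>a b. 0 \<le> a \<Longrightarrow> 0 \<le> b \<Longrightarrow> a * b \<le> 1 / (2 * D) * a powr r + C * b powr p"
    using Young_eps[OF r(2) p(1) r(3), of "1 / (2 * D)"] D by auto
  have "Lp_relax_bound p (2 * C)"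
    unfolding Lp_relax_bound_def
  proof (intro allI impI)
    fix T :: real and I :: "nat set" and l :: "nat \<Rightarrow> real" and f :: "nat \<Rightarrow> real \<Rightarrow> real"
    assume T: "0 \<le> T" and fin: "finite I" and lf: "\<forall>i\<in>I. 0 < l i \<and> f i \<in> borel_measurable borel"
      and int: "(\<lambda>t. l2 I f t powr p) integrable_on {0..T}"
    have f1: "f i absolutely_integrable_on {0..T}" if "i \<in> I" for i
      by (rule Lp_family_absolutely_integrable[OF _ fin _ int that]) (use lf p in auto)
    define n where "n t = L2_set (\<lambda>i. relax (l i) (f i) t) I" for t
    have n0: "0 \<le> n t" for t by (simp add: n_def)
    have nc: "continuous_on {0..T} n"
      unfolding n_def by (intro continuous_on_L2_set relax_continuous f1)
    \<comment> \<open>The sum of v i * g i is n^p, and |g|^r = n^p by (p - 1) r = p. The exponent p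
      - 2 is negative; written as p - 1 - 1 it fits the continuity lemma with a = p - 1 > 0.\<close>
    define g where "g i t = relax (l i) (f i) t * n t powr (p - 1 - 1)" for i t
    have gc: "continuous_on {0..T} (g i)" if "i \<in> I" for i
      unfolding g_def using p fin that
      by (intro continuous_on_mult_powr relax_continuous f1 nc) (auto simp: n_def intro: abs_le_L2_set)
    have ng: "l2 I g t = n t powr (p - 1)" for t
    proof -
      have "l2 I g t = n t * n t powr (p - 1 - 1)"
        unfolding g_def n_def by (rule L2_set_left_distrib[symmetric]) simp
      then show ?thesis using n0[of t] by (cases "n t = 0") (auto simp: powr_mult_base)
    qed
    have np: "n t powr p = (\<Sum>i\<in>I. relax (l i) (f i) t * g i t)" for t
    proof -
      have "(\<Sum>i\<in>I. relax (l i) (f i) t * g i t) = (\<Sum>i\<in>I. (relax (l i) (f i) t)\<^sup>2) * n t powr (p - 1 - 1)"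
        by (simp add: g_def sum_distrib_right power2_eq_square mult.assoc)
      also have "\<dots> = n t * (n t * n t powr (p - 1 - 1))"
        by (simp add: n_def L2_set_square[symmetric] power2_eq_square[of "L2_set _ _"])
      also have "\<dots> = n t powr p"
        using n0[of t] by (cases "n t = 0") (auto simp: powr_mult_base)
      finally show ?thesis by simp
    qed
    define w where "w i = relax_adj (l i) T (g i)" for i
    have wc: "continuous_on {0..T} (w i)" if "i \<in> I" for i
      unfolding w_def by (rule DERIV_continuous_on[OF relax_adj_deriv[OF gc[OF that]]])
    define m where "m t = l2 I w t" for t
    have mc: "continuous_on {0..T} m" unfolding m_def by (intro continuous_on_L2_set wc)
    have m0: "0 \<le> m t" for t by (simp add: m_def)
    have mint: "(\<lambda>t. m t powr r) integrable_on {0..T}"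
      using r by (intro integrable_continuous_real continuous_on_powr_nonneg mc m0) auto
    have nint: "(\<lambda>t. n t powr p) integrable_on {0..T}"
      using p by (intro integrable_continuous_real continuous_on_powr_nonneg nc n0) auto
    have mn: "integral {0..T} (\<lambda>t. m t powr r) \<le> D * integral {0..T} (\<lambda>t. n t powr p)"
    proof -
      \<comment> \<open>Reversed in time, the adjoint solution w is a forward solution with forcing
        g reversed. The indicator makes that forcing Borel on the whole line.\<close>
      define gb where "gb i t = indicator {0..T} t * g i (T - t)" for i t
      have gbm: "gb i \<in> borel_measurable borel" if "i \<in> I" for i
      proof -
        have "continuous_on {0..T} (\<lambda>t. g i (T - t))"
          by (rule continuous_on_compose2[OF gc[OF that]]) (auto intro!: continuous_intros)
        then have "(\<lambda>t. indicator {0..T} t *\<^sub>R g i (T - t)) \<in> borel_measurable borel"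
          by (intro borel_measurable_continuous_on_indicator) auto
        then show ?thesis unfolding gb_def[abs_def] by simp
      qed
      have wb: "w i t = relax (l i) (gb i) (T - t)" if "i \<in> I" "t \<in> {0..T}" for i t
      proof -
        have "w i t = relax (l i) (\<lambda>t. g i (T - t)) (T - t)"
          unfolding w_def using that gc by (intro relax_adj_flip) auto
        also have "\<dots> = relax (l i) (gb i) (T - t)"
          unfolding relax_def using that by (intro arg_cong2[where f="(*)"] refl integral_cong) (auto simp: gb_def)
        finally show ?thesis .
      qed
      have gbn: "l2 I gb t powr r = n (T - t) powr p" if "t \<in> {0..T}" for t
        using that r by (simp add: gb_def ng powr_powr)
      have nflip: "((\<lambda>t. n (T - t) powr p) has_integral integral {0..T} (\<lambda>t. n t powr p)) {0..T}"
        using has_integral_flip[OF integrable_integral[OF nint], of T] by simp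
      have gbint: "((\<lambda>t. l2 I gb t powr r) has_integral integral {0..T} (\<lambda>t. n t powr p)) {0..T}"
        by (rule has_integral_eq[OF _ nflip]) (simp add: gbn)
      then have "integral {0..T} (\<lambda>t. L2_set (\<lambda>i. relax (l i) (gb i) t) I powr r)
          \<le> D * integral {0..T} (\<lambda>t. l2 I gb t powr r)"
        using D(2) T fin lf gbm unfolding Lp_relax_bound_def by (auto simp: has_integral_integrable)
      also have "integral {0..T} (\<lambda>t. l2 I gb t powr r) = integral {0..T} (\<lambda>t. n t powr p)"
        using gbint by (rule integral_unique)
      also have "integral {0..T} (\<lambda>t. L2_set (\<lambda>i. relax (l i) (gb i) t) I powr r) = integral {0..T} (\<lambda>t. m (T - t) powr r)"
        by (intro integral_cong) (auto simp: m_def wb cong: L2_set_cong)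
      also have "\<dots> = integral {0..T} (\<lambda>t. m t powr r)"
        using integral_flip[OF mint, of T] by simp
      finally show ?thesis .
    qed
    have fw: "(\<lambda>t. f i t * w i t) integrable_on {0..T}" if "i \<in> I" for i
      using absolutely_integrable_continuous_mult[OF wc[OF that] f1[OF that]]
      by (simp add: absolutely_integrable_on_def mult.commute)
    have "integral {0..T} (\<lambda>t. n t powr p) = (\<Sum>i\<in>I. integral {0..T} (\<lambda>t. relax (l i) (f i) t * g i t))"
      unfolding np
      by (intro integral_sum fin integrable_continuous_real continuous_intros relax_continuous f1 gc)
    also have "\<dots> = (\<Sum>i\<in>I. integral {0..T} (\<lambda>t. f i t * w i t))"
      unfolding w_def using lf by (intro sum.cong refl relax_duality f1 gc) auto
    also have "\<dots> = integral {0..T} (\<lambda>t. \<Sum>i\<in>I. f i t * w i t)"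
      by (intro integral_sum[symmetric] fin fw)
    also have "\<dots> \<le> integral {0..T} (\<lambda>t. 1 / (2 * D) * m t powr r + C * l2 I f t powr p)"
    proof (intro integral_le integrable_add integrable_on_mult_right integrable_sum fin fw int mint)
      fix t assume "t \<in> {0..T}"
      have "(\<Sum>i\<in>I. f i t * w i t) \<le> (\<Sum>i\<in>I. \<bar>f i t\<bar> * \<bar>w i t\<bar>)"
        by (intro sum_mono) (metis abs_ge_self abs_mult)
      also have "\<dots> \<le> m t * l2 I f t"
        unfolding m_def using L2_set_mult_ineq[of "\<lambda>i. f i t" "\<lambda>i. w i t" I] by (simp add: mult.commute)
      also have "\<dots> \<le> 1 / (2 * D) * m t powr r + C * l2 I f t powr p"
        by (intro C m0) auto
      finally show "(\<Sum>i\<in>I. f i t * w i t) \<le> 1 / (2 * D) * m t powr r + C * l2 I f t powr p" .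
    qed
    also have "\<dots> = 1 / (2 * D) * integral {0..T} (\<lambda>t. m t powr r) + C * integral {0..T} (\<lambda>t. l2 I f t powr p)"
      by (subst Henstock_Kurzweil_Integration.integral_add[OF integrable_on_mult_right[OF mint] integrable_on_mult_right[OF int]]) simp
    also have "1 / (2 * D) * integral {0..T} (\<lambda>t. m t powr r) \<le> 1 / 2 * integral {0..T} (\<lambda>t. n t powr p)"
      using mn D by (simp add: field_simps)
    finally show "integral {0..T} (\<lambda>t. L2_set (\<lambda>i. relax (l i) (f i) t) I powr p)
       \<le> 2 * C * integral {0..T} (\<lambda>t. l2 I f t powr p)"
      unfolding n_def by simp
  qed
  then show ?thesis using C(1) by (intro exI[of _ "2 * C"]) simp
qed

lemma relax_maximal_regularity:
  assumes "1 < p"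
  shows "\<exists>C>0. Lp_relax_bound p C"
  using Lp_relax_bound_lt_2[of p] Lp_relax_bound_gt_2[of p] Lp_relax_bound_2 assms
  by (cases p "2::real" rule: linorder_cases) (auto intro: exI[of _ 1])

section \<open>Volterra equations with a bounded kernel\<close>

lemma Gronwall:
  fixes W :: "real \<Rightarrow> real"
  assumes W: "continuous_on {0..T} W" and D: "0 \<le> D"
    and le: "\<And>t. t \<in> {0..T} \<Longrightarrow> W t \<le> A + D * integral {0..t} W" and t: "t \<in> {0..T}"
  shows "W t \<le> A * exp (D * t)"
proof -
  define G where "G t = (A + D * integral {0..t} W) * exp (- (D * t))" for t
  have "G t \<le> G 0"
  proof (rule DERIV_nonpos_imp_decreasing_open[of 0 t G])
    show "0 \<le> t" using t by simp
    show "continuous_on {0..t} G"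
      unfolding G_def using t
      by (intro continuous_intros indefinite_integral_continuous_1 integrable_continuous_real continuous_on_subset[OF W]) auto
    fix x assume x: "0 < x" "x < t"
    have "((\<lambda>t. integral {0..t} W) has_real_derivative W x) (at x within {0..T})"
      using x t by (intro integral_has_real_derivative W) auto
    then have d: "((\<lambda>t. integral {0..t} W) has_real_derivative W x) (at x)"
      using x t at_within_Icc_at[of 0 x T] by simp
    have "(G has_real_derivative D * (W x - (A + D * integral {0..x} W)) * exp (- (D * x))) (at x)"
      unfolding G_def by (rule derivative_eq_intros d refl | simp add: algebra_simps)+
    moreover have "D * (W x - (A + D * integral {0..x} W)) * exp (- (D * x)) \<le> 0"
      using le[of x] x t D by (intro mult_nonpos_nonneg mult_nonneg_nonpos) auto
    ultimately show "\<exists>y. (G has_real_derivative y) (at x) \<and> y \<le> 0" by blast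
  qed
  then have "(A + D * integral {0..t} W) \<le> A * exp (D * t)"
    by (simp add: G_def exp_minus field_simps)
  then show ?thesis using le[OF t] by simp
qed

section \<open>Power inequalities and Minkowski's integral inequality\<close>

lemma powr_add_le:
  fixes x y p :: real
  assumes "0 \<le> x" "0 \<le> y" "0 < p"
  shows "(x + y) powr p \<le> 2 powr p * (x powr p + y powr p)"
proof -
  have "(x + y) powr p \<le> (2 * max x y) powr p"
    using assms by (intro powr_mono2) auto
  also have "\<dots> = 2 powr p * max x y powr p" using assms by (simp add: powr_mult)
  also have "\<dots> \<le> 2 powr p * (x powr p + y powr p)"
    by (intro mult_left_mono) (auto simp: max_def)
  finally show ?thesis .
qed

text \<open>The tangent line of x^p at the mean m of n is integrated; the tangent inequality is
  Young's inequality for x and m^(p - 1). The natural factor s^(p - 1) is enlarged to T^(p - 1) so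
  that it no longer depends on s.\<close>

lemma integral_powr_Jensen:
  fixes n :: "real \<Rightarrow> real"
  assumes p: "1 < p" and s: "0 \<le> s" "s \<le> T" and n: "continuous_on {0..s} n" "\<And>t. t \<in> {0..s} \<Longrightarrow> 0 \<le> n t"
  shows "(integral {0..s} n) powr p \<le> T powr (p - 1) * integral {0..s} (\<lambda>t. n t powr p)"
proof (cases "s = 0")
  case False
  then have "0 < s" using s by simp
  define m where "m = integral {0..s} n / s"
  have m: "0 \<le> m" "integral {0..s} n = m * s"
    using \<open>0 < s\<close> n by (auto simp: m_def intro!: integral_nonneg integrable_continuous_real divide_nonneg_pos)
  have tangent: "p * m powr (p - 1) * x - (p - 1) * m powr p \<le> x powr p" if "0 \<le> x" for x
  proof -
    have "x * m powr (p - 1) \<le> x powr p / p + (m powr (p - 1)) powr (p / (p - 1)) / (p / (p - 1))"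
      using p that by (intro Youngs_inequality) (auto simp: field_simps)
    also have "\<dots> = x powr p / p + m powr p * (p - 1) / p" using p by (simp add: powr_powr)
    finally have "p * (x * m powr (p - 1)) \<le> p * (x powr p / p + m powr p * (p - 1) / p)"
      using p by (intro mult_left_mono) auto
    also have "\<dots> = x powr p + m powr p * (p - 1)" using p by (simp add: field_simps)
    finally show ?thesis by (simp add: algebra_simps)
  qed
  have "m powr p * s = p * m powr (p - 1) * (m * s) - (p - 1) * m powr p * s"
  proof -
    have "m powr (p - 1) * m = m powr p" using m(1) by (cases "m = 0") (auto simp: powr_diff)
    moreover have "p * m powr (p - 1) * (m * s) = p * (m powr (p - 1) * m) * s" by (simp only: mult_ac)
    ultimately have eq: "p * m powr (p - 1) * (m * s) = p * m powr p * s" by (simp only:)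
    show ?thesis unfolding eq by (simp add: algebra_simps)
  qed
  also have "\<dots> = integral {0..s} (\<lambda>t. p * m powr (p - 1) * n t - (p - 1) * m powr p)"
  proof (rule integral_unique[symmetric], rule has_integral_diff)
    have "(n has_integral m * s) {0..s}"
      unfolding m(2)[symmetric] by (intro integrable_integral integrable_continuous_real n)
    then show "((\<lambda>t. p * m powr (p - 1) * n t) has_integral p * m powr (p - 1) * (m * s)) {0..s}"
      by (rule has_integral_mult_right)
    show "((\<lambda>t. (p - 1) * m powr p) has_integral (p - 1) * m powr p * s) {0..s}"
      using has_integral_const_real[of "(p - 1) * m powr p" 0 s] s by (simp add: mult.commute)
  qed
  also have "\<dots> \<le> integral {0..s} (\<lambda>t. n t powr p)"
  proof (rule integral_le)
    show "(\<lambda>t. n t powr p) integrable_on {0..s}"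
      using p by (intro integrable_continuous_real continuous_on_powr_nonneg n) auto
  qed (intro integrable_continuous_real continuous_intros n, intro tangent n)
  finally have "m powr p * s \<le> integral {0..s} (\<lambda>t. n t powr p)" .
  moreover have "(m * s) powr p = s powr (p - 1) * (m powr p * s)"
    using m(1) \<open>0 < s\<close> by (simp add: powr_mult powr_diff)
  moreover have "s powr (p - 1) \<le> T powr (p - 1)" using s p by (intro powr_mono2) auto
  ultimately show ?thesis
    unfolding m(2) using m(1) \<open>0 < s\<close> by (smt (verit) mult_mono mult_nonneg_nonneg powr_ge_zero)
qed (use p in auto)

lemma L2_set_integral_le:
  fixes f :: "'i \<Rightarrow> real \<Rightarrow> real"
  assumes fin: "finite I" and f: "\<And>i. i \<in> I \<Longrightarrow> f i integrable_on S"
    and n: "(\<lambda>r. l2 I f r) integrable_on S"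
  shows "L2_set (\<lambda>i. integral S (f i)) I \<le> integral S (\<lambda>r. l2 I f r)"
proof -
  define c where "c i = integral S (f i)" for i
  define m where "m = L2_set c I"
  define J where "J = integral S (\<lambda>r. l2 I f r)"
  have J: "0 \<le> J" unfolding J_def by (intro integral_nonneg n) auto
  have "m * m = (\<Sum>i\<in>I. c i * c i)"
    using L2_set_square[of c I] by (simp add: m_def power2_eq_square)
  also have "\<dots> = (\<Sum>i\<in>I. integral S (\<lambda>r. c i * f i r))"
    by (intro sum.cong refl) (simp add: c_def)
  also have "\<dots> = integral S (\<lambda>r. \<Sum>i\<in>I. c i * f i r)"
    by (intro integral_sum[symmetric] fin integrable_on_mult_right f)
  also have "\<dots> \<le> integral S (\<lambda>r. m * l2 I f r)"
  proof (intro integral_le integrable_sum fin integrable_on_mult_right f n)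
    fix r
    have "(\<Sum>i\<in>I. c i * f i r) \<le> (\<Sum>i\<in>I. \<bar>c i\<bar> * \<bar>f i r\<bar>)"
      by (intro sum_mono) (metis abs_ge_self abs_mult)
    also have "\<dots> \<le> m * l2 I f r"
      unfolding m_def by (rule L2_set_mult_ineq)
    finally show "(\<Sum>i\<in>I. c i * f i r) \<le> m * l2 I f r" .
  qed
  also have "\<dots> = m * J" unfolding J_def by simp
  finally have "m * m \<le> m * J" .
  moreover have "0 \<le> m" by (simp add: m_def)
  ultimately have "m \<le> J" using J by (cases "m = 0") auto
  then show ?thesis by (simp add: m_def c_def[abs_def] J_def)
qed

text \<open>The bound is imposed on the whole line, so that shifted values k (s - r) raise no
  question of domain. The Abel kernel enters after multiplication by the indicator of (0,
  T].\<close>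

locale bounded_kernel =
  fixes k :: "real \<Rightarrow> real" and K T :: real
  assumes k_borel [measurable]: "k \<in> borel_measurable borel"
    and k_bound: "\<bar>k t\<bar> \<le> K" and T_pos: "0 < T"
begin

lemma K_nonneg: "0 \<le> K" using k_bound[of 0] by linarith

definition conv :: "(real \<Rightarrow> real) \<Rightarrow> real \<Rightarrow> real" where
  "conv y s = integral {0..s} (\<lambda>r. k (s - r) * y r)"

lemma conv_integrand:
  assumes "y absolutely_integrable_on {0..s}"
  shows "(\<lambda>r. k (s - r) * y r) absolutely_integrable_on {0..s}"
  using assms k_bound
  by (intro absolutely_integrable_bounded_measurable_product_real borel_measurable_lebesgue_on)
     (auto intro!: boundedI[of _ K])

lemma conv_abs_le:
  assumes "y absolutely_integrable_on {0..s}"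
  shows "\<bar>conv y s\<bar> \<le> K * integral {0..s} (\<lambda>r. \<bar>y r\<bar>)"
proof -
  have "norm (integral {0..s} (\<lambda>r. k (s - r) * y r)) \<le> integral {0..s} (\<lambda>r. K * \<bar>y r\<bar>)"
    using conv_integrand[OF assms] assms k_bound
    by (intro integral_norm_bound_integral integrable_on_mult_right)
       (auto simp: absolutely_integrable_on_def abs_mult intro!: mult_right_mono)
  then show ?thesis by (simp add: conv_def)
qed

text \<open>The kernel is only Borel, so measurability in s is taken from the integral with a
  parameter of a jointly Borel function. The indicators hide the values of y and of s outside
  [0, T].\<close>

lemma conv_measurable:
  assumes "continuous_on {0..T} y"
  shows "(\<lambda>s. indicator {0..T} s * conv y s) \<in> borel_measurable borel"
proof -
  define Y where "Y r = indicator {0..T} r * y r" for r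
  have "(\<lambda>r. indicator {0..T} r *\<^sub>R y r) \<in> borel_measurable borel"
    using assms by (intro borel_measurable_continuous_on_indicator) auto
  then have [measurable]: "Y \<in> borel_measurable borel" unfolding Y_def[abs_def] by simp
  have eq: "indicator {0..T} s * conv y s = indicator {0..T} s * (\<integral>r. (if 0 \<le> r \<and> r \<le> s then k (s - r) * Y r else 0) \<partial>lborel)" for s
  proof (cases "s \<in> {0..T}")
    case True
    have "y absolutely_integrable_on {0..s}"
      using True assms by (intro absolutely_integrable_continuous_real) (auto intro: continuous_on_subset)
    from conv_integrand[OF this] have "(\<lambda>r. k (s - r) * Y r) absolutely_integrable_on {0..s}"
      using True by (subst set_integrable_cong[OF refl refl]) (auto simp: Y_def)
    then have "(\<integral>r. indicator {0..s} r * (k (s - r) * Y r) \<partial>lborel) = integral {0..s} (\<lambda>r. k (s - r) * Y r)"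
      by (intro borel_absolutely_integrable_lborel(2)) auto
    also have "\<dots> = conv y s"
      unfolding conv_def using True by (intro integral_cong) (auto simp: Y_def)
    also have "(\<lambda>r. indicator {0..s} r * (k (s - r) * Y r)) = (\<lambda>r. if 0 \<le> r \<and> r \<le> s then k (s - r) * Y r else 0)"
      by (auto simp: indicator_def)
    finally show ?thesis by simp
  qed simp
  show ?thesis unfolding eq by measurable
qed

lemma conv_bounded:
  assumes "continuous_on {0..T} y" "s \<in> {0..T}" "\<And>r. r \<in> {0..s} \<Longrightarrow> \<bar>y r\<bar> \<le> B"
  shows "\<bar>conv y s\<bar> \<le> K * T * B"
proof -
  have c: "continuous_on {0..s} y" using assms by (auto intro: continuous_on_subset)
  have "0 \<le> B" using assms(3)[of 0] assms(2) by force
  have "\<bar>conv y s\<bar> \<le> K * integral {0..s} (\<lambda>r. \<bar>y r\<bar>)"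
    using c by (intro conv_abs_le absolutely_integrable_continuous_real)
  also have "integral {0..s} (\<lambda>r. \<bar>y r\<bar>) \<le> integral {0..s} (\<lambda>r. B)"
    using assms(3) c by (intro integral_le integrable_continuous_real continuous_intros) auto
  also have "\<dots> \<le> T * B" using assms(2) \<open>0 \<le> B\<close> by (auto intro: mult_right_mono)
  finally show ?thesis using K_nonneg by (simp add: mult_left_mono mult.assoc)
qed

lemma conv_absolutely_integrable:
  assumes "continuous_on {0..T} y"
  shows "conv y absolutely_integrable_on {0..T}"
proof -
  have "bounded (y ` {0..T})"
    using assms by (intro compact_imp_bounded compact_continuous_image) auto
  then obtain B where B: "\<forall>r\<in>{0..T}. \<bar>y r\<bar> \<le> B"
    by (auto simp: bounded_iff)
  have "(\<lambda>s. indicator {0..T} s * conv y s) absolutely_integrable_on {0..T}"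
  proof (rule measurable_bounded_by_integrable_imp_absolutely_integrable)
    show "(\<lambda>s. K * T * B) integrable_on {0..T}" by (rule integrable_const_Icc)
    show "norm (indicator {0..T} s * conv y s) \<le> K * T * B" if "s \<in> {0..T}" for s
      using conv_bounded[OF assms that, of B] B that by simp
  qed (auto intro!: borel_measurable_lebesgue_on conv_measurable assms)
  then show ?thesis
    by (subst (asm) set_integrable_cong[OF refl refl]) auto
qed

lemma conv_mult: "conv (\<lambda>r. c * y r) s = c * conv y s"
  unfolding conv_def by (simp add: mult.left_commute)

lemma conv_diff:
  assumes "y absolutely_integrable_on {0..s}" "z absolutely_integrable_on {0..s}"
  shows "conv (\<lambda>r. y r - z r) s = conv y s - conv z s"
  unfolding conv_def
  using conv_integrand[OF assms(1)] conv_integrand[OF assms(2)]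
  by (subst Henstock_Kurzweil_Integration.integral_diff[symmetric])
     (auto simp: absolutely_integrable_on_def algebra_simps)

lemma conv_L2_set_le:
  assumes fin: "finite I" and y: "\<And>i. i \<in> I \<Longrightarrow> continuous_on {0..s} (y i)"
  shows "L2_set (\<lambda>i. conv (y i) s) I \<le> K * integral {0..s} (\<lambda>r. l2 I y r)"
proof -
  define n where "n r = l2 I y r" for r
  have nc: "continuous_on {0..s} n" unfolding n_def by (intro continuous_on_L2_set y)
  have kn: "L2_set (\<lambda>i. k (s - r) * y i r) I = \<bar>k (s - r) * n r\<bar>" for r
    using L2_set_right_distrib[of "\<bar>k (s - r)\<bar>" "\<lambda>i. y i r" I]
    by (simp add: n_def abs_mult) (simp add: L2_set_def power_mult_distrib)
  have "(\<lambda>r. k (s - r) * n r) absolutely_integrable_on {0..s}"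
    by (intro conv_integrand absolutely_integrable_continuous_real nc)
  then have kni: "(\<lambda>r. \<bar>k (s - r) * n r\<bar>) integrable_on {0..s}"
    by (simp add: absolutely_integrable_on_def)
  have "L2_set (\<lambda>i. conv (y i) s) I \<le> integral {0..s} (\<lambda>r. L2_set (\<lambda>i. k (s - r) * y i r) I)"
    unfolding conv_def
  proof (rule L2_set_integral_le[OF fin])
    fix i assume "i \<in> I"
    then show "(\<lambda>r. k (s - r) * y i r) integrable_on {0..s}"
      using conv_integrand[OF absolutely_integrable_continuous_real[OF y]]
      by (simp add: absolutely_integrable_on_def)
  qed (use kni in \<open>simp add: kn\<close>)
  also have "\<dots> \<le> integral {0..s} (\<lambda>r. K * n r)"
    unfolding kn using k_bound
    by (intro integral_le kni integrable_on_mult_right integrable_continuous_real nc)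
       (auto simp: abs_mult n_def intro!: mult_right_mono)
  finally show ?thesis by (simp add: n_def)
qed

text \<open>The mild form of \<open>y' + c y + e (k * y) = f\<close>, \<open>y 0 = a\<close>, for a single mode.\<close>

definition mild :: "real \<Rightarrow> real \<Rightarrow> real \<Rightarrow> (real \<Rightarrow> real) \<Rightarrow> (real \<Rightarrow> real) \<Rightarrow> real \<Rightarrow> real" where
  "mild c e a f y t = exp (- (c * t)) * (a + integral {0..t} (\<lambda>s. exp (c * s) * (f s - e * conv y s)))"

lemma mild_forcing_absolutely_integrable:
  assumes "continuous_on {0..T} y" "f absolutely_integrable_on {0..T}"
  shows "(\<lambda>s. f s - e * conv y s) absolutely_integrable_on {0..T}"
  using assms by (intro set_integral_diff set_integrable_mult_right conv_absolutely_integrable)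

lemma mild_continuous:
  assumes "continuous_on {0..T} y" "f absolutely_integrable_on {0..T}"
  shows "continuous_on {0..T} (mild c e a f y)"
proof -
  have "(\<lambda>s. exp (c * s) * (f s - e * conv y s)) integrable_on {0..T}"
    using absolutely_integrable_exp_mult[OF mild_forcing_absolutely_integrable[OF assms, of e], of c]
    by (simp add: absolutely_integrable_on_def)
  then show ?thesis unfolding mild_def by (intro continuous_intros indefinite_integral_continuous_1)
qed

text \<open>Contraction in the norm weighted by exp (- \<sigma> t): integrating exp (\<sigma> s)
  gains 1 / \<sigma>, so \<sigma> \<ge> 2 e K T yields the factor 1/2 on all of [0, T], without a
  restart on short intervals. The damping exp (- c (t - s)) is at most 1.\<close>

lemma mild_lipschitz:
  assumes f: "f absolutely_integrable_on {0..T}" and c: "0 \<le> c" and e: "0 \<le> e" and d: "0 \<le> d"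
    and s: "0 < \<sigma>" "2 * (e * K * T) \<le> \<sigma>"
    and y: "continuous_on {0..T} y" and z: "continuous_on {0..T} z" and t: "t \<in> {0..T}"
    and yz: "\<And>r. r \<in> {0..T} \<Longrightarrow> \<bar>y r - z r\<bar> \<le> exp (\<sigma> * r) * d"
  shows "\<bar>mild c e a f y t - mild c e a f z t\<bar> \<le> exp (\<sigma> * t) * (d / 2)"
proof -
  define E where "E x = (\<lambda>s. exp (c * s) * (f s - e * conv x s))" for x
  have int: "E x integrable_on {0..t}" if "continuous_on {0..T} x" for x
  proof -
    have "E x absolutely_integrable_on {0..T}"
      unfolding E_def by (intro absolutely_integrable_exp_mult mild_forcing_absolutely_integrable that f)
    then have "E x absolutely_integrable_on {0..t}"
      by (rule absolutely_integrable_on_subinterval) (use t in auto)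
    then show ?thesis by (simp add: absolutely_integrable_on_def)
  qed
  have diff: "mild c e a f y t - mild c e a f z t = exp (- (c * t)) *
     integral {0..t} (\<lambda>s. E y s - E z s)"
    unfolding Henstock_Kurzweil_Integration.integral_diff[OF int[OF y] int[OF z]]
    by (simp add: mild_def E_def algebra_simps)
  have b1: "norm (integral {0..t} (\<lambda>s. E y s - E z s))
      \<le> integral {0..t} (\<lambda>s. exp (c * t) * (e * K * T * d) * exp (\<sigma> * s))"
  proof (intro integral_norm_bound_integral Henstock_Kurzweil_Integration.integrable_diff int y z)
    show "(\<lambda>s. exp (c * t) * (e * K * T * d) * exp (\<sigma> * s)) integrable_on {0..t}"
      by (intro integrable_continuous_real continuous_intros)
    fix s assume s': "s \<in> {0..t}"
    have ac: "x absolutely_integrable_on {0..s}" if "continuous_on {0..T} x" for x :: "real \<Rightarrow> real"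
      using that s' t by (intro absolutely_integrable_continuous_real) (auto intro: continuous_on_subset)
    have "\<bar>conv (\<lambda>r. y r - z r) s\<bar> \<le> K * T * (exp (\<sigma> * s) * d)"
    proof (rule conv_bounded)
      fix r assume r: "r \<in> {0..s}"
      have "\<bar>y r - z r\<bar> \<le> exp (\<sigma> * r) * d" using r s' t by (intro yz) auto
      also have "\<dots> \<le> exp (\<sigma> * s) * d" using r s(1) d by (intro mult_right_mono) auto
      finally show "\<bar>y r - z r\<bar> \<le> exp (\<sigma> * s) * d" .
    qed (use s' t y z in \<open>auto intro!: continuous_intros\<close>)
    then have b: "\<bar>conv y s - conv z s\<bar> \<le> K * T * (exp (\<sigma> * s) * d)"
      by (simp add: conv_diff[OF ac[OF y] ac[OF z]])
    have "norm (E y s - E z s)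
        = exp (c * s) * (e * \<bar>conv y s - conv z s\<bar>)"
    proof -
      have "E y s - E z s = exp (c * s) * (e * (conv z s - conv y s))" by (simp add: E_def algebra_simps)
      then show ?thesis using e by (simp add: abs_mult abs_minus_commute)
    qed
    also have "\<dots> \<le> exp (c * t) * (e * (K * T * (exp (\<sigma> * s) * d)))"
      using b e c s' by (intro mult_mono) (auto intro!: mult_left_mono)
    finally show "norm (E y s - E z s)
        \<le> exp (c * t) * (e * K * T * d) * exp (\<sigma> * s)"
      by (simp add: mult_ac)
  qed
  have b2: "integral {0..t} (\<lambda>s. exp (c * t) * (e * K * T * d) * exp (\<sigma> * s)) \<le> exp (c * t) * (exp (\<sigma> * t) * (d / 2))"
  proof -
    have "((\<lambda>s. exp (\<sigma> * s)) has_integral (exp (\<sigma> * t) / \<sigma> - exp (\<sigma> * 0) / \<sigma>)) {0..t}"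
      using t s by (intro fundamental_theorem_of_calculus)
        (auto intro!: derivative_eq_intros simp flip: has_real_derivative_iff_has_vector_derivative)
    then have "integral {0..t} (\<lambda>s. exp (\<sigma> * s)) \<le> exp (\<sigma> * t) / \<sigma>"
      using s by (simp add: integral_unique)
    then have "(e * K * T * d) * integral {0..t} (\<lambda>s. exp (\<sigma> * s)) \<le> (e * K * T * d) * (exp (\<sigma> * t) / \<sigma>)"
      using e K_nonneg T_pos d by (intro mult_left_mono) auto
    also have "\<dots> \<le> (\<sigma> / 2 * d) * (exp (\<sigma> * t) / \<sigma>)"
      using s d by (intro mult_right_mono) auto
    also have "\<dots> = exp (\<sigma> * t) * (d / 2)" using s by simp
    finally show ?thesis by (simp add: mult.assoc)
  qed
  have "\<bar>mild c e a f y t - mild c e a f z t\<bar> \<le> exp (- (c * t)) * (exp (c * t) * (exp (\<sigma> * t) * (d / 2)))"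
    unfolding diff abs_mult abs_exp_cancel
    by (rule mult_left_mono) (use order_trans[OF b1 b2] in auto)
  then show ?thesis by (simp add: mult.assoc[symmetric] flip: exp_add)
qed

lemma mild_fixed_point:
  assumes f: "f absolutely_integrable_on {0..T}" and c: "0 \<le> c" and e: "0 \<le> e"
  shows "\<exists>y. continuous_on {0..T} y \<and> (\<forall>t\<in>{0..T}. y t = mild c e a f y t)"
proof -
  \<comment> \<open>The added 1 keeps \<sigma> positive when e or K is 0.\<close>
  define \<sigma> where "\<sigma> = 2 * (e * K * T) + 1"
  have s: "0 < \<sigma>" "2 * (e * K * T) \<le> \<sigma>" using e K_nonneg T_pos by (auto simp: \<sigma>_def add_nonneg_pos)
  \<comment> \<open>The complete space at hand consists of bounded continuous functions on the whole
    line; clamping the argument extends functions from [0, T] to it.\<close>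
  define cl where "cl t = max 0 (min t T)" for t :: real
  have cl: "cl t \<in> {0..T}" for t using T_pos by (auto simp: cl_def)
  have clid: "cl t = t" if "t \<in> {0..T}" for t using that by (auto simp: cl_def)
  have clc: "continuous_on UNIV cl" unfolding cl_def by (intro continuous_intros)
  \<comment> \<open>z is the unknown divided by exp (\<sigma> t), so the plain supremum metric for z
    is the weighted metric of the contraction estimate.\<close>
  define Y where "Y z t = exp (\<sigma> * t) * apply_bcontfun z t" for z :: "real \<Rightarrow>\<^sub>C real" and t
  have Yc: "continuous_on {0..T} (Y z)" for z
    unfolding Y_def by (intro continuous_intros continuous_on_apply_bcontfun)
  define P where "P z = (\<lambda>t. exp (- (\<sigma> * cl t)) * mild c e a f (Y z) (cl t))" for z
  have Pb: "P z \<in> bcontfun" for z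
  proof -
    have m: "continuous_on {0..T} (\<lambda>t. exp (- (\<sigma> * t)) * mild c e a f (Y z) t)"
      by (intro continuous_intros mild_continuous Yc f)
    then have "continuous_on UNIV (P z)"
      unfolding P_def by (rule continuous_on_compose2) (use cl clc in auto)
    moreover have "bounded (range (P z))"
    proof (rule bounded_subset)
      show "bounded ((\<lambda>t. exp (- (\<sigma> * t)) * mild c e a f (Y z) t) ` {0..T})"
        by (intro compact_imp_bounded compact_continuous_image m) auto
      show "range (P z) \<subseteq> (\<lambda>t. exp (- (\<sigma> * t)) * mild c e a f (Y z) t) ` {0..T}"
        using cl by (auto simp: P_def)
    qed
    ultimately show ?thesis by (simp add: bcontfun_def)
  qed
  have "\<exists>!z. Bcontfun (P z) = z"
  proof (rule banach_fix_type[of "1/2"])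
    show "\<forall>x y. dist (Bcontfun (P x)) (Bcontfun (P y)) \<le> 1 / 2 * dist x y"
    proof (intro allI dist_bound)
      fix x y :: "real \<Rightarrow>\<^sub>C real" and t :: real
      have "\<bar>mild c e a f (Y x) (cl t) - mild c e a f (Y y) (cl t)\<bar> \<le> exp (\<sigma> * cl t) * (dist x y / 2)"
      proof (rule mild_lipschitz[OF f c e _ s Yc Yc cl])
        fix r
        have "\<bar>apply_bcontfun x r - apply_bcontfun y r\<bar> \<le> dist x y"
          using dist_bounded[of x r y] by (simp add: dist_real_def)
        then show "\<bar>Y x r - Y y r\<bar> \<le> exp (\<sigma> * r) * dist x y"
          by (simp add: Y_def abs_mult flip: right_diff_distrib)
      qed auto
      then have "exp (- (\<sigma> * cl t)) * \<bar>mild c e a f (Y x) (cl t) - mild c e a f (Y y) (cl t)\<bar>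
          \<le> exp (- (\<sigma> * cl t)) * (exp (\<sigma> * cl t) * (dist x y / 2))"
        by (rule mult_left_mono) simp
      then show "dist (apply_bcontfun (Bcontfun (P x)) t) (apply_bcontfun (Bcontfun (P y)) t) \<le> 1 / 2 * dist x y"
        unfolding Bcontfun_inverse[OF Pb]
        by (simp add: P_def dist_real_def abs_mult mult.assoc[symmetric] flip: right_diff_distrib exp_add)
    qed
  qed auto
  then obtain z where z: "Bcontfun (P z) = z" by blast
  then have zP: "apply_bcontfun z = P z" using Bcontfun_inverse[OF Pb] by metis
  have "Y z t = mild c e a f (Y z) t" if "t \<in> {0..T}" for t
    unfolding Y_def[of z t] zP
    by (simp add: P_def clid[OF that] mult.assoc[symmetric] flip: exp_add)
  then show ?thesis using Yc by blast
qed

end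

context bounded_kernel
begin

text \<open>As f is merely integrable, the mild formula is not differentiated. Instead the integral
  of c y is computed from it by exchanging the order of integration.\<close>

lemma mild_imp_integral_equation:
  assumes fm [measurable]: "f \<in> borel_measurable borel" and f: "f absolutely_integrable_on {0..T}"
    and y: "continuous_on {0..T} y" and eq: "\<And>t. t \<in> {0..T} \<Longrightarrow> y t = mild c e a f y t" and t: "t \<in> {0..T}"
  shows "y t = a + integral {0..t} (\<lambda>s. f s - e * conv y s - c * y s)"
proof -
  \<comment> \<open>Agrees with f - e (k * y) on [0, T] and is Borel everywhere, as the exchange of
    integrals requires.\<close>
  define G where "G s = indicator {0..T} s * f s - e * (indicator {0..T} s * conv y s)" for s
  have Gm: "G \<in> borel_measurable borel"
    unfolding G_def using conv_measurable[OF y] by measurable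
  have "(\<lambda>s. f s - e * conv y s) absolutely_integrable_on {0..t}"
    by (rule absolutely_integrable_on_subinterval[OF mild_forcing_absolutely_integrable[OF y f]]) (use t in auto)
  then have Ga: "G absolutely_integrable_on {0..t}"
    by (rule set_integrable_cong[THEN iffD1, rotated -1]) (use t in \<open>auto simp: G_def\<close>)
  define E where "E s = integral {0..s} (\<lambda>r. exp (c * r) * G r)" for s
  have eGa: "(\<lambda>r. exp (c * r) * G r) absolutely_integrable_on {0..t}"
    by (rule absolutely_integrable_exp_mult[OF Ga])
  have yE: "y s = exp (- (c * s)) * (a + E s)" if "s \<in> {0..t}" for s
  proof -
    have "E s = integral {0..s} (\<lambda>r. exp (c * r) * (f r - e * conv y r))"
      unfolding E_def using that t by (intro integral_cong) (auto simp: G_def)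
    then show ?thesis using eq[of s] that t by (simp add: mild_def)
  qed
  have Ec: "continuous_on {0..t} E"
    unfolding E_def using eGa by (intro indefinite_integral_continuous_1) (simp add: absolutely_integrable_on_def)
  have I1: "((\<lambda>r. c * exp (- (c * r))) has_integral (exp (- (c * s)) - exp (- (c * t)))) {s..t}" if "s \<in> {0..t}" for s
  proof -
    have "((\<lambda>r. c * exp (- (c * r))) has_integral (- exp (- (c * t)) - (- exp (- (c * s))))) {s..t}"
      using that by (intro fundamental_theorem_of_calculus)
        (auto intro!: derivative_eq_intros simp flip: has_real_derivative_iff_has_vector_derivative)
    then show ?thesis by (simp add: algebra_simps)
  qed
  have "integral {0..t} (\<lambda>s. E s * (c * exp (- (c * s))))
      = integral {0..t} (\<lambda>s. exp (c * s) * G s * integral {s..t} (\<lambda>r. c * exp (- (c * r))))"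
    unfolding E_def
    by (rule integral_triangle_swap)
       (use Gm eGa in \<open>auto intro!: continuous_intros borel_measurable_times borel_measurable_continuous_onI\<close>)
  also have "\<dots> = integral {0..t} (\<lambda>s. G s - exp (- (c * t)) * (exp (c * s) * G s))"
  proof (rule integral_cong)
    fix s assume "s \<in> {0..t}"
    then show "exp (c * s) * G s * integral {s..t} (\<lambda>r. c * exp (- (c * r))) = G s - exp (- (c * t)) * (exp (c * s) * G s)"
      unfolding integral_unique[OF I1[OF \<open>s \<in> {0..t}\<close>]] by (simp add: exp_minus field_simps)
  qed
  also have "\<dots> = integral {0..t} G - exp (- (c * t)) * E t"
    unfolding E_def using Ga eGa
    by (subst Henstock_Kurzweil_Integration.integral_diff) (auto simp: absolutely_integrable_on_def)
  finally have I2: "integral {0..t} (\<lambda>s. E s * (c * exp (- (c * s)))) = integral {0..t} G - exp (- (c * t)) * E t" .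
  have yc: "continuous_on {0..t} y" using y t by (auto intro: continuous_on_subset)
  have "integral {0..t} (\<lambda>s. c * y s) = integral {0..t} (\<lambda>s. a * (c * exp (- (c * s))) + E s * (c * exp (- (c * s))))"
    by (intro integral_cong) (simp add: yE algebra_simps)
  also have "\<dots> = integral {0..t} (\<lambda>s. a * (c * exp (- (c * s)))) + integral {0..t} (\<lambda>s. E s * (c * exp (- (c * s))))"
    by (intro Henstock_Kurzweil_Integration.integral_add integrable_continuous_real continuous_intros Ec)
  also have "integral {0..t} (\<lambda>s. a * (c * exp (- (c * s)))) = a * (1 - exp (- (c * t)))"
    using has_integral_mult_right[OF I1[of 0], of a] t by (intro integral_unique) simp
  finally have I3: "integral {0..t} (\<lambda>s. c * y s) = a + integral {0..t} G - exp (- (c * t)) * (a + E t)"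
    unfolding I2 by (simp add: algebra_simps)
  have "integral {0..t} (\<lambda>s. f s - e * conv y s - c * y s) = integral {0..t} (\<lambda>s. G s - c * y s)"
    using t by (intro integral_cong) (auto simp: G_def)
  also have "\<dots> = integral {0..t} G - integral {0..t} (\<lambda>s. c * y s)"
  proof (rule Henstock_Kurzweil_Integration.integral_diff)
    show "G integrable_on {0..t}" using Ga by (simp add: absolutely_integrable_on_def)
    show "(\<lambda>s. c * y s) integrable_on {0..t}" by (intro integrable_continuous_real continuous_intros yc)
  qed
  finally show ?thesis unfolding I3 using yE[of t] t by simp
qed

text \<open>Gronwall's inequality for |d| with A = 0: the memory term is at most K times the
  integral of |d| up to t, and integrating it once more costs at most a factor T. The Gronwall
  constant depends on c and e, which is harmless for one mode at a time.\<close>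

lemma volterra_uniqueness:
  assumes c: "0 \<le> c" and e: "0 \<le> e" and d: "continuous_on {0..T} d"
    and eq: "\<And>t. t \<in> {0..T} \<Longrightarrow> d t = integral {0..t} (\<lambda>s. - (c * d s) - e * conv d s)" and t: "t \<in> {0..T}"
  shows "d t = 0"
proof -
  have "\<bar>d t\<bar> \<le> 0 * exp ((c + e * K * T) * t)"
  proof (rule Gronwall[OF _ _ _ t])
    show "continuous_on {0..T} (\<lambda>t. \<bar>d t\<bar>)" using d by (intro continuous_intros)
    show "0 \<le> c + e * K * T" using c e K_nonneg T_pos by simp
    fix t assume t: "t \<in> {0..T}"
    define J where "J = integral {0..t} (\<lambda>s. \<bar>d s\<bar>)"
    have dc: "continuous_on {0..s} d" if "s \<le> t" for s
      using d t that by (auto intro: continuous_on_subset)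
    have J0: "0 \<le> J" unfolding J_def by (intro integral_nonneg integrable_continuous_real continuous_intros dc) auto
    have "(\<lambda>s. - c * d s - e * conv d s) absolutely_integrable_on {0..T}"
      by (intro set_integral_diff set_integrable_mult_right conv_absolutely_integrable d
          absolutely_integrable_continuous_real)
    then have "(\<lambda>s. - (c * d s) - e * conv d s) absolutely_integrable_on {0..t}"
      using t by (auto dest: absolutely_integrable_on_subinterval[where a=0 and b=t])
    then have di: "(\<lambda>s. - (c * d s) - e * conv d s) integrable_on {0..t}"
      by (simp add: absolutely_integrable_on_def)
    have "norm (integral {0..t} (\<lambda>s. - (c * d s) - e * conv d s)) \<le> integral {0..t} (\<lambda>s. c * \<bar>d s\<bar> + e * K * J)"
    proof (rule integral_norm_bound_integral[OF di])
      show "(\<lambda>s. c * \<bar>d s\<bar> + e * K * J) integrable_on {0..t}"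
        by (intro integrable_continuous_real continuous_intros dc) simp
      fix s assume s: "s \<in> {0..t}"
      have "\<bar>conv d s\<bar> \<le> K * integral {0..s} (\<lambda>r. \<bar>d r\<bar>)"
        using s by (intro conv_abs_le absolutely_integrable_continuous_real dc) auto
      also have "\<dots> \<le> K * J"
        unfolding J_def using s K_nonneg
        by (intro mult_left_mono integral_subset_le integrable_continuous_real continuous_intros dc) auto
      finally have "e * \<bar>conv d s\<bar> \<le> e * K * J" using e by (simp add: mult_left_mono mult.assoc)
      then show "norm (- (c * d s) - e * conv d s) \<le> c * \<bar>d s\<bar> + e * K * J"
        using c e by (simp add: abs_mult order_trans[OF abs_triangle_ineq4])
    qed
    also have "\<dots> = c * J + e * K * J * t"
      unfolding J_def using t
      by (subst Henstock_Kurzweil_Integration.integral_add) 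
         (auto intro!: integrable_continuous_real continuous_intros dc)
    also have "\<dots> \<le> c * J + e * K * J * T"
      using t J0 e K_nonneg by (intro add_left_mono mult_left_mono) auto
    finally show "\<bar>d t\<bar> \<le> 0 + (c + e * K * T) * integral {0..t} (\<lambda>s. \<bar>d s\<bar>)"
      using eq[OF t] by (simp add: J_def algebra_simps)
  qed
  then show ?thesis by simp
qed

text \<open>Q precedes the family, its size and its rates. The expression in the second and third
  clauses is the time derivative of y read off from the equation; it is no more regular than f,
  hence its own integrability clause, whereas l * y is continuous.\<close>

definition a_priori_bound :: "real \<Rightarrow> real \<Rightarrow> real \<Rightarrow> real \<Rightarrow> bool" where
  "a_priori_bound \<mu> \<zeta> p Q \<longleftrightarrow> (\<forall>I::nat set. \<forall>l a f y. finite I \<longrightarrow>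
    (\<forall>i\<in>I. 0 < l i \<and> f i \<in> borel_measurable borel \<and> continuous_on {0..T} (y i)
      \<and> (\<forall>t\<in>{0..T}. y i t = mild (\<mu> * l i) (\<zeta> * l i) (a i) (f i) (y i) t)) \<longrightarrow>
    (\<lambda>t. l2 I f t powr p) integrable_on {0..T} \<longrightarrow>
    integral {0..T} (\<lambda>t. L2_set (\<lambda>i. l i * y i t) I powr p)
      \<le> Q * (L2_set (\<lambda>i. l i * a i) I powr p + integral {0..T} (\<lambda>t. l2 I f t powr p)) \<and>
    (\<lambda>t. L2_set (\<lambda>i. f i t - \<zeta> * l i * conv (y i) t - \<mu> * l i * y i t) I powr p) integrable_on {0..T} \<and>
    integral {0..T} (\<lambda>t. L2_set (\<lambda>i. f i t - \<zeta> * l i * conv (y i) t - \<mu> * l i * y i t) I powr p)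
      \<le> Q * (L2_set (\<lambda>i. l i * a i) I powr p + integral {0..T} (\<lambda>t. l2 I f t powr p)))"

text \<open>For w = l y the extra factor l completes Duhamel's integral to
  \<open>relax (\<mu> * l i)\<close>, applied to the forcing F = f - \<zeta> (k * w). Maximal
  regularity on [0, \<tau>] bounds V \<tau>, the integral of |w|^p, by the data plus a multiple of
  the integral of V, and Gronwall's inequality closes the estimate.\<close>

lemma a_priori_estimate:
  assumes p: "1 < p" and mu: "0 < \<mu>" and ze: "0 < \<zeta>"
  shows "\<exists>Q>0. a_priori_bound \<mu> \<zeta> p Q"
proof -
  obtain C where C: "0 < C" "Lp_relax_bound p C"
    using relax_maximal_regularity[OF p] by blast
  define P where "P = (2::real) powr p"
  have P: "0 < P" by (simp add: P_def)
  \<comment> \<open>By Jensen's inequality, \<kappa> V s bounds the p-th power of \<zeta> K times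
    the integral of |w| up to s, that is, of the memory part of F.\<close>
  define \<kappa> where "\<kappa> = (\<zeta> * K) powr p * T powr (p - 1)"
  have \<kappa>: "0 \<le> \<kappa>" by (simp add: \<kappa>_def)
  define m where "m = (1 / \<mu>) powr p"
  have m: "0 < m" using mu by (simp add: m_def)
  \<comment> \<open>A0 and D are the coefficients in V \<tau> \<le> A0 X + D (integral of V up to
    \<tau>), where X is |l a|^p plus the integral of |f|^p. Each use of (x + y)^p \<le> 2^p (x^p +
    y^p) costs a factor P, and m accounts for the 1 / \<mu> in front of
    \<open>relax\<close>.\<close>
  define A0 where "A0 = P * (T + m * C * P)"
  define D where "D = P * (m * C * P * \<kappa>)"
  define Q1 where "Q1 = A0 * exp (D * T)"
  \<comment> \<open>For the derivative F - \<mu> w: the part |F|^p costs P (1 + \<kappa> T Q1),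
    using V \<le> V T, and the part |\<mu> w|^p costs \<mu>^p Q1.\<close>
  define Q2 where "Q2 = P * (P * (1 + \<kappa> * T * Q1) + \<mu> powr p * Q1)"
  have A0: "0 < A0" using P m C T_pos by (simp add: A0_def add_pos_pos)
  have D: "0 \<le> D" using P m C \<kappa> by (simp add: D_def)
  have Q1: "0 < Q1" using A0 by (simp add: Q1_def)
  have Q2: "0 < Q2" unfolding Q2_def using P \<kappa> T_pos Q1
    by (intro mult_pos_pos add_pos_nonneg) auto
  show ?thesis
    unfolding a_priori_bound_def
  proof (intro exI[of _ "Q1 + Q2"] conjI allI impI)
    show "0 < Q1 + Q2" using Q1 Q2 by simp
    fix I :: "nat set" and l a :: "nat \<Rightarrow> real" and f y :: "nat \<Rightarrow> real \<Rightarrow> real"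
    assume fin: "finite I" and
      H: "\<forall>i\<in>I. 0 < l i \<and> f i \<in> borel_measurable borel \<and> continuous_on {0..T} (y i)
        \<and> (\<forall>t\<in>{0..T}. y i t = mild (\<mu> * l i) (\<zeta> * l i) (a i) (f i) (y i) t)"
      and int: "(\<lambda>t. l2 I f t powr p) integrable_on {0..T}"
    have l: "0 < l i" and fm: "f i \<in> borel_measurable borel" and yc: "continuous_on {0..T} (y i)"
      and yeq: "\<And>t. t \<in> {0..T} \<Longrightarrow> y i t = mild (\<mu> * l i) (\<zeta> * l i) (a i) (f i) (y i) t"
      if "i \<in> I" for i using H that by auto
    define w where "w i t = l i * y i t" for i t
    have wc: "continuous_on {0..T} (w i)" if "i \<in> I" for i
      unfolding w_def by (intro continuous_intros yc that)
    have cw: "conv (w i) t = l i * conv (y i) t" for i t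
      unfolding w_def by (rule conv_mult)
    define nw where "nw t = l2 I w t" for t
    define nf where "nf t = l2 I f t" for t
    have nwc: "continuous_on {0..T} nw" unfolding nw_def by (intro continuous_on_L2_set wc)
    have nw0: "0 \<le> nw t" and nf0: "0 \<le> nf t" for t by (auto simp: nw_def nf_def)
    have nwpc: "continuous_on {0..T} (\<lambda>t. nw t powr p)"
      using p by (intro continuous_on_powr_nonneg nwc nw0) auto
    define V where "V s = integral {0..s} (\<lambda>t. nw t powr p)" for s
    have Vc: "continuous_on {0..T} V"
      unfolding V_def by (intro indefinite_integral_continuous_1 integrable_continuous_real nwpc)
    have Vmono: "V s \<le> V t" if "0 \<le> s" "s \<le> t" "t \<le> T" for s t
      unfolding V_def using that
      by (intro integral_subset_le integrable_continuous_real continuous_on_subset[OF nwpc]) auto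
    have V0: "0 \<le> V s" if "s \<in> {0..T}" for s
      using Vmono[of 0 s] that by (simp add: V_def)
    define \<Phi> where "\<Phi> = integral {0..T} (\<lambda>t. nf t powr p)"
    have int': "(\<lambda>t. nf t powr p) integrable_on {0..T}" using int by (simp add: nf_def)
    have \<Phi>0: "0 \<le> \<Phi>" unfolding \<Phi>_def by (intro integral_nonneg int') auto
    define na where "na = L2_set (\<lambda>i. l i * a i) I"
    have na0: "0 \<le> na" by (simp add: na_def)
    define X where "X = na powr p + \<Phi>"
    have X: "0 \<le> X" "\<Phi> \<le> X" "na powr p \<le> X" using \<Phi>0 by (auto simp: X_def)
    \<comment> \<open>On [0, T] this is the complete forcing of w; the indicators make it Borel on
      the line, as \<open>Lp_relax_bound\<close> demands.\<close>
    define F where "F i s = indicator {0..T} s * f i s - \<zeta> * (indicator {0..T} s * conv (w i) s)" for i s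
    have Fm: "F i \<in> borel_measurable borel" if "i \<in> I" for i
      unfolding F_def using conv_measurable[OF wc[OF that]] fm[OF that] by measurable
    have FT: "F i s = f i s - \<zeta> * conv (w i) s" if "s \<in> {0..T}" for i s
      using that by (simp add: F_def)
    define nF where "nF t = l2 I F t" for t
    have nF0: "0 \<le> nF t" for t by (simp add: nF_def)
    have nFm: "nF \<in> borel_measurable borel"
      unfolding nF_def by (intro borel_measurable_L2_set Fm)
    have nF: "nF s powr p \<le> P * (nf s powr p + \<kappa> * V s)" if s: "s \<in> {0..T}" for s
    proof -
      have "nF s = L2_set (\<lambda>i. f i s + - \<zeta> * conv (w i) s) I"
        unfolding nF_def using s by (simp add: FT)
      also have "\<dots> \<le> nf s + L2_set (\<lambda>i. - \<zeta> * conv (w i) s) I"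
        unfolding nf_def by (rule L2_set_triangle_ineq)
      also have "L2_set (\<lambda>i. - \<zeta> * conv (w i) s) I = \<zeta> * L2_set (\<lambda>i. conv (w i) s) I"
        using ze by (simp add: L2_set_right_distrib) (simp add: L2_set_def)
      also have "\<dots> \<le> \<zeta> * (K * integral {0..s} nw)"
        unfolding nw_def using ze s wc
        by (intro mult_left_mono conv_L2_set_le fin) (auto intro!: continuous_on_subset[OF wc])
      finally have "nF s \<le> nf s + \<zeta> * K * integral {0..s} nw" by (simp add: mult.assoc)
      moreover have i0: "0 \<le> integral {0..s} nw"
        using s by (intro integral_nonneg integrable_continuous_real continuous_on_subset[OF nwc] nw0) auto
      ultimately have "nF s powr p \<le> (nf s + \<zeta> * K * integral {0..s} nw) powr p"
        using p nF0 by (intro powr_mono2) auto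
      also have "\<dots> \<le> P * (nf s powr p + (\<zeta> * K * integral {0..s} nw) powr p)"
        unfolding P_def using p nf0 ze K_nonneg i0 by (intro powr_add_le) auto
      also have "(\<zeta> * K * integral {0..s} nw) powr p = (\<zeta> * K) powr p * (integral {0..s} nw) powr p"
        using ze K_nonneg i0 by (simp add: powr_mult)
      also have "\<dots> \<le> (\<zeta> * K) powr p * (T powr (p - 1) * V s)"
        unfolding V_def using s p nw0
        by (intro mult_left_mono integral_powr_Jensen continuous_on_subset[OF nwc]) auto
      finally show ?thesis using P by (simp add: \<kappa>_def mult.assoc)
    qed
    have bint: "(\<lambda>s. P * (nf s powr p + \<kappa> * V s)) integrable_on {0..\<tau>}" if "\<tau> \<in> {0..T}" for \<tau>
    proof (rule integrable_on_subinterval)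
      show "(\<lambda>s. P * (nf s powr p + \<kappa> * V s)) integrable_on {0..T}"
        by (intro integrable_on_mult_right integrable_add int' integrable_continuous_real Vc)
    qed (use that in auto)
    have nFint: "(\<lambda>t. nF t powr p) integrable_on {0..\<tau>}" if "\<tau> \<in> {0..T}" for \<tau>
    proof (rule measurable_bounded_by_integrable_imp_integrable_real[OF _ bint[OF that]])
      show "(\<lambda>t. nF t powr p) \<in> borel_measurable (lebesgue_on {0..\<tau>})"
        using nFm by (intro borel_measurable_lebesgue_on) measurable
    qed (use nF that in auto)
    have nFV: "integral {0..\<tau>} (\<lambda>t. nF t powr p) \<le> P * (\<Phi> + \<kappa> * integral {0..\<tau>} V)" if "\<tau> \<in> {0..T}" for \<tau>
    proof -
      have vi: "V integrable_on {0..\<tau>}" and fi: "(\<lambda>t. nf t powr p) integrable_on {0..\<tau>}"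
        using that by (auto intro!: integrable_continuous_real continuous_on_subset[OF Vc] integrable_on_subinterval[OF int'])
      have "integral {0..\<tau>} (\<lambda>t. nF t powr p) \<le> integral {0..\<tau>} (\<lambda>s. P * (nf s powr p + \<kappa> * V s))"
        using nF that by (intro integral_le nFint bint) auto
      also have "\<dots> = P * integral {0..\<tau>} (\<lambda>s. nf s powr p + \<kappa> * V s)" by simp
      also have "integral {0..\<tau>} (\<lambda>s. nf s powr p + \<kappa> * V s) = integral {0..\<tau>} (\<lambda>s. nf s powr p) + \<kappa> * integral {0..\<tau>} V"
        by (subst Henstock_Kurzweil_Integration.integral_add[OF fi integrable_on_mult_right[OF vi]]) simp
      also have "integral {0..\<tau>} (\<lambda>s. nf s powr p) \<le> \<Phi>"
        unfolding \<Phi>_def using that by (intro integral_subset_le fi int') auto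
      finally show ?thesis using P by simp
    qed
    define nr where "nr t = L2_set (\<lambda>i. relax (\<mu> * l i) (F i) t) I" for t
    have FaT: "F i absolutely_integrable_on {0..T}" if "i \<in> I" for i
    proof (rule Lp_family_absolutely_integrable[OF Fm fin])
      show "(\<lambda>t. l2 I F t powr p) integrable_on {0..T}"
        using nFint[of T] T_pos by (simp add: nF_def)
    qed (use p that in auto)
    have nrc: "continuous_on {0..T} nr"
      unfolding nr_def by (intro continuous_on_L2_set relax_continuous FaT)
    have wr: "w i t = exp (- (\<mu> * l i * t)) * (l i * a i) + 1 / \<mu> * relax (\<mu> * l i) (F i) t"
      if i: "i \<in> I" and t: "t \<in> {0..T}" for i t
    proof -
      have "integral {0..t} (\<lambda>s. exp (\<mu> * l i * s) * (f i s - \<zeta> * l i * conv (y i) s))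
          = integral {0..t} (\<lambda>s. exp (\<mu> * l i * s) * F i s)"
        using t by (intro integral_cong) (auto simp: FT cw mult.assoc)
      then have "y i t = exp (- (\<mu> * l i * t)) * (a i + integral {0..t} (\<lambda>s. exp (\<mu> * l i * s) * F i s))"
        using yeq[OF i t] by (simp add: mild_def)
      then show ?thesis using mu by (simp add: w_def relax_def algebra_simps)
    qed
    have nw_le: "nw t powr p \<le> P * (na powr p + m * nr t powr p)" if t: "t \<in> {0..T}" for t
    proof -
      have "nw t = L2_set (\<lambda>i. exp (- (\<mu> * l i * t)) * (l i * a i) + 1 / \<mu> * relax (\<mu> * l i) (F i) t) I"
        unfolding nw_def using wr t by (auto intro: L2_set_cong)
      also have "\<dots> \<le> L2_set (\<lambda>i. exp (- (\<mu> * l i * t)) * (l i * a i)) I + L2_set (\<lambda>i. 1 / \<mu> * relax (\<mu> * l i) (F i) t) I"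
        by (rule L2_set_triangle_ineq)
      also have "L2_set (\<lambda>i. 1 / \<mu> * relax (\<mu> * l i) (F i) t) I = 1 / \<mu> * nr t"
        unfolding nr_def using mu by (intro L2_set_right_distrib[symmetric]) simp
      also have "L2_set (\<lambda>i. exp (- (\<mu> * l i * t)) * (l i * a i)) I = L2_set (\<lambda>i. \<bar>exp (- (\<mu> * l i * t)) * (l i * a i)\<bar>) I"
        by (simp add: L2_set_def)
      also have "\<dots> \<le> L2_set (\<lambda>i. \<bar>l i * a i\<bar>) I"
      proof (rule L2_set_mono)
        fix i assume "i \<in> I"
        then have "exp (- (\<mu> * l i * t)) \<le> 1" using mu l t by (simp add: less_imp_le)
        then show "\<bar>exp (- (\<mu> * l i * t)) * (l i * a i)\<bar> \<le> \<bar>l i * a i\<bar>"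
          by (simp add: abs_mult mult_left_le_one_le)
      qed auto
      also have "\<dots> = na" by (simp add: na_def L2_set_def)
      finally have "nw t powr p \<le> (na + 1 / \<mu> * nr t) powr p"
        using p nw0 by (intro powr_mono2) auto
      also have "\<dots> \<le> P * (na powr p + (1 / \<mu> * nr t) powr p)"
        unfolding P_def using p na0 mu by (intro powr_add_le) (auto simp: nr_def)
      also have "(1 / \<mu> * nr t) powr p = m * nr t powr p"
        unfolding m_def using mu by (subst powr_mult) (auto simp: nr_def)
      finally show ?thesis .
    qed
    have Vle: "V \<tau> \<le> A0 * X + D * integral {0..\<tau>} V" if \<tau>: "\<tau> \<in> {0..T}" for \<tau>
    proof -
      have nrint: "(\<lambda>t. nr t powr p) integrable_on {0..\<tau>}"
        using p \<tau> by (intro integrable_continuous_real continuous_on_powr_nonneg continuous_on_subset[OF nrc])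
          (auto simp: nr_def)
      \<comment> \<open>The bound is used on [0, \<tau>] and not on [0, T], which is possible since
        \<open>relax\<close> at time t sees the forcing only up to t.\<close>
      have mr: "integral {0..\<tau>} (\<lambda>t. nr t powr p) \<le> C * integral {0..\<tau>} (\<lambda>t. nF t powr p)"
        using C(2) \<tau> fin l mu Fm nFint[OF \<tau>] unfolding Lp_relax_bound_def nr_def nF_def by simp
      have "V \<tau> \<le> integral {0..\<tau>} (\<lambda>t. P * (na powr p + m * nr t powr p))"
        unfolding V_def using nw_le \<tau>
        by (intro integral_le integrable_on_mult_right integrable_add nrint integrable_const_Icc
            integrable_continuous_real[OF continuous_on_subset[OF nwpc]]) auto
      also have "\<dots> = P * integral {0..\<tau>} (\<lambda>t. na powr p + m * nr t powr p)" by simp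
      also have "integral {0..\<tau>} (\<lambda>t. na powr p + m * nr t powr p) = na powr p * \<tau> + m * integral {0..\<tau>} (\<lambda>t. nr t powr p)"
        using \<tau> by (subst Henstock_Kurzweil_Integration.integral_add[OF integrable_const_Icc
              integrable_on_mult_right[OF nrint]]) simp
      also have "\<dots> \<le> X * T + m * (C * (P * (X + \<kappa> * integral {0..\<tau>} V)))"
      proof (intro add_mono mult_mono mult_left_mono)
        show "integral {0..\<tau>} (\<lambda>t. nr t powr p) \<le> C * (P * (X + \<kappa> * integral {0..\<tau>} V))"
        proof (rule order_trans[OF mr], rule mult_left_mono)
          show "integral {0..\<tau>} (\<lambda>t. nF t powr p) \<le> P * (X + \<kappa> * integral {0..\<tau>} V)"
            using nFV[OF \<tau>] X(2) P by (meson add_right_mono less_imp_le mult_left_mono order_trans)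
        qed (use C in simp)
      qed (use X m \<tau> in \<open>auto intro!: integral_nonneg nrint\<close>)
      finally show ?thesis using P by (simp add: A0_def D_def algebra_simps)
    qed
    have VT: "V T \<le> Q1 * X"
    proof -
      have "V T \<le> A0 * X * exp (D * T)"
        by (rule Gronwall[OF Vc D Vle]) (use T_pos in auto)
      then show ?thesis by (simp add: Q1_def mult_ac)
    qed
    have "V T \<le> (Q1 + Q2) * X"
      using VT Q2 X by (simp add: distrib_right add_increasing2)
    then show "integral {0..T} (\<lambda>t. L2_set (\<lambda>i. l i * y i t) I powr p)
      \<le> (Q1 + Q2) * (L2_set (\<lambda>i. l i * a i) I powr p + integral {0..T} (\<lambda>t. l2 I f t powr p))"
      by (simp add: V_def X_def \<Phi>_def nw_def nf_def na_def w_def)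
    define ng where "ng t = L2_set (\<lambda>i. F i t - \<mu> * w i t) I" for t
    have ngeq: "L2_set (\<lambda>i. f i t - \<zeta> * l i * conv (y i) t - \<mu> * l i * y i t) I powr p = ng t powr p" if "t \<in> {0..T}" for t
      unfolding ng_def using that by (simp add: FT cw w_def mult.assoc)
    have ng_le: "ng t powr p \<le> P * (nF t powr p + \<mu> powr p * nw t powr p)" for t
    proof -
      have "ng t \<le> nF t + L2_set (\<lambda>i. - \<mu> * w i t) I"
        unfolding ng_def nF_def using L2_set_triangle_ineq[of "\<lambda>i. F i t" "\<lambda>i. - \<mu> * w i t" I] by simp
      also have "L2_set (\<lambda>i. - \<mu> * w i t) I = \<mu> * nw t"
        unfolding nw_def using mu by (simp add: L2_set_right_distrib) (simp add: L2_set_def)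
      finally have "ng t powr p \<le> (nF t + \<mu> * nw t) powr p"
        using p by (intro powr_mono2) (auto simp: ng_def)
      also have "\<dots> \<le> P * (nF t powr p + (\<mu> * nw t) powr p)"
        unfolding P_def using p nF0 nw0 mu by (intro powr_add_le) auto
      finally show ?thesis using mu nw0 by (simp add: powr_mult)
    qed
    have TT: "T \<in> {0..T}" using T_pos by simp
    have nwint: "(\<lambda>t. nw t powr p) integrable_on {0..T}" by (rule integrable_continuous_real[OF nwpc])
    have gb: "(\<lambda>t. P * (nF t powr p + \<mu> powr p * nw t powr p)) integrable_on {0..T}"
      by (intro integrable_on_mult_right integrable_add nFint[OF TT] nwint)
    have ngint: "(\<lambda>t. ng t powr p) integrable_on {0..T}"
    proof (rule measurable_bounded_by_integrable_imp_integrable_real[OF _ gb])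
      have wm: "w i \<in> borel_measurable (lebesgue_on {0..T})" if "i \<in> I" for i
        by (intro continuous_imp_measurable_on_sets_lebesgue wc that) auto
      have "ng \<in> borel_measurable (lebesgue_on {0..T})"
        unfolding ng_def
        by (intro borel_measurable_L2_set borel_measurable_diff borel_measurable_times
            borel_measurable_const wm borel_measurable_lebesgue_on[OF Fm])
      then show "(\<lambda>t. ng t powr p) \<in> borel_measurable (lebesgue_on {0..T})" by measurable
    qed (use ng_le in auto)
    then show "(\<lambda>t. L2_set (\<lambda>i. f i t - \<zeta> * l i * conv (y i) t - \<mu> * l i * y i t) I powr p) integrable_on {0..T}"
      by (rule integrable_eq) (simp add: ngeq)
    have "integral {0..T} (\<lambda>t. ng t powr p) \<le> integral {0..T} (\<lambda>t. P * (nF t powr p + \<mu> powr p * nw t powr p))"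
      by (intro integral_le ngint gb ng_le)
    also have "\<dots> = P * integral {0..T} (\<lambda>t. nF t powr p + \<mu> powr p * nw t powr p)" by simp
    also have "integral {0..T} (\<lambda>t. nF t powr p + \<mu> powr p * nw t powr p)
        = integral {0..T} (\<lambda>t. nF t powr p) + \<mu> powr p * V T"
      unfolding V_def
      by (subst Henstock_Kurzweil_Integration.integral_add[OF nFint[OF TT] integrable_on_mult_right[OF nwint]]) simp
    also have "\<dots> \<le> P * (1 + \<kappa> * T * Q1) * X + \<mu> powr p * (Q1 * X)"
    proof (intro add_mono mult_left_mono VT)
      have "integral {0..T} V \<le> integral {0..T} (\<lambda>_. V T)"
        using Vmono by (intro integral_le integrable_continuous_real Vc continuous_on_const) auto
      also have "\<dots> = T * V T" using T_pos by simp
      also have "\<dots> \<le> T * (Q1 * X)" using T_pos VT by (intro mult_left_mono) auto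
      finally have "\<Phi> + \<kappa> * integral {0..T} V \<le> X + \<kappa> * (T * (Q1 * X))"
        using X(2) \<kappa> by (intro add_mono mult_left_mono)
      then have "P * (\<Phi> + \<kappa> * integral {0..T} V) \<le> P * (X + \<kappa> * (T * (Q1 * X)))"
        using P by (intro mult_left_mono) auto
      then show "integral {0..T} (\<lambda>t. nF t powr p) \<le> P * (1 + \<kappa> * T * Q1) * X"
        using nFV[OF TT] by (simp add: algebra_simps)
    qed auto
    finally have "integral {0..T} (\<lambda>t. ng t powr p) \<le> Q2 * X"
      using P by (simp add: Q2_def algebra_simps)
    also have "\<dots> \<le> (Q1 + Q2) * X" using Q1 X by (simp add: distrib_right)
    also have "integral {0..T} (\<lambda>t. ng t powr p) = integral {0..T} (\<lambda>t. L2_set (\<lambda>i. f i t - \<zeta> * l i * conv (y i) t - \<mu> * l i * y i t) I powr p)"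
      by (intro integral_cong) (simp add: ngeq)
    finally show "integral {0..T} (\<lambda>t. L2_set (\<lambda>i. f i t - \<zeta> * l i * conv (y i) t - \<mu> * l i * y i t) I powr p)
      \<le> (Q1 + Q2) * (L2_set (\<lambda>i. l i * a i) I powr p + integral {0..T} (\<lambda>t. l2 I f t powr p))"
      by (simp add: X_def \<Phi>_def nf_def na_def)
  qed
qed

end

text \<open>The power is exp ((1 - \<alpha> t) (- ln t)). For t \<le> 1 the two factors in the
  exponent are at most Q t and 1 / t, so their product is at most Q; for t > 1 the exponent is not
  positive. The reciprocal Gamma factor is bounded by continuity on the compact interval from
  \<open>\<alpha>\<^sub>s\<close> to 1.\<close>

lemma abel_kernel_bounded:
  fixes \<alpha> :: "real \<Rightarrow> real"
  assumes T: "0 < T" and as: "0 < \<alpha>\<^sub>s" and al: "\<forall>t\<in>{0..T}. \<alpha>\<^sub>s \<le> \<alpha> t \<and> \<alpha> t \<le> 1" and "\<alpha> 0 = 1"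
    and der: "\<And>t. t \<in> {0..T} \<Longrightarrow> (\<alpha> has_real_derivative \<alpha>' t) (at t within {0..T})"
    and bd: "\<And>t. t \<in> {0..T} \<Longrightarrow> \<bar>\<alpha>' t\<bar> \<le> Q"
  shows "\<exists>K. bounded_kernel (\<lambda>t. indicator {0<..T} t * abel_kernel \<alpha> t) K T"
proof -
  have ac: "continuous_on {0..T} \<alpha>" by (rule DERIV_continuous_on[OF der])
  have Q0: "0 \<le> Q" using bd[of 0] T by force
  have lip: "1 - \<alpha> t \<le> Q * t" if "t \<in> {0..T}" for t
    using field_differentiable_bound[of "{0..T}" \<alpha> \<alpha>' Q t 0] der bd that \<open>\<alpha> 0 = 1\<close> T by auto
  have Gpos: "0 < Gamma x" if "x \<in> {\<alpha>\<^sub>s..1}" for x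
    using as that by (intro Gamma_real_pos) auto
  have Gc: "continuous_on {\<alpha>\<^sub>s..1} Gamma"
    using as by (intro continuous_on_Gamma) (auto elim!: nonpos_Ints_cases)
  then have "continuous_on {\<alpha>\<^sub>s..1} (\<lambda>x. inverse (Gamma x))"
    using Gpos by (intro continuous_on_inverse) (auto simp: less_le)
  then have "bounded ((\<lambda>x. inverse (Gamma x)) ` {\<alpha>\<^sub>s..1})"
    by (intro compact_imp_bounded compact_continuous_image) auto
  then obtain R where R: "\<forall>x\<in>{\<alpha>\<^sub>s..1}. \<bar>inverse (Gamma x)\<bar> \<le> R" by (auto simp: bounded_iff)
  have R0: "0 \<le> R" using R al T by (metis abs_ge_zero atLeastAtMost_iff less_imp_le order_refl order_trans)
  have "continuous_on {0<..T} (abel_kernel \<alpha>)"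
    unfolding abel_kernel_def
  proof (intro continuous_intros ballI)
    show ac': "continuous_on {0<..T} \<alpha>" by (rule continuous_on_subset[OF ac]) auto
    show "continuous_on {0<..T} (\<lambda>t. Gamma (\<alpha> t))"
      by (rule continuous_on_compose2[OF Gc ac']) (use al in auto)
    fix t assume t: "t \<in> {0<..T}"
    then show "t \<noteq> 0" by simp
    have "\<alpha> t \<in> {\<alpha>\<^sub>s..1}" using t al by auto
    then show "Gamma (\<alpha> t) \<noteq> 0" using Gpos by fastforce
  qed
  then have "(\<lambda>t. indicator {0<..T} t *\<^sub>R abel_kernel \<alpha> t) \<in> borel_measurable borel"
    by (intro borel_measurable_continuous_on_indicator) auto
  moreover have "\<bar>indicator {0<..T} t * abel_kernel \<alpha> t\<bar> \<le> exp Q * R" for t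
  proof (cases "t \<in> {0<..T}")
    case True
    then have t: "0 < t" "t \<in> {0..T}" by auto
    have "(\<alpha> t - 1) * ln t \<le> Q"
    proof (cases "t \<le> 1")
      case True
      have "- ln t \<le> 1 / t" using ln_le_minus_one[of "1 / t"] t by (simp add: ln_div)
      then have "(1 - \<alpha> t) * (- ln t) \<le> (Q * t) * (1 / t)"
        using True t lip[OF t(2)] Q0 by (intro mult_mono) auto
      then show ?thesis using t by (simp add: algebra_simps)
    next
      case False
      then have "(\<alpha> t - 1) * ln t \<le> 0" using al t by (intro mult_nonpos_nonneg) auto
      then show ?thesis using Q0 by simp
    qed
    then have "t powr (\<alpha> t - 1) \<le> exp Q" using t by (simp add: powr_def)
    moreover have "\<bar>inverse (Gamma (\<alpha> t))\<bar> \<le> R" using R al t by auto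
    ultimately show ?thesis using True R0
      by (simp add: abel_kernel_def divide_inverse abs_mult mult_mono)
  qed (use R0 in simp)
  ultimately show ?thesis
    using T by (intro exI[of _ "exp Q * R"]) (simp add: bounded_kernel_def)
qed

section \<open>Lower bound for the Dirichlet eigenvalues\<close>

text \<open>At the maximum g' 0 = 0. With D > 0 the derivative g' would be positive just to the
  right of 0, and g would increase there.\<close>

lemma second_derivative_at_local_max:
  fixes g g' :: "real \<Rightarrow> real"
  assumes "0 < d" and g: "\<And>t. \<bar>t\<bar> < d \<Longrightarrow> (g has_real_derivative g' t) (at t)"
    and g': "(g' has_real_derivative D) (at 0)" and mx: "\<And>t. \<bar>t\<bar> < d \<Longrightarrow> g t \<le> g 0"
  shows "D \<le> 0"
proof (rule ccontr)
  assume "\<not> D \<le> 0"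
  have "g' 0 = 0"
    using DERIV_local_max[of g "g' 0" 0 d] g[of 0] mx \<open>0 < d\<close> by auto
  obtain e where e: "0 < e" "\<And>h. 0 < h \<Longrightarrow> h < e \<Longrightarrow> g' 0 < g' (0 + h)"
    using DERIV_pos_inc_right[OF g'] \<open>\<not> D \<le> 0\<close> by (metis not_le)
  define t where "t = min d e / 2"
  have t: "0 < t" "t < d" "t < e" using \<open>0 < d\<close> e(1) by (auto simp: t_def)
  have "g 0 < g t"
  proof (rule DERIV_pos_imp_increasing_open[OF t(1)])
    fix x assume "0 < x" "x < t"
    then show "\<exists>y. (g has_real_derivative y) (at x) \<and> 0 < y"
      using g[of x] e(2)[of x] t \<open>g' 0 = 0\<close> by (intro exI[of _ "g' x"]) auto
  next
    show "continuous_on {0..t} g"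
      using t g by (intro DERIV_continuous_on[where D=g']) (auto intro: has_field_derivative_at_within)
  qed
  then show False using mx[of t] t by simp
qed

text \<open>\<open>has_partial\<close> differentiates at parameter 0 only. Moving the base point
  along the axis gives the derivative at every parameter, as one-variable calculus on a segment
  requires.\<close>

lemma has_partial_deriv:
  assumes "has_partial i f (x + t *\<^sub>R axis i 1)"
  shows "((\<lambda>s. f (x + s *\<^sub>R axis i 1)) has_real_derivative partial_dir i f (x + t *\<^sub>R axis i 1)) (at t)"
proof -
  have "((\<lambda>s. f (x + t *\<^sub>R axis i 1 + s *\<^sub>R axis i 1)) has_real_derivative partial_dir i f (x + t *\<^sub>R axis i 1)) (at 0)"
    using assms unfolding has_partial_def partial_dir_def
    by (simp add: DERIV_deriv_iff_real_differentiable)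
  then have "((\<lambda>s. f (x + (s + t) *\<^sub>R axis i 1)) has_real_derivative partial_dir i f (x + t *\<^sub>R axis i 1)) (at 0)"
    by (simp add: scaleR_add_left algebra_simps)
  then show ?thesis using DERIV_shift[of "\<lambda>s. f (x + s *\<^sub>R axis i 1)" _ 0 t] by simp
qed

text \<open>Comparison of an eigenfunction with the barrier \<open>w x = 1 + R\<^sup>2 - (x $ k)\<^sup>2\<close> at a maximum
  of their quotient; here \<open>- \<Delta> w = 2\<close>.\<close>
lemma dirichlet_eigenvalue_lower_bound:
  fixes \<Omega> :: "(real^'n::finite) set"
  assumes "open \<Omega>" "bounded \<Omega>" and sys: "dirichlet_eigensystem \<Omega> lam \<phi>"
  shows "\<exists>c>0. \<forall>i. c \<le> lam i"
proof -
  obtain R where R: "0 < R" "\<And>x. x \<in> closure \<Omega> \<Longrightarrow> norm x \<le> R"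
    using bounded_closure[OF \<open>bounded \<Omega>\<close>] unfolding bounded_pos by auto
  \<comment> \<open>Any coordinate serves for the barrier; one exists because types are
    inhabited.\<close>
  obtain k :: 'n where True by simp
  define w where "w x = 1 + R\<^sup>2 - (x $ k)\<^sup>2" for x :: "real^'n"
  have w1: "1 \<le> w x" "w x \<le> 1 + R\<^sup>2" if "x \<in> closure \<Omega>" for x
  proof -
    have "\<bar>x $ k\<bar> \<le> R" using R(2)[OF that] component_le_norm_cart[of x k] by linarith
    then have "(x $ k)\<^sup>2 \<le> R\<^sup>2" using R(1) by (simp flip: abs_le_square_iff)
    then show "1 \<le> w x" "w x \<le> 1 + R\<^sup>2" by (auto simp: w_def)
  qed
  \<comment> \<open>At the maximum point - \<Delta> (\<sigma> \<phi>) is at least 2 c, while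
    \<sigma> \<phi> = c w and w \<le> 1 + R^2; the constant is the resulting quotient.\<close>
  have "2 / (1 + R\<^sup>2) \<le> lam i" for i
  proof -
    have C2: "C2_on \<Omega> (\<phi> i)" and cont: "continuous_on (closure \<Omega>) (\<phi> i)"
      and bdry: "\<forall>x\<in>frontier \<Omega>. \<phi> i x = 0" and eig: "\<forall>x\<in>\<Omega>. - laplacian (\<phi> i) x = lam i * \<phi> i x"
      and one: "L2_inner \<Omega> (\<phi> i) (\<phi> i) = 1"
      using sys unfolding dirichlet_eigensystem_def by auto
    have "\<exists>z\<in>\<Omega>. \<phi> i z \<noteq> 0"
    proof (rule ccontr)
      assume "\<not> ?thesis"
      then have "L2_inner \<Omega> (\<phi> i) (\<phi> i) = 0"
        unfolding L2_inner_def set_lebesgue_integral_def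
        by (intro integral_eq_zero_AE) (auto simp: indicator_def)
      then show False using one by simp
    qed
    then obtain z where z: "z \<in> \<Omega>" "\<phi> i z \<noteq> 0" by blast
    \<comment> \<open>The sign makes the quotient positive at z. Its maximum is then positive and
      cannot lie on the boundary, where the eigenfunction vanishes.\<close>
    define \<sigma> where "\<sigma> = sgn (\<phi> i z)"
    have zpos: "0 < \<sigma> * \<phi> i z" using z(2) by (simp add: \<sigma>_def sgn_real_def)
    have wc: "continuous_on S w" for S unfolding w_def by (intro continuous_intros)
    have "compact (closure \<Omega>)" using \<open>bounded \<Omega>\<close> by (simp add: compact_closure)
    moreover have "continuous_on (closure \<Omega>) (\<lambda>x. \<sigma> * \<phi> i x / w x)"
      using w1(1) by (intro continuous_intros cont wc) force
    moreover have "closure \<Omega> \<noteq> {}" using z(1) closure_subset by blast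
    ultimately obtain x0 where x0: "x0 \<in> closure \<Omega>"
      "\<forall>x\<in>closure \<Omega>. \<sigma> * \<phi> i x / w x \<le> \<sigma> * \<phi> i x0 / w x0"
      using continuous_attains_sup[of "closure \<Omega>" "\<lambda>x. \<sigma> * \<phi> i x / w x"] by blast
    define c where "c = \<sigma> * \<phi> i x0 / w x0"
    have "0 < \<sigma> * \<phi> i z / w z" using zpos w1(1)[of z] z(1) closure_subset by (force intro: divide_pos_pos)
    also have "\<dots> \<le> c" unfolding c_def using x0(2) z(1) closure_subset by blast
    finally have cpos: "0 < c" .
    have x0\<Omega>: "x0 \<in> \<Omega>"
    proof (rule ccontr)
      assume "x0 \<notin> \<Omega>"
      then have "x0 \<in> frontier \<Omega>" using x0(1) \<open>open \<Omega>\<close> by (simp add: frontier_def interior_open)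
      then show False using bdry cpos by (simp add: c_def)
    qed
    \<comment> \<open>The quotient itself is never differentiated: \<sigma> \<phi> - c w is at most
      0 on the domain and equals 0 at x0, so the second derivative test applies to this difference
      along each axis.\<close>
    have x0eq: "\<sigma> * \<phi> i x0 = c * w x0" using w1(1)[OF x0(1)] by (simp add: c_def)
    have le: "\<sigma> * \<phi> i x \<le> c * w x" if "x \<in> \<Omega>" for x
      using x0(2) that closure_subset w1(1)[of x] unfolding c_def[symmetric]
      by (smt (verit) pos_divide_le_eq subsetD)
    obtain d where d: "0 < d" "ball x0 d \<subseteq> \<Omega>" using \<open>open \<Omega>\<close> x0\<Omega> open_contains_ball by blast
    have dir: "\<sigma> * partial_dir j (partial_dir j (\<phi> i)) x0 \<le> c * (if j = k then - 2 else 0)" for j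
    proof -
      define u :: real where "u = (if j = k then 1 else 0)"
      have comp: "(x0 + t *\<^sub>R axis j 1) $ k = x0 $ k + t * u" for t by (simp add: u_def axis_def)
      have in\<Omega>: "x0 + t *\<^sub>R axis j 1 \<in> \<Omega>" if "\<bar>t\<bar> < d" for t
        using d(2) that by (auto simp: dist_norm norm_axis_1 subset_eq)
      have "\<sigma> * partial_dir j (partial_dir j (\<phi> i)) x0 + c * (2 * u * u) \<le> 0"
      proof (rule second_derivative_at_local_max[OF d(1)])
        fix t :: real assume t: "\<bar>t\<bar> < d"
        have "((\<lambda>s. \<phi> i (x0 + s *\<^sub>R axis j 1)) has_real_derivative partial_dir j (\<phi> i) (x0 + t *\<^sub>R axis j 1)) (at t)"
          using C2 in\<Omega>[OF t] unfolding C2_on_def by (intro has_partial_deriv) auto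
        then show "((\<lambda>s. \<sigma> * \<phi> i (x0 + s *\<^sub>R axis j 1) - c * w (x0 + s *\<^sub>R axis j 1)) has_real_derivative
            \<sigma> * partial_dir j (\<phi> i) (x0 + t *\<^sub>R axis j 1) + c * (2 * (x0 $ k + t * u) * u)) (at t)"
          unfolding w_def comp by (auto intro!: derivative_eq_intros)
        show "\<sigma> * \<phi> i (x0 + t *\<^sub>R axis j 1) - c * w (x0 + t *\<^sub>R axis j 1)
            \<le> \<sigma> * \<phi> i (x0 + 0 *\<^sub>R axis j 1) - c * w (x0 + 0 *\<^sub>R axis j 1)"
          using le[OF in\<Omega>[OF t]] x0eq by simp
      next
        have "((\<lambda>s. partial_dir j (\<phi> i) (x0 + s *\<^sub>R axis j 1)) has_real_derivative
            partial_dir j (partial_dir j (\<phi> i)) (x0 + 0 *\<^sub>R axis j 1)) (at 0)"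
          using C2 x0\<Omega> unfolding C2_on_def by (intro has_partial_deriv) auto
        then show "((\<lambda>t. \<sigma> * partial_dir j (\<phi> i) (x0 + t *\<^sub>R axis j 1) + c * (2 * (x0 $ k + t * u) * u))
            has_real_derivative \<sigma> * partial_dir j (partial_dir j (\<phi> i)) x0 + c * (2 * u * u)) (at 0)"
          by (auto intro!: derivative_eq_intros)
      qed
      then show ?thesis by (auto simp: u_def split: if_splits)
    qed
    have "\<sigma> * laplacian (\<phi> i) x0 = (\<Sum>j\<in>UNIV. \<sigma> * partial_dir j (partial_dir j (\<phi> i)) x0)"
      by (simp add: laplacian_def sum_distrib_left)
    also have "\<dots> \<le> (\<Sum>j\<in>UNIV. c * (if j = k then - 2 else 0))" by (intro sum_mono dir)
    also have "\<dots> = - 2 * c" by (simp flip: sum_distrib_left)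
    finally have "2 * c \<le> \<sigma> * (- laplacian (\<phi> i) x0)" by simp
    also have "\<dots> = lam i * (c * w x0)" using eig x0\<Omega> x0eq by (simp add: mult.left_commute)
    finally have "2 \<le> lam i * w x0" using cpos by (simp add: mult.left_commute)
    moreover have "0 < lam i"
      using calculation w1(1)[OF x0(1)] by (smt (verit) mult_nonpos_nonneg)
    ultimately have "2 \<le> lam i * (1 + R\<^sup>2)"
      using w1(2)[OF x0(1)] by (smt (verit) mult_left_mono)
    then show ?thesis by (simp add: divide_le_eq add_pos_nonneg)
  qed
  moreover have "0 < 2 / (1 + R\<^sup>2)" by (simp add: add_pos_nonneg)
  ultimately show ?thesis by blast
qed

section \<open>Square-integrable functions and the eigenbasis\<close>

definition sq_int :: "'a measure \<Rightarrow> ('a \<Rightarrow> real) \<Rightarrow> bool" where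
  "sq_int M v \<longleftrightarrow> v \<in> borel_measurable M \<and> integrable M (\<lambda>x. (v x)\<^sup>2)"

lemma sq_int_mult:
  assumes "sq_int M v" "sq_int M w"
  shows "integrable M (\<lambda>x. v x * w x)"
proof (rule Bochner_Integration.integrable_bound)
  show "integrable M (\<lambda>x. (v x)\<^sup>2 + (w x)\<^sup>2)" using assms by (auto simp: sq_int_def)
  show "(\<lambda>x. v x * w x) \<in> borel_measurable M" using assms by (auto simp: sq_int_def)
  have "\<bar>a * b\<bar> \<le> \<bar>a\<^sup>2 + b\<^sup>2\<bar>" for a b :: real
  proof -
    have "2 * \<bar>a * b\<bar> \<le> a\<^sup>2 + b\<^sup>2"
      using sum_squares_bound[of "\<bar>a\<bar>" "\<bar>b\<bar>"] by (simp add: abs_mult)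
    then show ?thesis by linarith
  qed
  then show "AE x in M. norm (v x * w x) \<le> norm ((v x)\<^sup>2 + (w x)\<^sup>2)" by simp
qed

lemma sq_int_add:
  assumes "sq_int M v" "sq_int M w"
  shows "sq_int M (\<lambda>x. v x + w x)"
proof -
  have "integrable M (\<lambda>x. (v x)\<^sup>2 + (w x)\<^sup>2 + 2 * (v x * w x))"
    using assms sq_int_mult[OF assms] by (auto simp: sq_int_def)
  then show ?thesis using assms by (auto simp: sq_int_def power2_sum mult.assoc)
qed

lemma sq_int_scale: "sq_int M v \<Longrightarrow> sq_int M (\<lambda>x. c * v x)"
  by (auto simp: sq_int_def power_mult_distrib)

lemma sq_int_diff:
  assumes "sq_int M v" "sq_int M w"
  shows "sq_int M (\<lambda>x. v x - w x)"
  using sq_int_add[OF assms(1) sq_int_scale[OF assms(2), of "-1"]] by simp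

lemma sq_int_sum:
  assumes "\<And>i. i \<in> I \<Longrightarrow> sq_int M (v i)"
  shows "sq_int M (\<lambda>x. \<Sum>i\<in>I. v i x)"
  using assms
proof (induction I rule: infinite_finite_induct)
  case (insert i I)
  then show ?case by (simp add: sq_int_add)
qed (auto simp: sq_int_def)

lemma integral_Cauchy_Schwarz:
  assumes v: "sq_int M v" and w: "sq_int M w"
  shows "(\<integral>x. v x * w x \<partial>M)\<^sup>2 \<le> (\<integral>x. (v x)\<^sup>2 \<partial>M) * (\<integral>x. (w x)\<^sup>2 \<partial>M)"
proof -
  define A where "A = (\<integral>x. (v x)\<^sup>2 \<partial>M)"
  define B where "B = (\<integral>x. v x * w x \<partial>M)"
  define C where "C = (\<integral>x. (w x)\<^sup>2 \<partial>M)"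
  have q: "0 \<le> A - 2 * t * B + t\<^sup>2 * C" for t
  proof -
    have "0 \<le> (\<integral>x. (v x - t * w x)\<^sup>2 \<partial>M)" by simp
    also have "\<dots> = (\<integral>x. (v x)\<^sup>2 - 2 * t * (v x * w x) + t\<^sup>2 * (w x)\<^sup>2 \<partial>M)"
      by (intro Bochner_Integration.integral_cong) (auto simp: power2_eq_square algebra_simps)
    also have "\<dots> = A - 2 * t * B + t\<^sup>2 * C"
      using v w sq_int_mult[OF v w] by (simp add: A_def B_def C_def sq_int_def)
    finally show ?thesis .
  qed
  have C0: "0 \<le> C" by (simp add: C_def)
  show ?thesis
  proof (cases "C = 0")
    case True
    have "B = 0"
    proof (rule ccontr)
      assume "B \<noteq> 0"
      then show False using q[of "(A + 1) / (2 * B)"] True by simp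
    qed
    then show ?thesis using True by (simp add: B_def C_def)
  next
    case False
    then have "0 < C" using C0 by simp
    have "0 \<le> (A - 2 * (B / C) * B + (B / C)\<^sup>2 * C) * C"
      using q[of "B / C"] C0 by (intro mult_nonneg_nonneg) auto
    also have "\<dots> = A * C - B\<^sup>2" using \<open>0 < C\<close> by (simp add: power2_eq_square field_simps)
    finally show ?thesis by (simp add: A_def B_def C_def)
  qed
qed

text \<open>Completeness of L2, carried out on functions instead of classes. Along a fast
  subsequence the successive differences are summable almost everywhere, because a finite measure
  bounds L1 norms by L2 norms. The conclusion is stated as an expansion of every pairing with h,
  from which coefficients, norm and weak measurability of v can be read off.\<close>

lemma (in finite_measure) Riesz_Fischer:
  fixes \<phi> :: "nat \<Rightarrow> 'a \<Rightarrow> real"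
  assumes phi: "\<And>i. sq_int M (\<phi> i)"
    and ortho: "\<And>i j. (\<integral>x. \<phi> i x * \<phi> j x \<partial>M) = (if i = j then 1 else 0)"
    and c: "summable (\<lambda>i. (c i)\<^sup>2)"
  shows "\<exists>v. sq_int M v \<and> (\<forall>h. sq_int M h \<longrightarrow> (\<lambda>i. c i * (\<integral>x. \<phi> i x * h x \<partial>M)) sums (\<integral>x. v x * h x \<partial>M))"
proof -
  define s where "s n x = (\<Sum>i<n. c i * \<phi> i x)" for n x
  have s: "sq_int M (s n)" for n
    unfolding s_def by (intro sq_int_sum sq_int_scale phi)
  have sm [measurable]: "s n \<in> borel_measurable M" for n using s by (simp add: sq_int_def)
  have cs: "summable (\<lambda>i. (c (i + n))\<^sup>2)" for n
    using c summable_iff_shift[of "\<lambda>i. (c i)\<^sup>2" n] by simp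
  define \<tau> where "\<tau> n = (\<Sum>i. (c (i + n))\<^sup>2)" for n
  have tau: "\<tau> \<longlonglongrightarrow> 0"
    unfolding \<tau>_def using c by (rule suminf_exist_split2)
  have tau0: "0 \<le> \<tau> n" for n
    unfolding \<tau>_def by (intro suminf_nonneg cs) simp
  have sn_diff_le: "(\<integral>x. (s m x - s n x)\<^sup>2 \<partial>M) \<le> \<tau> n" if "n \<le> m" for m n
  proof -
    have eq: "s m x - s n x = (\<Sum>i\<in>{n..<m}. c i * \<phi> i x)" for x
      using sum_diff_nat_ivl[of 0 n m "\<lambda>i. c i * \<phi> i x"] that by (simp add: s_def atLeast0LessThan)
    have "(\<integral>x. (s m x - s n x)\<^sup>2 \<partial>M) = (\<integral>x. (\<Sum>i\<in>{n..<m}. \<Sum>j\<in>{n..<m}. c i * c j * (\<phi> i x * \<phi> j x)) \<partial>M)"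
      unfolding eq power2_eq_square sum_product by (simp add: mult_ac)
    also have "\<dots> = (\<Sum>i\<in>{n..<m}. \<Sum>j\<in>{n..<m}. c i * c j * (if i = j then 1 else 0))"
      using sq_int_mult[OF phi phi] by (subst Bochner_Integration.integral_sum) (auto simp: ortho)
    also have "\<dots> = (\<Sum>i\<in>{n..<m}. (c i)\<^sup>2)"
      by (simp add: power2_eq_square if_distrib[of "\<lambda>x. _ * x"] cong: if_cong)
    also have "\<dots> = (\<Sum>i<m - n. (c (i + n))\<^sup>2)"
      using sum.shift_bounds_nat_ivl[of "\<lambda>i. (c i)\<^sup>2" 0 n "m - n"] that by (simp add: atLeast0LessThan)
    also have "\<dots> \<le> \<tau> n"
      unfolding \<tau>_def by (intro sum_le_suminf cs) auto
    finally show ?thesis .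
  qed
  \<comment> \<open>Adding both tails covers either order of m and n, so the subsequence N chosen
    next need not be increasing.\<close>
  have s_diff: "(\<integral>x. (s m x - s n x)\<^sup>2 \<partial>M) \<le> \<tau> m + \<tau> n" for m n
    using sn_diff_le[of n m] sn_diff_le[of m n] tau0[of m] tau0[of n]
    by (cases "n \<le> m") (auto simp: power2_commute)
  \<comment> \<open>Squared distances of order 4^(-k) become norms of order 2^(-k), whose sum is
    finite.\<close>
  have "\<exists>n. \<tau> n \<le> (1 / 4) ^ k" for k
    using order_tendstoD(2)[OF tau, of "(1 / 4) ^ k"] by (auto simp: eventually_sequentially intro: less_imp_le)
  then obtain N where N: "\<And>k. \<tau> (N k) \<le> (1 / 4) ^ k" by metis
  define D where "D k x = \<bar>s (N (Suc k)) x - s (N k) x\<bar>" for k x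
  have Dm [measurable]: "D k \<in> borel_measurable M" for k unfolding D_def by measurable
  have Dsq: "sq_int M (D k)" for k
    using sq_int_diff[OF s s, of "N (Suc k)" "N k"] by (auto simp: sq_int_def D_def)
  have one: "sq_int M (\<lambda>_. 1)" by (simp add: sq_int_def)
  define \<Lambda> where "\<Lambda> = measure M (space M)"
  have Dint: "integrable M (D k)" for k using sq_int_mult[OF Dsq one] by simp
  have Dle: "(\<integral>x. D k x \<partial>M) \<le> sqrt (2 * \<Lambda>) * (1 / 2) ^ k" for k
  proof -
    have "(\<integral>x. D k x * 1 \<partial>M)\<^sup>2 \<le> (\<integral>x. (D k x)\<^sup>2 \<partial>M) * (\<integral>x. 1\<^sup>2 \<partial>M)"
      by (rule integral_Cauchy_Schwarz[OF Dsq one])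
    also have "\<dots> \<le> (2 * (1 / 4) ^ k) * \<Lambda>"
    proof (rule mult_mono)
      have "\<tau> (N (Suc k)) + \<tau> (N k) \<le> (1 / 4) ^ Suc k + (1 / 4) ^ k" by (intro add_mono N)
      also have "\<dots> \<le> 2 * (1 / 4) ^ k" by simp
      finally show "(\<integral>x. (D k x)\<^sup>2 \<partial>M) \<le> 2 * (1 / 4) ^ k"
        using s_diff[of "N (Suc k)" "N k"] by (simp add: D_def)
    qed (auto simp: \<Lambda>_def)
    also have "\<dots> = (sqrt (2 * \<Lambda>) * (1 / 2) ^ k)\<^sup>2"
    proof -
      have "((1 / 2 :: real) ^ k)\<^sup>2 = (1 / 4) ^ k"
        by (simp add: power2_eq_square flip: power_mult_distrib)
      moreover have "(sqrt (2 * \<Lambda>))\<^sup>2 = 2 * \<Lambda>" by (simp add: \<Lambda>_def)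
      ultimately show ?thesis by (simp only: power_mult_distrib) simp
    qed
    finally show ?thesis
      by (simp add: \<Lambda>_def power2_le_iff_abs_le)
  qed
  have AEs: "AE x in M. summable (\<lambda>k. D k x)"
  proof -
    have "(\<integral>\<^sup>+x. (\<Sum>k. ennreal (D k x)) \<partial>M) = (\<Sum>k. \<integral>\<^sup>+x. ennreal (D k x) \<partial>M)"
      using Dint by (intro nn_integral_suminf) auto
    also have "\<dots> = (\<Sum>k. ennreal (\<integral>x. D k x \<partial>M))"
      using Dint by (subst nn_integral_eq_integral) (auto simp: D_def)
    also have "\<dots> \<le> (\<Sum>k. ennreal (sqrt (2 * \<Lambda>) * (1 / 2) ^ k))"
      by (intro suminf_le ennreal_leI Dle) auto
    also have "\<dots> = ennreal (\<Sum>k. sqrt (2 * \<Lambda>) * (1 / 2) ^ k)"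
      by (intro suminf_ennreal2) (auto simp: \<Lambda>_def intro!: summable_mult summable_geometric)
    finally have "(\<integral>\<^sup>+x. (\<Sum>k. ennreal (D k x)) \<partial>M) \<noteq> \<infinity>" by (auto simp: top_unique)
    then have "AE x in M. (\<Sum>k. ennreal (D k x)) \<noteq> \<infinity>"
      by (intro nn_integral_PInf_AE) (auto simp: D_def)
    then show ?thesis
    proof eventually_elim
      case (elim x)
      then show ?case by (intro summable_suminf_not_top) (auto simp: D_def)
    qed
  qed
  define v where "v x = lim (\<lambda>k. s (N k) x)" for x
  have vm [measurable]: "v \<in> borel_measurable M"
    unfolding v_def by (rule borel_measurable_lim_metric) auto
  have AEv: "AE x in M. (\<lambda>k. s (N k) x) \<longlonglongrightarrow> v x"
    using AEs
  proof eventually_elim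
    case (elim x)
    have "summable (\<lambda>k. s (N (Suc k)) x - s (N k) x)"
      using elim unfolding D_def by (rule summable_rabs_cancel)
    then have "convergent (\<lambda>n. \<Sum>k<n. s (N (Suc k)) x - s (N k) x)"
      by (simp add: summable_iff_convergent)
    then have "convergent (\<lambda>n. s (N n) x - s (N 0) x)"
      by (simp only: sum_lessThan_telescope[of "\<lambda>k. s (N k) x"])
    then have "convergent (\<lambda>n. (s (N n) x - s (N 0) x) + s (N 0) x)"
      by (intro convergent_add convergent_const)
    then show ?case by (simp add: v_def convergent_LIMSEQ_iff)
  qed
  \<comment> \<open>Fatou's lemma along the subsequence bounds the distance from v to every partial
    sum, with no dominating function at hand.\<close>
  have Fatou: "(\<integral>\<^sup>+x. ennreal ((v x - s n x)\<^sup>2) \<partial>M) \<le> ennreal (\<tau> n)" for n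
  proof -
    have "(\<integral>\<^sup>+x. ennreal ((v x - s n x)\<^sup>2) \<partial>M) = (\<integral>\<^sup>+x. liminf (\<lambda>k. ennreal ((s (N k) x - s n x)\<^sup>2)) \<partial>M)"
    proof (rule nn_integral_cong_AE)
      show "AE x in M. ennreal ((v x - s n x)\<^sup>2) = liminf (\<lambda>k. ennreal ((s (N k) x - s n x)\<^sup>2))"
        using AEv
      proof eventually_elim
        case (elim x)
        have "(\<lambda>k. ennreal ((s (N k) x - s n x)\<^sup>2)) \<longlonglongrightarrow> ennreal ((v x - s n x)\<^sup>2)"
          by (intro tendsto_intros elim)
        then show ?case by (rule lim_imp_Liminf[OF trivial_limit_sequentially, symmetric])
      qed
    qed
    also have "\<dots> \<le> liminf (\<lambda>k. \<integral>\<^sup>+x. ennreal ((s (N k) x - s n x)\<^sup>2) \<partial>M)"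
      by (intro nn_integral_liminf) auto
    also have "\<dots> \<le> liminf (\<lambda>k. ennreal ((1 / 4) ^ k + \<tau> n))"
    proof (intro Liminf_mono always_eventually allI)
      fix k
      have "(\<integral>\<^sup>+x. ennreal ((s (N k) x - s n x)\<^sup>2) \<partial>M) = ennreal (\<integral>x. (s (N k) x - s n x)\<^sup>2 \<partial>M)"
        using sq_int_diff[OF s s, of "N k" n] by (intro nn_integral_eq_integral) (auto simp: sq_int_def)
      also have "\<dots> \<le> ennreal ((1 / 4) ^ k + \<tau> n)"
        using s_diff[of "N k" n] N[of k] by (intro ennreal_leI) simp
      finally show "(\<integral>\<^sup>+x. ennreal ((s (N k) x - s n x)\<^sup>2) \<partial>M) \<le> ennreal ((1 / 4) ^ k + \<tau> n)" .
    qed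
    also have "\<dots> = ennreal (0 + \<tau> n)"
      by (intro lim_imp_Liminf tendsto_intros LIMSEQ_power_zero) auto
    finally show ?thesis by simp
  qed
  have vs: "sq_int M (\<lambda>x. v x - s n x)" for n
    unfolding sq_int_def
  proof
    show "integrable M (\<lambda>x. (v x - s n x)\<^sup>2)"
      by (rule integrableI_nonneg) (auto intro: le_less_trans[OF Fatou])
  qed simp
  have vs_le: "(\<integral>x. (v x - s n x)\<^sup>2 \<partial>M) \<le> \<tau> n" for n
    using Fatou[of n] vs[of n] tau0[of n]
    by (subst (asm) nn_integral_eq_integral) (auto simp: sq_int_def)
  have v: "sq_int M v" using vs[of 0] by (simp add: s_def)
  show ?thesis
  proof (intro exI[of _ v] conjI allI impI v)
    fix h assume h: "sq_int M h"
    define B where "B = (\<integral>x. (h x)\<^sup>2 \<partial>M)"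
    have sh: "(\<integral>x. s n x * h x \<partial>M) = (\<Sum>i<n. c i * (\<integral>x. \<phi> i x * h x \<partial>M))" for n
      unfolding s_def sum_distrib_right mult.assoc using sq_int_mult[OF phi h]
      by (subst Bochner_Integration.integral_sum) auto
    have "(\<lambda>n. (\<integral>x. s n x * h x \<partial>M) - (\<integral>x. v x * h x \<partial>M)) \<longlonglongrightarrow> 0"
    proof (rule Lim_null_comparison)
      show "eventually (\<lambda>n. norm ((\<integral>x. s n x * h x \<partial>M) - (\<integral>x. v x * h x \<partial>M)) \<le> sqrt (\<tau> n * B)) sequentially"
      proof (intro always_eventually allI)
        fix n
        have "(\<integral>x. v x * h x \<partial>M) - (\<integral>x. s n x * h x \<partial>M) = (\<integral>x. (v x - s n x) * h x \<partial>M)"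
          using sq_int_mult[OF v h] sq_int_mult[OF s h] by (simp add: left_diff_distrib)
        then have "((\<integral>x. v x * h x \<partial>M) - (\<integral>x. s n x * h x \<partial>M))\<^sup>2 \<le> (\<integral>x. (v x - s n x)\<^sup>2 \<partial>M) * B"
          using integral_Cauchy_Schwarz[OF vs h] by (simp add: B_def)
        also have "\<dots> \<le> \<tau> n * B" by (intro mult_right_mono vs_le) (simp add: B_def)
        finally have "sqrt (((\<integral>x. v x * h x \<partial>M) - (\<integral>x. s n x * h x \<partial>M))\<^sup>2) \<le> sqrt (\<tau> n * B)"
          by (rule real_sqrt_le_mono)
        then show "norm ((\<integral>x. s n x * h x \<partial>M) - (\<integral>x. v x * h x \<partial>M)) \<le> sqrt (\<tau> n * B)"
          by (simp add: abs_minus_commute)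
      qed
      have "(\<lambda>n. sqrt (\<tau> n * B)) \<longlonglongrightarrow> sqrt (0 * B)" by (intro tendsto_intros tau)
      then show "(\<lambda>n. sqrt (\<tau> n * B)) \<longlonglongrightarrow> 0" by simp
    qed
    then show "(\<lambda>i. c i * (\<integral>x. \<phi> i x * h x \<partial>M)) sums (\<integral>x. v x * h x \<partial>M)"
      unfolding sums_def sh by (simp add: LIM_zero_iff)
  qed
qed

section \<open>Coefficients and synthesis in the Dirichlet eigenbasis\<close>

locale eigensystem =
  fixes \<Omega> :: "(real^'n::finite) set" and lam :: "nat \<Rightarrow> real" and \<phi> :: "nat \<Rightarrow> real^'n \<Rightarrow> real"
  assumes open_domain: "open \<Omega>" and bounded_domain: "bounded \<Omega>"
    and eigsys: "dirichlet_eigensystem \<Omega> lam \<phi>"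
begin

abbreviation "ip \<equiv> L2_inner \<Omega>"
abbreviation "inL2 \<equiv> in_L2 \<Omega>"

lemma domain_sets: "\<Omega> \<in> sets lebesgue"
  using open_domain by simp

lemma in_L2_iff: "inL2 v \<longleftrightarrow> sq_int (lebesgue_on \<Omega>) v"
  unfolding in_L2_def sq_int_def set_borel_measurable_def set_integrable_def
  using domain_sets by (simp add: borel_measurable_restrict_space_iff integrable_restrict_space)

lemma L2_inner_eq: "ip v w = (\<integral>x. v x * w x \<partial>lebesgue_on \<Omega>)"
  unfolding L2_inner_def set_lebesgue_integral_def
  using domain_sets by (simp add: integral_restrict_space)

lemma L2_norm_square: "(L2_norm \<Omega> v)\<^sup>2 = ip v v"
proof -
  have "0 \<le> (LINT x:\<Omega>|lebesgue. (v x)\<^sup>2)"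
    unfolding set_lebesgue_integral_def by (intro Bochner_Integration.integral_nonneg) simp
  then show ?thesis by (simp add: L2_norm_def L2_inner_def power2_eq_square)
qed

lemma L2_norm_nonneg: "0 \<le> L2_norm \<Omega> v"
proof -
  have "0 \<le> (LINT x:\<Omega>|lebesgue. (v x)\<^sup>2)"
    unfolding set_lebesgue_integral_def by (intro Bochner_Integration.integral_nonneg) simp
  then show ?thesis by (simp add: L2_norm_def)
qed

lemma finite_measure_domain: "finite_measure (lebesgue_on \<Omega>)"
proof (rule finite_measureI)
  have "\<Omega> \<in> lmeasurable"
    using open_domain bounded_domain by (simp add: lmeasurable_open)
  then show "emeasure (lebesgue_on \<Omega>) (space (lebesgue_on \<Omega>)) \<noteq> \<infinity>"
    using domain_sets by (simp add: emeasure_restrict_space fmeasurable_def space_restrict_space)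
qed

lemma ortho: "ip (\<phi> i) (\<phi> j) = (if i = j then 1 else 0)"
  using eigsys by (simp add: dirichlet_eigensystem_def)

lemma complete: "inL2 v \<Longrightarrow> (\<And>i. ip v (\<phi> i) = 0) \<Longrightarrow> AE x in lebesgue. x \<in> \<Omega> \<longrightarrow> v x = 0"
  using eigsys by (simp add: dirichlet_eigensystem_def)

lemma eigenfunction_L2: "inL2 (\<phi> i)"
proof -
  interpret finite_measure "lebesgue_on \<Omega>" by (rule finite_measure_domain)
  have c: "continuous_on (closure \<Omega>) (\<phi> i)"
    using eigsys by (simp add: dirichlet_eigensystem_def)
  have "compact (closure \<Omega>)" using bounded_domain by (simp add: compact_closure)
  then have "bounded (\<phi> i ` closure \<Omega>)"
    using c by (intro compact_imp_bounded compact_continuous_image)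
  then obtain B where B: "\<forall>x\<in>closure \<Omega>. \<bar>\<phi> i x\<bar> \<le> B" by (auto simp: bounded_iff)
  have m: "\<phi> i \<in> borel_measurable (lebesgue_on \<Omega>)"
    using domain_sets c closure_subset
    by (intro continuous_imp_measurable_on_sets_lebesgue) (auto intro: continuous_on_subset)
  have "integrable (lebesgue_on \<Omega>) (\<lambda>x. (\<phi> i x)\<^sup>2)"
  proof (rule integrable_const_bound)
    show "AE x in lebesgue_on \<Omega>. norm ((\<phi> i x)\<^sup>2) \<le> B\<^sup>2"
    proof (rule AE_I2)
      fix x assume "x \<in> space (lebesgue_on \<Omega>)"
      then have "x \<in> closure \<Omega>" using closure_subset by (auto simp: space_restrict_space)
      then have "\<bar>\<phi> i x\<bar> \<le> \<bar>B\<bar>" using B by fastforce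
      then show "norm ((\<phi> i x)\<^sup>2) \<le> B\<^sup>2" by (simp add: abs_le_square_iff)
    qed
  qed (use m in measurable)
  then show ?thesis using m by (simp add: in_L2_iff sq_int_def)
qed

lemma ip_commute: "ip v w = ip w v"
  by (simp add: L2_inner_def mult.commute)

lemma ip_diff: "inL2 v \<Longrightarrow> inL2 w \<Longrightarrow> inL2 h \<Longrightarrow> ip (\<lambda>x. v x - w x) h = ip v h - ip w h"
  unfolding in_L2_iff L2_inner_eq using sq_int_mult[of "lebesgue_on \<Omega>"] by (simp add: left_diff_distrib)

lemma in_L2_diff: "inL2 v \<Longrightarrow> inL2 w \<Longrightarrow> inL2 (\<lambda>x. v x - w x)"
  unfolding in_L2_iff by (rule sq_int_diff)

text \<open>A representative with prescribed coefficients, chosen anew for each sequence. The choice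
  gives no joint regularity in x and a parameter, but pairings with L2 functions do not depend on
  it. The default 0 makes the map total, so that it can be applied at every time.\<close>

definition synth :: "(nat \<Rightarrow> real) \<Rightarrow> real^'n \<Rightarrow> real" where
  "synth c = (if summable (\<lambda>i. (c i)\<^sup>2)
     then SOME v. inL2 v \<and> (\<forall>h. inL2 h \<longrightarrow> (\<lambda>i. c i * ip (\<phi> i) h) sums ip v h) else (\<lambda>_. 0))"

lemma synth_summable:
  assumes "summable (\<lambda>i. (c i)\<^sup>2)"
  shows "inL2 (synth c)" "inL2 h \<Longrightarrow> (\<lambda>i. c i * ip (\<phi> i) h) sums ip (synth c) h"
proof -
  interpret finite_measure "lebesgue_on \<Omega>" by (rule finite_measure_domain)
  have "\<exists>v. inL2 v \<and> (\<forall>h. inL2 h \<longrightarrow> (\<lambda>i. c i * ip (\<phi> i) h) sums ip v h)"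
    unfolding in_L2_iff L2_inner_eq
    using eigenfunction_L2 ortho assms by (intro Riesz_Fischer) (auto simp: in_L2_iff L2_inner_eq)
  from someI_ex[OF this] show "inL2 (synth c)" "inL2 h \<Longrightarrow> (\<lambda>i. c i * ip (\<phi> i) h) sums ip (synth c) h"
    using assms by (auto simp: synth_def)
qed

lemma synth_not_summable: "\<not> summable (\<lambda>i. (c i)\<^sup>2) \<Longrightarrow> synth c = (\<lambda>_. 0)"
  by (simp add: synth_def)

lemma synth_coeff:
  assumes "summable (\<lambda>i. (c i)\<^sup>2)"
  shows "ip (synth c) (\<phi> j) = c j"
proof -
  have "(\<lambda>i. c i * ip (\<phi> i) (\<phi> j)) sums ip (synth c) (\<phi> j)"
    by (rule synth_summable(2)[OF assms eigenfunction_L2])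
  moreover have "(\<lambda>i. c i * ip (\<phi> i) (\<phi> j)) = (\<lambda>i. if i = j then c j else 0)"
    by (auto simp: ortho)
  ultimately show ?thesis using sums_single[of j "\<lambda>_. c j"] by (simp add: sums_unique2)
qed

lemma synth_norm:
  assumes "summable (\<lambda>i. (c i)\<^sup>2)"
  shows "L2_norm \<Omega> (synth c) = sqrt (\<Sum>i. (c i)\<^sup>2)"
proof -
  have "(\<lambda>i. c i * ip (\<phi> i) (synth c)) sums ip (synth c) (synth c)"
    by (intro synth_summable assms)
  then have "(\<lambda>i. (c i)\<^sup>2) sums (L2_norm \<Omega> (synth c))\<^sup>2"
    by (simp add: ip_commute[of "\<phi> _"] synth_coeff[OF assms] L2_norm_square power2_eq_square[of "c _"])
  then show ?thesis using L2_norm_nonneg by (simp add: sums_iff)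
qed

lemma Bessel:
  assumes "inL2 v"
  shows "(\<Sum>i<n. (ip v (\<phi> i))\<^sup>2) \<le> ip v v"
proof -
  define c where "c i = ip v (\<phi> i)" for i
  define s where "s x = (\<Sum>i<n. c i * \<phi> i x)" for x
  have v: "sq_int (lebesgue_on \<Omega>) v" and phi: "sq_int (lebesgue_on \<Omega>) (\<phi> i)" for i
    using assms eigenfunction_L2 by (auto simp: in_L2_iff)
  have s: "sq_int (lebesgue_on \<Omega>) s"
    unfolding s_def by (intro sq_int_sum sq_int_scale phi)
  have ips: "ip h s = (\<Sum>i<n. c i * ip h (\<phi> i))" if "inL2 h" for h
  proof -
    have "ip h s = (\<integral>x. (\<Sum>i<n. c i * (h x * \<phi> i x)) \<partial>lebesgue_on \<Omega>)"
      unfolding L2_inner_eq s_def by (simp add: sum_distrib_left mult_ac)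
    also have "\<dots> = (\<Sum>i<n. c i * ip h (\<phi> i))"
      using sq_int_mult[OF _ phi] that unfolding L2_inner_eq in_L2_iff
      by (subst Bochner_Integration.integral_sum) auto
    finally show ?thesis .
  qed
  have "ip s (\<phi> j) = c j" if "j < n" for j
    using ips[OF eigenfunction_L2, of j] that by (simp add: ip_commute[of s] ortho if_distrib cong: if_cong)
  then have ss: "ip s s = (\<Sum>i<n. (c i)\<^sup>2)"
    using ips[of s] s by (simp add: in_L2_iff power2_eq_square)
  have vs: "ip v s = (\<Sum>i<n. (c i)\<^sup>2)"
    using ips[OF assms] by (simp add: c_def power2_eq_square)
  have "0 \<le> (\<integral>x. (v x - s x)\<^sup>2 \<partial>lebesgue_on \<Omega>)" by simp
  also have "\<dots> = (\<integral>x. v x * v x - 2 * (v x * s x) + s x * s x \<partial>lebesgue_on \<Omega>)"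
    by (intro Bochner_Integration.integral_cong) (auto simp: power2_eq_square algebra_simps)
  also have "\<dots> = ip v v - 2 * ip v s + ip s s"
    unfolding L2_inner_eq using sq_int_mult[OF v v] sq_int_mult[OF v s] sq_int_mult[OF s s] by simp
  finally show ?thesis by (simp add: ss vs c_def)
qed

text \<open>Completeness is given in the form that a function with zero coefficients vanishes almost
  everywhere. It is applied to v minus the function synthesized from the coefficients of v; the
  pairing of the latter with v is the series.\<close>

lemma Parseval:
  assumes "inL2 v"
  shows "(\<lambda>i. (ip v (\<phi> i))\<^sup>2) sums (L2_norm \<Omega> v)\<^sup>2"
proof -
  define c where "c i = ip v (\<phi> i)" for i
  have cc: "ip v (\<phi> i) = c i" for i by (simp add: c_def)
  have sm: "summable (\<lambda>i. (c i)\<^sup>2)"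
    unfolding c_def by (rule summableI_nonneg_bounded[of _ "ip v v"]) (use Bessel[OF assms] in auto)
  note w = synth_summable[OF sm]
  have "AE x in lebesgue. x \<in> \<Omega> \<longrightarrow> v x - synth c x = 0"
    using assms w(1) eigenfunction_L2 synth_coeff[OF sm]
    by (intro complete in_L2_diff) (auto simp: ip_diff cc)
  then have ae: "AE x in lebesgue_on \<Omega>. v x = synth c x"
    using domain_sets by (simp add: AE_restrict_space_iff)
  have "ip (synth c) v = ip v v"
    unfolding L2_inner_eq using ae assms w(1)
    by (intro integral_cong_AE) (auto simp: in_L2_iff sq_int_def)
  then show ?thesis
    using w(2)[OF assms] by (simp add: cc ip_commute[of "\<phi> _"] L2_norm_square power2_eq_square[of "c _"])
qed

lemma coeff_le_norm: "inL2 v \<Longrightarrow> \<bar>ip v (\<phi> i)\<bar> \<le> L2_norm \<Omega> v"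
proof -
  assume "inL2 v"
  from Parseval[OF this] have "(ip v (\<phi> i))\<^sup>2 \<le> (L2_norm \<Omega> v)\<^sup>2"
    using sum_le_suminf[of "\<lambda>i. (ip v (\<phi> i))\<^sup>2" "{i}"] by (simp add: sums_iff)
  then show ?thesis using L2_norm_nonneg by (simp flip: abs_le_square_iff)
qed

lemma L2_eqI:
  assumes "inL2 v" "inL2 w" "\<And>i. ip v (\<phi> i) = ip w (\<phi> i)"
  shows "AE x in lebesgue. x \<in> \<Omega> \<longrightarrow> v x = w x"
  using complete[OF in_L2_diff[OF assms(1,2)]] assms eigenfunction_L2 by (simp add: ip_diff)

end

section \<open>Comparison of integrals and passage to infinitely many modes\<close>

lemma absolutely_integrable_AE_cong:
  fixes F G :: "real \<Rightarrow> real"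
  assumes ae: "AE s in lebesgue_on {0..T}. F s = G s" and G: "G absolutely_integrable_on {0..t}" and t: "t \<le> T"
  shows "F absolutely_integrable_on {0..t}" "integral {0..t} F = integral {0..t} G"
    "(LINT s:{0..t}|lebesgue. F s) = integral {0..t} G"
proof -
  have "AE s in lebesgue. s \<in> {0..T} \<longrightarrow> F s = G s"
    using ae by (simp add: AE_restrict_space_iff)
  then obtain N where N: "N \<in> null_sets lebesgue" "{s. \<not> (s \<in> {0..T} \<longrightarrow> F s = G s)} \<subseteq> N"
    by (auto simp: eventually_ae_filter)
  then have "negligible N" by (simp add: negligible_iff_null_sets)
  moreover have FG: "F s = G s" if "s \<in> {0..t} - N" for s using N(2) that t by auto
  ultimately show 1: "F absolutely_integrable_on {0..t}"
    using absolutely_integrable_spike[OF G, of N F] by blast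
  show 2: "integral {0..t} F = integral {0..t} G"
    using \<open>negligible N\<close> FG by (intro integral_spike) auto
  show "(LINT s:{0..t}|lebesgue. F s) = integral {0..t} G"
    using set_lebesgue_integral_eq_integral(2)[OF 1] 2 by simp
qed

lemma lebesgue_on_integrable_iff:
  fixes f :: "real \<Rightarrow> real"
  shows "integrable (lebesgue_on {a..b}) f \<longleftrightarrow> f absolutely_integrable_on {a..b}"
  by (simp add: integrable_restrict_space set_integrable_def)

lemma lebesgue_on_integral_eq:
  fixes f :: "real \<Rightarrow> real"
  assumes "f absolutely_integrable_on {a..b}"
  shows "integral\<^sup>L (lebesgue_on {a..b}) f = integral {a..b} f"
  using set_lebesgue_integral_eq_integral(2)[OF assms]
  by (simp add: integral_restrict_space set_lebesgue_integral_def)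

text \<open>A countable form of square summability: with a natural number as bound, the set of times
  at which measurable coefficients are square summable is evidently measurable.\<close>

lemma summable_square_iff_bounded:
  fixes c :: "nat \<Rightarrow> real"
  shows "summable (\<lambda>i. (c i)\<^sup>2) \<longleftrightarrow> (\<exists>B::nat. \<forall>n. (\<Sum>i<n. (c i)\<^sup>2) \<le> real B)"
proof
  assume s: "summable (\<lambda>i. (c i)\<^sup>2)"
  obtain B where "(\<Sum>i. (c i)\<^sup>2) \<le> real B" using real_arch_simple by blast
  moreover have "(\<Sum>i<n. (c i)\<^sup>2) \<le> (\<Sum>i. (c i)\<^sup>2)" for n by (intro sum_le_suminf s) auto
  ultimately show "\<exists>B::nat. \<forall>n. (\<Sum>i<n. (c i)\<^sup>2) \<le> real B" by (meson order_trans)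
next
  assume "\<exists>B::nat. \<forall>n. (\<Sum>i<n. (c i)\<^sup>2) \<le> real B"
  then show "summable (\<lambda>i. (c i)\<^sup>2)" by (auto intro: summableI_nonneg_bounded)
qed

text \<open>Monotone convergence for the p-th powers of the truncated norms. The uniform bound makes
  their supremum finite almost everywhere, and this finiteness is already the summability
  claim.\<close>

lemma monotone_limit_Lp:
  fixes c :: "nat \<Rightarrow> real \<Rightarrow> real"
  assumes cm: "\<And>i. c i \<in> borel_measurable (lebesgue_on {0..T})" and p: "0 < p"
    and int: "\<And>n. (\<lambda>t. l2 {..<n} c t powr p) integrable_on {0..T}"
    and bd: "\<And>n. integral {0..T} (\<lambda>t. l2 {..<n} c t powr p) \<le> B"
  shows "AE t in lebesgue_on {0..T}. summable (\<lambda>i. (c i t)\<^sup>2)"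
    and "integrable (lebesgue_on {0..T}) (\<lambda>t. sqrt (\<Sum>i. (c i t)\<^sup>2) powr p)"
    and "integral\<^sup>L (lebesgue_on {0..T}) (\<lambda>t. sqrt (\<Sum>i. (c i t)\<^sup>2) powr p) \<le> B"
proof -
  let ?M = "lebesgue_on {0..T}"
  have [measurable]: "c i \<in> borel_measurable ?M" for i by (rule cm)
  define h where "h n t = ennreal (l2 {..<n} c t powr p)" for n t
  have hm [measurable]: "h n \<in> borel_measurable ?M" for n unfolding h_def by measurable
  have L2mono: "l2 {..<m} c t \<le> l2 {..<n} c t" if "m \<le> n" for m n t
    unfolding L2_set_def using that by (intro real_sqrt_le_mono sum_mono2) auto
  have hmono: "incseq h"
    unfolding incseq_def le_fun_def h_def using p L2mono
    by (auto intro!: ennreal_leI powr_mono2)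
  have B0: "0 \<le> B" using bd[of 0] p by simp
  have abs_int: "(\<lambda>t. l2 {..<n} c t powr p) absolutely_integrable_on {0..T}" for n
    using int by (simp add: absolutely_integrable_on_def)
  have "(\<integral>\<^sup>+t. h n t \<partial>?M) \<le> ennreal B" for n
  proof -
    have "(\<integral>\<^sup>+t. h n t \<partial>?M) = ennreal (integral\<^sup>L ?M (\<lambda>t. l2 {..<n} c t powr p))"
      unfolding h_def using abs_int by (intro nn_integral_eq_integral) (auto simp: lebesgue_on_integrable_iff)
    also have "\<dots> \<le> ennreal B"
      using bd[of n] by (intro ennreal_leI) (simp add: lebesgue_on_integral_eq[OF abs_int])
    finally show ?thesis .
  qed
  then have "(SUP n. \<integral>\<^sup>+t. h n t \<partial>?M) \<le> ennreal B" by (intro SUP_least)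
  then have supB: "(\<integral>\<^sup>+t. (SUP n. h n t) \<partial>?M) \<le> ennreal B"
    using nn_integral_monotone_convergence_SUP[OF hmono, of ?M] by simp
  then have "(\<integral>\<^sup>+t. (SUP n. h n t) \<partial>?M) \<noteq> \<infinity>" by (auto simp: top_unique)
  then have fin: "AE t in ?M. (SUP n. h n t) \<noteq> \<infinity>"
    by (intro nn_integral_PInf_AE) auto
  then show ae: "AE t in ?M. summable (\<lambda>i. (c i t)\<^sup>2)"
  proof eventually_elim
    case (elim t)
    then obtain r where r: "0 \<le> r" "(SUP n. h n t) = ennreal r" by (metis ennreal_cases infinity_ennreal_def)
    have "(\<Sum>i<n. (c i t)\<^sup>2) \<le> (r powr (1 / p))\<^sup>2" for n
    proof -
      have "h n t \<le> ennreal r" unfolding r(2)[symmetric] by (rule SUP_upper) simp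
      then have "l2 {..<n} c t powr p \<le> r" using r(1) by (simp add: h_def)
      then have "(l2 {..<n} c t powr p) powr (1 / p) \<le> r powr (1 / p)"
        using p by (intro powr_mono2) auto
      then have "l2 {..<n} c t \<le> r powr (1 / p)" using p by (simp add: powr_powr)
      then have "(l2 {..<n} c t)\<^sup>2 \<le> (r powr (1 / p))\<^sup>2" by (intro power_mono) auto
      then show ?thesis by (simp add: L2_set_square)
    qed
    then show ?case by (intro summableI_nonneg_bounded[of _ "(r powr (1 / p))\<^sup>2"]) auto
  qed
  have "(\<integral>\<^sup>+t. ennreal (sqrt (\<Sum>i. (c i t)\<^sup>2) powr p) \<partial>?M) = (\<integral>\<^sup>+t. (SUP n. h n t) \<partial>?M)"
  proof (rule nn_integral_cong_AE)
    show "AE t in ?M. ennreal (sqrt (\<Sum>i. (c i t)\<^sup>2) powr p) = (SUP n. h n t)"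
      using ae
    proof eventually_elim
      case (elim t)
      have "(\<lambda>n. \<Sum>i<n. (c i t)\<^sup>2) \<longlonglongrightarrow> (\<Sum>i. (c i t)\<^sup>2)" by (rule summable_LIMSEQ[OF elim])
      then have "(\<lambda>n. l2 {..<n} c t) \<longlonglongrightarrow> sqrt (\<Sum>i. (c i t)\<^sup>2)"
        unfolding L2_set_def by (rule tendsto_real_sqrt)
      then have "(\<lambda>n. l2 {..<n} c t powr p) \<longlonglongrightarrow> sqrt (\<Sum>i. (c i t)\<^sup>2) powr p"
        using p by (intro tendsto_powr') auto
      then have lim: "(\<lambda>n. h n t) \<longlonglongrightarrow> ennreal (sqrt (\<Sum>i. (c i t)\<^sup>2) powr p)"
        unfolding h_def by (rule tendsto_ennrealI)
      have "(\<lambda>n. h n t) \<longlonglongrightarrow> (SUP n. h n t)"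
        using hmono by (intro LIMSEQ_SUP) (auto simp: incseq_def le_fun_def)
      then show ?case using lim LIMSEQ_unique by blast
    qed
  qed
  then have nn: "(\<integral>\<^sup>+t. ennreal (sqrt (\<Sum>i. (c i t)\<^sup>2) powr p) \<partial>?M) \<le> ennreal B" using supB by simp
  show i: "integrable ?M (\<lambda>t. sqrt (\<Sum>i. (c i t)\<^sup>2) powr p)"
    by (rule integrableI_nonneg) (use nn in \<open>auto intro: le_less_trans\<close>)
  show "integral\<^sup>L ?M (\<lambda>t. sqrt (\<Sum>i. (c i t)\<^sup>2) powr p) \<le> B"
    using nn B0 by (subst (asm) nn_integral_eq_integral[OF i]) auto
qed

section \<open>Existence and uniqueness\<close>

locale subdiffusion = eigensystem \<Omega> lam \<phi> + bounded_kernel k K T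
  for \<Omega> :: "(real^'n::finite) set" and lam \<phi> k K T +
  fixes \<alpha> :: "real \<Rightarrow> real" and \<mu> \<zeta> p \<kappa> :: real
  assumes mu: "0 < \<mu>" and zeta: "0 < \<zeta>" and p: "1 < p" and gap: "0 < \<kappa>" "\<And>i. \<kappa> \<le> lam i"
    and k_abel: "\<And>t. k t = indicator {0<..T} t * abel_kernel \<alpha> t"
begin

lemma lam_pos: "0 < lam i"
  using gap(1) gap(2)[of i] by linarith

text \<open>The two kernels also agree at 0, where \<open>0 powr x = 0\<close>.\<close>
lemma abel_convolution:
  assumes t: "t \<in> {0..T}" and y: "y absolutely_integrable_on {0..t}" and U: "\<And>s. s \<in> {0..t} \<Longrightarrow> U s = y s"
  shows "set_integrable lebesgue {0..t} (\<lambda>s. abel_kernel \<alpha> (t - s) * U s)"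
    and "(LINT s:{0..t}|lebesgue. abel_kernel \<alpha> (t - s) * U s) = conv y t"
proof -
  have eq: "abel_kernel \<alpha> (t - s) * U s = k (t - s) * y s" if "s \<in> {0..t}" for s
  proof (cases "s = t")
    case True
    then show ?thesis by (simp add: k_abel abel_kernel_def)
  next
    case False
    then show ?thesis using that t U[OF that] by (simp add: k_abel)
  qed
  have i: "(\<lambda>s. k (t - s) * y s) absolutely_integrable_on {0..t}" by (rule conv_integrand[OF y])
  then show *: "set_integrable lebesgue {0..t} (\<lambda>s. abel_kernel \<alpha> (t - s) * U s)"
    by (rule set_integrable_cong[THEN iffD1, rotated -1]) (auto simp: eq)
  have "(LINT s:{0..t}|lebesgue. abel_kernel \<alpha> (t - s) * U s) = integral {0..t} (\<lambda>s. abel_kernel \<alpha> (t - s) * U s)"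
    by (rule set_lebesgue_integral_eq_integral(2)[OF *])
  also have "\<dots> = conv y t" unfolding conv_def by (intro integral_cong) (simp add: eq)
  finally show "(LINT s:{0..t}|lebesgue. abel_kernel \<alpha> (t - s) * U s) = conv y t" .
qed

lemma Lp_coeff_absolutely_integrable:
  assumes "Lp_L2 \<Omega> p T w"
  shows "(\<lambda>t. ip (w t) (\<phi> i)) absolutely_integrable_on {0..T}"
proof -
  have "integrable (lebesgue_on {0..T}) (\<lambda>t. ip (w t) (\<phi> i))"
  proof (rule Bochner_Integration.integrable_bound)
    have "integrable (lebesgue_on {0..T}) (\<lambda>t. 1 :: real)"
      unfolding lebesgue_on_integrable_iff by (intro absolutely_integrable_continuous_real continuous_on_const)
    then show "integrable (lebesgue_on {0..T}) (\<lambda>t. 1 + L2_norm \<Omega> (w t) powr p)"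
      using assms by (simp add: Lp_L2_def)
    show "(\<lambda>t. ip (w t) (\<phi> i)) \<in> borel_measurable (lebesgue_on {0..T})"
      using assms eigenfunction_L2 by (simp add: Lp_L2_def weakly_meas_L2_def)
    have "AE t in lebesgue_on {0..T}. inL2 (w t)" using assms by (simp add: Lp_L2_def)
    then show "AE t in lebesgue_on {0..T}. norm (ip (w t) (\<phi> i)) \<le> norm (1 + L2_norm \<Omega> (w t) powr p)"
    proof eventually_elim
      case (elim t)
      have "\<bar>ip (w t) (\<phi> i)\<bar> \<le> L2_norm \<Omega> (w t)" by (rule coeff_le_norm[OF elim])
      also have "\<dots> \<le> 1 + L2_norm \<Omega> (w t) powr p"
        using powr_le_1_plus_powr[of "L2_norm \<Omega> (w t)" 1 p] p L2_norm_nonneg by simp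
      finally show ?case by (simp add: abs_of_nonneg add_nonneg_nonneg)
    qed
  qed
  then show ?thesis by (simp add: lebesgue_on_integrable_iff)
qed

text \<open>The coefficients of a solution are continuous, being indefinite integrals. So in each
  mode the difference of two solutions satisfies a homogeneous Volterra equation at every time, and
  completeness passes from coefficients to functions.\<close>

lemma solution_unique:
  assumes 1: "is_solution \<Omega> lam \<phi> \<mu> \<zeta> \<alpha> p T f u0 u g" and 2: "is_solution \<Omega> lam \<phi> \<mu> \<zeta> \<alpha> p T f u0 v h"
    and t: "t \<in> {0..T}"
  shows "AE x in lebesgue. x \<in> \<Omega> \<longrightarrow> u t x = v t x"
proof (rule L2_eqI)
  show "inL2 (u t)" "inL2 (v t)" using 1 2 t by (auto simp: is_solution_def)
  fix i
  have ga: "(\<lambda>s. ip (g s) (\<phi> i)) absolutely_integrable_on {0..T}"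
    and ha: "(\<lambda>s. ip (h s) (\<phi> i)) absolutely_integrable_on {0..T}"
    using 1 2 by (auto intro!: Lp_coeff_absolutely_integrable simp: is_solution_def)
  have coeff: "ip (w s) (\<phi> i) = ip u0 (\<phi> i) + integral {0..s} (\<lambda>s. ip (q s) (\<phi> i))"
    if "is_solution \<Omega> lam \<phi> \<mu> \<zeta> \<alpha> p T f u0 w q" and s: "s \<in> {0..T}" for w q s
  proof -
    have "(\<lambda>s. ip (q s) (\<phi> i)) absolutely_integrable_on {0..T}"
      using that by (auto intro!: Lp_coeff_absolutely_integrable simp: is_solution_def)
    then have "(\<lambda>s. ip (q s) (\<phi> i)) absolutely_integrable_on {0..s}"
      by (rule absolutely_integrable_on_subinterval) (use s in auto)
    then show ?thesis
      using that set_lebesgue_integral_eq_integral(2)[of "{0..s}" "\<lambda>s. ip (q s) (\<phi> i)"]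
      by (simp add: is_solution_def)
  qed
  have cont: "continuous_on {0..T} (\<lambda>s. ip (w s) (\<phi> i))"
    if "is_solution \<Omega> lam \<phi> \<mu> \<zeta> \<alpha> p T f u0 w q" for w q
  proof -
    have "(\<lambda>s. ip (q s) (\<phi> i)) absolutely_integrable_on {0..T}"
      using that by (auto intro!: Lp_coeff_absolutely_integrable simp: is_solution_def)
    then have "continuous_on {0..T} (\<lambda>s. ip u0 (\<phi> i) + integral {0..s} (\<lambda>s. ip (q s) (\<phi> i)))"
      by (intro continuous_intros indefinite_integral_continuous_1) (simp add: absolutely_integrable_on_def)
    then show ?thesis by (rule continuous_on_eq) (simp add: coeff[OF that])
  qed
  define d where "d s = ip (u s) (\<phi> i) - ip (v s) (\<phi> i)" for s
  have dc: "continuous_on {0..T} d"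
    unfolding d_def by (intro continuous_intros cont[OF 1] cont[OF 2])
  have eqn: "AE s in lebesgue_on {0..T}. ip (q s) (\<phi> i) + \<mu> * lam i * ip (w s) (\<phi> i)
       + \<zeta> * lam i * conv (\<lambda>s. ip (w s) (\<phi> i)) s = ip (f s) (\<phi> i)"
    if sol: "is_solution \<Omega> lam \<phi> \<mu> \<zeta> \<alpha> p T f u0 w q" for w q
  proof -
    have "AE s in lebesgue_on {0..T}. s \<in> {0..T}" by (rule AE_I2) (simp add: space_restrict_space)
    moreover have "AE s in lebesgue_on {0..T}. ip (q s) (\<phi> i) + \<mu> * lam i * ip (w s) (\<phi> i)
       + \<zeta> * lam i * (LINT r:{0..s}|lebesgue. abel_kernel \<alpha> (s - r) * ip (w r) (\<phi> i)) = ip (f s) (\<phi> i)"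
      using sol unfolding is_solution_def by (auto elim: eventually_mono)
    ultimately show ?thesis
    proof eventually_elim
      case (elim s)
      have "(\<lambda>r. ip (w r) (\<phi> i)) absolutely_integrable_on {0..s}"
        using elim(1) by (intro absolutely_integrable_continuous_real continuous_on_subset[OF cont[OF sol]]) auto
      from abel_convolution(2)[OF elim(1) this refl] show ?case using elim(2) by simp
    qed
  qed
  have ae: "AE s in lebesgue_on {0..T}. ip (g s) (\<phi> i) - ip (h s) (\<phi> i)
      = - (\<mu> * lam i * d s) - \<zeta> * lam i * conv d s"
  proof -
    have "AE s in lebesgue_on {0..T}. s \<in> {0..T}" by (rule AE_I2) (simp add: space_restrict_space)
    then show ?thesis using eqn[OF 1] eqn[OF 2]
    proof eventually_elim
      case (elim s)
      have "(\<lambda>r. ip (u r) (\<phi> i)) absolutely_integrable_on {0..s}" "(\<lambda>r. ip (v r) (\<phi> i)) absolutely_integrable_on {0..s}"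
        using elim(1) by (auto intro!: absolutely_integrable_continuous_real continuous_on_subset[OF cont[OF 1]]
            continuous_on_subset[OF cont[OF 2]])
      from conv_diff[OF this] have cd: "conv d s = conv (\<lambda>r. ip (u r) (\<phi> i)) s - conv (\<lambda>r. ip (v r) (\<phi> i)) s"
        by (simp add: d_def[abs_def])
      show ?case unfolding cd using elim(2,3) by (simp add: d_def algebra_simps)
    qed
  qed
  have "d t = 0"
  proof (rule volterra_uniqueness[OF _ _ dc _ t])
    show "0 \<le> \<mu> * lam i" "0 \<le> \<zeta> * lam i" using mu zeta lam_pos[of i] by auto
    fix s assume s: "s \<in> {0..T}"
    have gs: "(\<lambda>s. ip (g s) (\<phi> i)) absolutely_integrable_on {0..s}" "(\<lambda>s. ip (h s) (\<phi> i)) absolutely_integrable_on {0..s}"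
      using absolutely_integrable_on_subinterval[OF ga, of 0 s] absolutely_integrable_on_subinterval[OF ha, of 0 s] s by auto
    have "d s = integral {0..s} (\<lambda>r. ip (g r) (\<phi> i) - ip (h r) (\<phi> i))"
      unfolding d_def coeff[OF 1 s] coeff[OF 2 s] using gs
      by (subst Henstock_Kurzweil_Integration.integral_diff) (auto simp: absolutely_integrable_on_def)
    also have "\<dots> = integral {0..s} (\<lambda>r. - (\<mu> * lam i * d r) - \<zeta> * lam i * conv d r)"
    proof (rule absolutely_integrable_AE_cong(2)[symmetric])
      show "AE r in lebesgue_on {0..T}. - (\<mu> * lam i * d r) - \<zeta> * lam i * conv d r = ip (g r) (\<phi> i) - ip (h r) (\<phi> i)"
        using ae by eventually_elim simp
    qed (use gs s in \<open>auto intro: set_integral_diff\<close>)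
    finally show "d s = integral {0..s} (\<lambda>r. - (\<mu> * lam i * d r) - \<zeta> * lam i * conv d r)" .
  qed
  then show "ip (u t) (\<phi> i) = ip (v t) (\<phi> i)" by (simp add: d_def)
qed

text \<open>Measurability survives the choice made at each time: the pairing with h is a series of
  measurable functions where the coefficients are square summable, and 0 elsewhere.\<close>

lemma synth_weakly_measurable:
  assumes cm: "\<And>i. c i \<in> borel_measurable (lebesgue_on {0..T})"
  shows "weakly_meas_L2 \<Omega> T (\<lambda>t. synth (\<lambda>i. c i t))"
  unfolding weakly_meas_L2_def
proof (intro allI impI)
  fix h assume h: "inL2 h"
  have [measurable]: "c i \<in> borel_measurable (lebesgue_on {0..T})" for i by (rule cm)
  have "ip (synth (\<lambda>i. c i t)) h = (if \<exists>B::nat. \<forall>n. (\<Sum>i<n. (c i t)\<^sup>2) \<le> real B then \<Sum>i. c i t * ip (\<phi> i) h else 0)" for t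
  proof (cases "summable (\<lambda>i. (c i t)\<^sup>2)")
    case True
    then show ?thesis
      using synth_summable(2)[OF True h] summable_square_iff_bounded[of "\<lambda>i. c i t"] by (simp add: sums_iff)
  next
    case False
    then have nb: "\<not> (\<exists>B::nat. \<forall>n. (\<Sum>i<n. (c i t)\<^sup>2) \<le> real B)"
      using summable_square_iff_bounded[of "\<lambda>i. c i t"] by blast
    show ?thesis unfolding if_not_P[OF nb] synth_not_summable[OF False] by (simp add: L2_inner_def)
  qed
  then show "(\<lambda>t. ip (synth (\<lambda>i. c i t)) h) \<in> borel_measurable (lebesgue_on {0..T})"
    by (simp only:) measurable
qed

lemma synth_Lp:
  assumes cm: "\<And>i. c i \<in> borel_measurable (lebesgue_on {0..T})"
    and int: "\<And>n. (\<lambda>t. l2 {..<n} c t powr p) integrable_on {0..T}"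
    and bd: "\<And>n. integral {0..T} (\<lambda>t. l2 {..<n} c t powr p) \<le> B"
  shows "Lp_L2 \<Omega> p T (\<lambda>t. synth (\<lambda>i. c i t))"
    and "Lp_L2_norm \<Omega> p T (\<lambda>t. synth (\<lambda>i. c i t)) \<le> B powr (1 / p)"
proof -
  have p0: "0 < p" using p by simp
  note lim = monotone_limit_Lp[OF cm p0 int bd]
  have wm: "weakly_meas_L2 \<Omega> T (\<lambda>t. synth (\<lambda>i. c i t))" by (rule synth_weakly_measurable[OF cm])
  have [measurable]: "c i \<in> borel_measurable (lebesgue_on {0..T})" for i by (rule cm)
  have norm: "L2_norm \<Omega> (synth (\<lambda>i. c i t)) =
      (if \<exists>B::nat. \<forall>n. (\<Sum>i<n. (c i t)\<^sup>2) \<le> real B then sqrt (\<Sum>i. (c i t)\<^sup>2) else 0)" for t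
    using synth_norm[of "\<lambda>i. c i t"] summable_square_iff_bounded[of "\<lambda>i. c i t"]
    by (cases "summable (\<lambda>i. (c i t)\<^sup>2)") (auto simp: synth_not_summable L2_norm_def)
  have nm: "(\<lambda>t. L2_norm \<Omega> (synth (\<lambda>i. c i t)) powr p) \<in> borel_measurable (lebesgue_on {0..T})"
    unfolding norm by measurable
  have ae: "AE t in lebesgue_on {0..T}. sqrt (\<Sum>i. (c i t)\<^sup>2) powr p = L2_norm \<Omega> (synth (\<lambda>i. c i t)) powr p"
    using lim(1) by eventually_elim (simp add: synth_norm)
  have aeL2: "AE t in lebesgue_on {0..T}. inL2 (synth (\<lambda>i. c i t))"
    using lim(1) by eventually_elim (rule synth_summable)
  have ni: "integrable (lebesgue_on {0..T}) (\<lambda>t. L2_norm \<Omega> (synth (\<lambda>i. c i t)) powr p)"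
    by (rule integrable_cong_AE_imp[OF lim(2) nm ae])
  then show "Lp_L2 \<Omega> p T (\<lambda>t. synth (\<lambda>i. c i t))"
    using wm aeL2 by (simp add: Lp_L2_def)
  have "integral\<^sup>L (lebesgue_on {0..T}) (\<lambda>t. L2_norm \<Omega> (synth (\<lambda>i. c i t)) powr p)
      = integral\<^sup>L (lebesgue_on {0..T}) (\<lambda>t. sqrt (\<Sum>i. (c i t)\<^sup>2) powr p)"
    using ae nm by (intro integral_cong_AE) (auto elim: eventually_mono)
  then show "Lp_L2_norm \<Omega> p T (\<lambda>t. synth (\<lambda>i. c i t)) \<le> B powr (1 / p)"
    unfolding Lp_L2_norm_def using lim(3) p by (intro powr_mono2) (auto intro: Bochner_Integration.integral_nonneg)
qed

text \<open>The coefficients of f are Lebesgue measurable, whereas the Fubini argument asks for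
  Borel forcing. Each is changed on a null set, and countably many modes share one exceptional
  set.\<close>

lemma borel_coeffs:
  assumes f: "Lp_L2 \<Omega> p T f"
  shows "\<exists>b. (\<forall>i. b i \<in> borel_measurable borel) \<and>
    (AE t in lebesgue_on {0..T}. \<forall>i. ip (f t) (\<phi> i) = b i t)"
proof -
  have "\<exists>b\<in>borel_measurable borel. AE t in lebesgue_on {0..T}. ip (f t) (\<phi> i) = b t" for i
  proof -
    have "(\<lambda>t. ip (f t) (\<phi> i)) \<in> borel_measurable (lebesgue_on {0..T})"
      using f eigenfunction_L2 by (simp add: Lp_L2_def weakly_meas_L2_def)
    then have "(\<lambda>t. indicator {0..T} t *\<^sub>R ip (f t) (\<phi> i)) \<in> borel_measurable lebesgue"
      by (simp add: borel_measurable_restrict_space_iff)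
    from completion_ex_borel_measurable_real[OF this] obtain b
      where b: "b \<in> borel_measurable lborel" "AE t in lborel. indicator {0..T} t *\<^sub>R ip (f t) (\<phi> i) = b t" by blast
    have "AE t in lebesgue. indicator {0..T} t *\<^sub>R ip (f t) (\<phi> i) = b t" by (rule AE_completion[OF b(2)])
    then have "AE t in lebesgue. t \<in> {0..T} \<longrightarrow> ip (f t) (\<phi> i) = b t"
      by eventually_elim (auto simp: indicator_def split: if_splits)
    then show ?thesis using b(1) by (intro bexI[of _ b]) (auto simp: AE_restrict_space_iff)
  qed
  then obtain b where "\<And>i. b i \<in> borel_measurable borel" "\<And>i. AE t in lebesgue_on {0..T}. ip (f t) (\<phi> i) = b i t"
    by metis
  then show ?thesis by (intro exI[of _ b]) (auto simp: AE_all_countable)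
qed

text \<open>Each mode is solved separately, so what remains is to assemble the coefficient
  functions; the a priori bound on the first n modes, uniform in n, permits this for \<lambda> y and
  for the time derivative.\<close>

lemma solution_exists:
  "\<exists>Q>0. \<forall>f u0. Lp_L2 \<Omega> p T f \<and> in_Hs \<Omega> lam \<phi> 2 u0 \<longrightarrow>
     (\<exists>u g. is_solution \<Omega> lam \<phi> \<mu> \<zeta> \<alpha> p T f u0 u g
        \<and> Lp_L2_norm \<Omega> p T u + Lp_L2_norm \<Omega> p T g + Lp_H2_norm \<Omega> lam \<phi> p T u
            \<le> Q * (Lp_L2_norm \<Omega> p T f + Hs_norm \<Omega> lam \<phi> 2 u0))"
proof -
  have p0: "0 < p" using p by simp
  obtain Q where Q: "0 < Q" and apriori: "a_priori_bound \<mu> \<zeta> p Q"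
    using a_priori_estimate[OF p mu zeta] by blast
  \<comment> \<open>The p-th power of the factor in |y| \<le> |\<lambda> y| / \<kappa>, where
    \<kappa> is the lower bound of the spectrum.\<close>
  define \<beta> where "\<beta> = (1 / \<kappa>) powr p"
  have \<beta>: "0 < \<beta>" using gap by (simp add: \<beta>_def)
  \<comment> \<open>One summand for each of u, its time derivative g and the norm of u with two
    spatial derivatives; the factors 2 come from A^p + F^p \<le> 2 (F + A)^p.\<close>
  define Q' where "Q' = (2 * (\<beta> * Q)) powr (1 / p) + (2 * Q) powr (1 / p) + (2 * Q) powr (1 / p)"
  have Q': "0 < Q'" using Q \<beta> by (simp add: Q'_def add_pos_pos)
  show ?thesis
  proof (intro exI[of _ Q'] conjI Q' allI impI)
    fix f :: "real \<Rightarrow> real^'n \<Rightarrow> real" and u0 :: "real^'n \<Rightarrow> real"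
    assume "Lp_L2 \<Omega> p T f \<and> in_Hs \<Omega> lam \<phi> 2 u0"
    then have f: "Lp_L2 \<Omega> p T f" and u0: "in_Hs \<Omega> lam \<phi> 2 u0" by auto
    let ?M = "lebesgue_on {0..T}"
    define a where "a i = ip u0 (\<phi> i)" for i
    define A where "A = Hs_norm \<Omega> lam \<phi> 2 u0"
    have sq: "lam i powr 2 * x\<^sup>2 = (lam i * x)\<^sup>2" for i x
      using lam_pos[of i] by (simp add: power_mult_distrib)
    have asum: "summable (\<lambda>i. (lam i * a i)\<^sup>2)" and A: "A = sqrt (\<Sum>i. (lam i * a i)\<^sup>2)"
      using u0 by (auto simp: in_Hs_def A_def Hs_norm_def a_def sq)
    have A0: "0 \<le> A" unfolding A using asum by (intro real_sqrt_ge_zero suminf_nonneg) auto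
    have naA: "L2_set (\<lambda>i. lam i * a i) {..<n} \<le> A" for n
      unfolding L2_set_def A by (intro real_sqrt_le_mono sum_le_suminf asum) auto
    obtain b where bm: "\<And>i. b i \<in> borel_measurable borel"
      and bf: "AE t in ?M. \<forall>i. ip (f t) (\<phi> i) = b i t"
      using borel_coeffs[OF f] by blast
    have fL2: "AE t in ?M. inL2 (f t)" and fint: "integrable ?M (\<lambda>t. L2_norm \<Omega> (f t) powr p)"
      using f by (auto simp: Lp_L2_def)
    define \<Phi> where "\<Phi> = integral\<^sup>L ?M (\<lambda>t. L2_norm \<Omega> (f t) powr p)"
    have \<Phi>0: "0 \<le> \<Phi>" unfolding \<Phi>_def by (intro Bochner_Integration.integral_nonneg) simp
    have nb_le: "AE t in ?M. l2 {..<n} b t powr p \<le> L2_norm \<Omega> (f t) powr p" for n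
      using fL2 bf
    proof eventually_elim
      case (elim t)
      have "l2 {..<n} b t = sqrt (\<Sum>i<n. (ip (f t) (\<phi> i))\<^sup>2)"
        using elim(2) by (simp add: L2_set_def)
      also have "\<dots> \<le> sqrt (ip (f t) (f t))" by (intro real_sqrt_le_mono Bessel elim)
      also have "\<dots> = L2_norm \<Omega> (f t)" using L2_norm_nonneg by (simp flip: L2_norm_square)
      finally show ?case using p by (intro powr_mono2) auto
    qed
    have nbm: "(\<lambda>t. l2 {..<n} b t powr p) \<in> borel_measurable ?M" for n
      using bm by (intro borel_measurable_lebesgue_on) measurable
    have nbi: "integrable ?M (\<lambda>t. l2 {..<n} b t powr p)" for n
      using nb_le[of n] by (intro Bochner_Integration.integrable_bound[OF fint nbm]) simp
    then have nba: "(\<lambda>t. l2 {..<n} b t powr p) absolutely_integrable_on {0..T}" for n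
      by (simp add: lebesgue_on_integrable_iff)
    then have nbint: "(\<lambda>t. l2 {..<n} b t powr p) integrable_on {0..T}" for n
      by (simp add: absolutely_integrable_on_def)
    have nb\<Phi>: "integral {0..T} (\<lambda>t. l2 {..<n} b t powr p) \<le> \<Phi>" for n
      unfolding \<Phi>_def lebesgue_on_integral_eq[OF nba, symmetric]
      by (intro integral_mono_AE nbi fint nb_le)
    \<comment> \<open>\<open>Suc i\<close> is the shortest truncation that contains mode i.\<close>
    have ba: "b i absolutely_integrable_on {0..T}" for i
      by (rule Lp_family_absolutely_integrable[OF bm _ _ nbint[of "Suc i"]]) (use p in auto)
    have "\<exists>y. continuous_on {0..T} y \<and> (\<forall>t\<in>{0..T}. y t = mild (\<mu> * lam i) (\<zeta> * lam i) (a i) (b i) y t)" for i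
      using mu zeta lam_pos[of i] by (intro mild_fixed_point ba) auto
    then obtain y where yc: "\<And>i. continuous_on {0..T} (y i)"
      and ym: "\<And>i. \<forall>t\<in>{0..T}. y i t = mild (\<mu> * lam i) (\<zeta> * lam i) (a i) (b i) (y i) t"
      by metis
    define X where "X = A powr p + \<Phi>"
    have X0: "0 \<le> X" using \<Phi>0 by (simp add: X_def)
    \<comment> \<open>The time derivative of y i as the equation dictates it; \<open>yeq\<close>
      confirms that y i is its integral.\<close>
    define G where "G i t = b i t - \<zeta> * lam i * conv (y i) t - \<mu> * lam i * y i t" for i t
    have est: "integral {0..T} (\<lambda>t. L2_set (\<lambda>i. lam i * y i t) {..<n} powr p) \<le> Q * X"
      "(\<lambda>t. l2 {..<n} G t powr p) integrable_on {0..T}"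
      "integral {0..T} (\<lambda>t. l2 {..<n} G t powr p) \<le> Q * X" for n
    proof -
      have "\<forall>i\<in>{..<n}. 0 < lam i \<and> b i \<in> borel_measurable borel \<and> continuous_on {0..T} (y i)
          \<and> (\<forall>t\<in>{0..T}. y i t = mild (\<mu> * lam i) (\<zeta> * lam i) (a i) (b i) (y i) t)"
        using lam_pos bm yc ym by blast
      note * = apriori[unfolded a_priori_bound_def, rule_format, OF finite_lessThan this[rule_format] nbint[of n]]
      have "Q * (L2_set (\<lambda>i. lam i * a i) {..<n} powr p + integral {0..T} (\<lambda>t. l2 {..<n} b t powr p)) \<le> Q * X"
        unfolding X_def using Q p naA by (intro mult_left_mono add_mono powr_mono2 nb\<Phi>) auto
      then show "integral {0..T} (\<lambda>t. L2_set (\<lambda>i. lam i * y i t) {..<n} powr p) \<le> Q * X"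
        "(\<lambda>t. l2 {..<n} G t powr p) integrable_on {0..T}"
        "integral {0..T} (\<lambda>t. l2 {..<n} G t powr p) \<le> Q * X"
        using * unfolding G_def by (blast intro: order_trans)+
    qed
    have ymeas: "y i \<in> borel_measurable ?M" for i
      by (intro continuous_imp_measurable_on_sets_lebesgue yc) auto
    have Ga: "G i absolutely_integrable_on {0..T}" for i
      unfolding G_def
      by (intro set_integral_diff set_integrable_mult_right ba conv_absolutely_integrable
          absolutely_integrable_continuous_real yc)
    have Gmeas: "G i \<in> borel_measurable ?M" for i
      using Ga[of i] by (simp flip: lebesgue_on_integrable_iff)
    have yint: "(\<lambda>t. l2 {..<n} y t powr p) integrable_on {0..T}" for n
      using p by (intro integrable_continuous_real continuous_on_powr_nonneg continuous_on_L2_set yc) auto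
    have wint: "(\<lambda>t. L2_set (\<lambda>i. lam i * y i t) {..<n} powr p) integrable_on {0..T}" for n
      using p by (intro integrable_continuous_real continuous_on_powr_nonneg continuous_on_L2_set continuous_intros yc) auto
    have yest: "integral {0..T} (\<lambda>t. l2 {..<n} y t powr p) \<le> \<beta> * Q * X" for n
    proof -
      have "integral {0..T} (\<lambda>t. l2 {..<n} y t powr p)
          \<le> integral {0..T} (\<lambda>t. \<beta> * L2_set (\<lambda>i. lam i * y i t) {..<n} powr p)"
      proof (intro integral_le yint integrable_on_mult_right wint)
        fix t
        have "l2 {..<n} y t = L2_set (\<lambda>i. \<bar>y i t\<bar>) {..<n}" by (simp add: L2_set_def)
        also have "\<dots> \<le> L2_set (\<lambda>i. 1 / \<kappa> * \<bar>lam i * y i t\<bar>) {..<n}"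
        proof (rule L2_set_mono)
          fix i
          have "\<kappa> * \<bar>y i t\<bar> \<le> lam i * \<bar>y i t\<bar>" by (intro mult_right_mono gap) simp
          then show "\<bar>y i t\<bar> \<le> 1 / \<kappa> * \<bar>lam i * y i t\<bar>"
            using gap(1) lam_pos[of i] by (simp add: abs_mult field_simps)
        qed simp
        also have "\<dots> = 1 / \<kappa> * L2_set (\<lambda>i. \<bar>lam i * y i t\<bar>) {..<n}"
          using gap(1) by (intro L2_set_right_distrib[symmetric]) simp
        also have "L2_set (\<lambda>i. \<bar>lam i * y i t\<bar>) {..<n} = L2_set (\<lambda>i. lam i * y i t) {..<n}"
          by (simp add: L2_set_def)
        finally have "l2 {..<n} y t powr p \<le> (1 / \<kappa> * L2_set (\<lambda>i. lam i * y i t) {..<n}) powr p"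
          using p by (intro powr_mono2) auto
        also have "\<dots> = \<beta> * L2_set (\<lambda>i. lam i * y i t) {..<n} powr p"
          unfolding \<beta>_def using gap(1) by (intro powr_mult) 
        finally show "l2 {..<n} y t powr p \<le> \<beta> * L2_set (\<lambda>i. lam i * y i t) {..<n} powr p" .
      qed
      also have "\<dots> = \<beta> * integral {0..T} (\<lambda>t. L2_set (\<lambda>i. lam i * y i t) {..<n} powr p)" by simp
      also have "\<dots> \<le> \<beta> * (Q * X)" using \<beta> by (intro mult_left_mono est) auto
      finally show ?thesis by (simp add: mult.assoc)
    qed
    have yeq: "y i t = a i + integral {0..t} (G i)" if "t \<in> {0..T}" for i t
      using mild_imp_integral_equation[OF bm ba yc _ that, of i] ym unfolding G_def by blast
    have a2sum: "summable (\<lambda>i. (a i)\<^sup>2)"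
      using Parseval[of u0] u0 by (auto simp: in_Hs_def a_def sums_iff)
    \<comment> \<open>Required at every t, since u is to be in L2 with the right coefficients at
      each time, while the bound on \<lambda> y speaks of almost every t. Minkowski's inequality for
      y = a + (integral of G) gives a bound that is uniform in t.\<close>
    have ysum: "summable (\<lambda>i. (y i t)\<^sup>2)" if t: "t \<in> {0..T}" for t
    proof -
      define S where "S = sqrt (\<Sum>i. (a i)\<^sup>2) + (T + Q * X)"
      have "l2 {..<n} y t \<le> S" for n
      proof -
        have Gi: "G i integrable_on {0..t}" for i
          using absolutely_integrable_on_subinterval[OF Ga, of 0 t i] t by (auto simp: absolutely_integrable_on_def)
        have nG: "(\<lambda>r. l2 {..<n} G r) integrable_on {0..T}"
        proof (rule measurable_bounded_by_integrable_imp_integrable_real)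
          show "(\<lambda>r. l2 {..<n} G r) \<in> borel_measurable ?M"
            using Gmeas by measurable
          show "(\<lambda>r. 1 + l2 {..<n} G r powr p) integrable_on {0..T}"
            by (intro integrable_add integrable_const_Icc est)
          show "\<bar>l2 {..<n} G r\<bar> \<le> 1 + l2 {..<n} G r powr p" for r
            using powr_le_1_plus_powr[of "l2 {..<n} G r" 1 p] p by simp
        qed simp
        then have nGt: "(\<lambda>r. l2 {..<n} G r) integrable_on {0..t}"
          by (rule integrable_on_subinterval) (use t in auto)
        have "l2 {..<n} y t = L2_set (\<lambda>i. a i + integral {0..t} (G i)) {..<n}"
          by (simp add: yeq[OF t])
        also have "\<dots> \<le> L2_set a {..<n} + L2_set (\<lambda>i. integral {0..t} (G i)) {..<n}"
          by (rule L2_set_triangle_ineq)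
        also have "L2_set a {..<n} \<le> sqrt (\<Sum>i. (a i)\<^sup>2)"
          unfolding L2_set_def by (intro real_sqrt_le_mono sum_le_suminf a2sum) auto
        also have "L2_set (\<lambda>i. integral {0..t} (G i)) {..<n} \<le> integral {0..t} (\<lambda>r. l2 {..<n} G r)"
          by (intro L2_set_integral_le Gi nGt) simp
        also have "\<dots> \<le> integral {0..T} (\<lambda>r. l2 {..<n} G r)"
          using t by (intro integral_subset_le nG nGt) auto
        also have "\<dots> \<le> integral {0..T} (\<lambda>r. 1 + l2 {..<n} G r powr p)"
        proof (intro integral_le nG integrable_add integrable_const_Icc est)
          show "l2 {..<n} G r \<le> 1 + l2 {..<n} G r powr p" for r
            using powr_le_1_plus_powr[of "l2 {..<n} G r" 1 p] p by simp
        qed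
        also have "\<dots> = T + integral {0..T} (\<lambda>r. l2 {..<n} G r powr p)"
          using T_pos by (subst Henstock_Kurzweil_Integration.integral_add[OF integrable_const_Icc est(2)]) simp
        also have "\<dots> \<le> T + Q * X" using est(3) by simp
        finally show ?thesis by (simp add: S_def)
      qed
      then have "(\<Sum>i<n. (y i t)\<^sup>2) \<le> S\<^sup>2" for n
        by (metis L2_set_nonneg L2_set_square power_mono)
      then show ?thesis by (intro summableI_nonneg_bounded[of _ "S\<^sup>2"]) auto
    qed
    define u where "u t = synth (\<lambda>i. y i t)" for t
    define g where "g t = synth (\<lambda>i. G i t)" for t
    have uc: "ip (u t) (\<phi> i) = y i t" if "t \<in> {0..T}" for t i
      unfolding u_def by (rule synth_coeff[OF ysum[OF that]])
    have AET: "AE t in ?M. t \<in> {0..T}" by (rule AE_I2) (simp add: space_restrict_space)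
    have Gsum: "AE t in ?M. summable (\<lambda>i. (G i t)\<^sup>2)"
      by (rule monotone_limit_Lp(1)[OF Gmeas p0 est(2,3)])
    have gc: "AE t in ?M. \<forall>i. ip (g t) (\<phi> i) = G i t"
      using Gsum by eventually_elim (simp add: g_def synth_coeff)
    have uLp: "Lp_L2 \<Omega> p T u" "Lp_L2_norm \<Omega> p T u \<le> (\<beta> * Q * X) powr (1 / p)"
      unfolding u_def using synth_Lp[OF ymeas yint yest] by auto
    have gLp: "Lp_L2 \<Omega> p T g" "Lp_L2_norm \<Omega> p T g \<le> (Q * X) powr (1 / p)"
      unfolding g_def using synth_Lp[OF Gmeas est(2,3)] by auto
    have wmeas: "(\<lambda>t. lam i * y i t) \<in> borel_measurable ?M" for i using ymeas[of i] by measurable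
    note wlim = monotone_limit_Lp[OF wmeas p0 wint est(1)]
    have Hs: "Hs_norm \<Omega> lam \<phi> 2 (u t) = sqrt (\<Sum>i. (lam i * y i t)\<^sup>2)" if "t \<in> {0..T}" for t
      unfolding Hs_norm_def by (simp add: uc[OF that] sq)
    have uH2: "Lp_H2 \<Omega> lam \<phi> p T u"
      unfolding Lp_H2_def
    proof (intro conjI)
      show "weakly_meas_L2 \<Omega> T u" using uLp by (simp add: Lp_L2_def)
      show "AE t in ?M. in_Hs \<Omega> lam \<phi> 2 (u t)"
        using wlim(1) AET
      proof eventually_elim
        case (elim t)
        have "inL2 (u t)" unfolding u_def by (rule synth_summable[OF ysum[OF elim(2)]])
        then show ?case using elim by (simp add: in_Hs_def uc sq)
      qed
      show "integrable ?M (\<lambda>t. Hs_norm \<Omega> lam \<phi> 2 (u t) powr p)"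
        using wlim(2)
        by (rule Bochner_Integration.integrable_cong[THEN iffD1, rotated -1]) (auto simp: Hs space_restrict_space)
    qed
    have uH2n: "Lp_H2_norm \<Omega> lam \<phi> p T u \<le> (Q * X) powr (1 / p)"
    proof -
      have "integral\<^sup>L ?M (\<lambda>t. Hs_norm \<Omega> lam \<phi> 2 (u t) powr p) = integral\<^sup>L ?M (\<lambda>t. sqrt (\<Sum>i. (lam i * y i t)\<^sup>2) powr p)"
        by (intro Bochner_Integration.integral_cong) (auto simp: Hs space_restrict_space)
      then show ?thesis unfolding Lp_H2_norm_def using wlim(3) p
        by (intro powr_mono2) (auto intro: Bochner_Integration.integral_nonneg)
    qed
    have sol: "is_solution \<Omega> lam \<phi> \<mu> \<zeta> \<alpha> p T f u0 u g"
      unfolding is_solution_def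
    proof (intro conjI uLp(1) gLp(1) uH2 ballI allI)
      fix t i assume t: "t \<in> {0..T}"
      show "inL2 (u t)" unfolding u_def by (rule synth_summable[OF ysum[OF t]])
      have "(LINT s:{0..t}|lebesgue. ip (g s) (\<phi> i)) = integral {0..t} (G i)"
      proof (rule absolutely_integrable_AE_cong(3))
        show "AE s in ?M. ip (g s) (\<phi> i) = G i s" using gc by eventually_elim simp
        show "G i absolutely_integrable_on {0..t}"
          by (rule absolutely_integrable_on_subinterval[OF Ga]) (use t in auto)
      qed (use t in simp)
      then show "ip (u t) (\<phi> i) = ip u0 (\<phi> i) + (LINT s:{0..t}|lebesgue. ip (g s) (\<phi> i))"
        using uc[OF t] yeq[OF t] by (simp add: a_def)
    next
      show "AE t in ?M. \<forall>i. set_integrable lebesgue {0..t} (\<lambda>s. abel_kernel \<alpha> (t - s) * ip (u s) (\<phi> i))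
        \<and> ip (g t) (\<phi> i) + \<mu> * lam i * ip (u t) (\<phi> i)
          + \<zeta> * lam i * (LINT s:{0..t}|lebesgue. abel_kernel \<alpha> (t - s) * ip (u s) (\<phi> i)) = ip (f t) (\<phi> i)"
        using gc bf AET
      proof eventually_elim
        case (elim t)
        show ?case
        proof
          fix i
          have ya: "y i absolutely_integrable_on {0..t}"
            using elim(3) by (intro absolutely_integrable_continuous_real continuous_on_subset[OF yc]) auto
          have us: "ip (u s) (\<phi> i) = y i s" if "s \<in> {0..t}" for s
            using that elim(3) by (intro uc) auto
          note ac = abel_convolution[OF elim(3) ya us]
          show "set_integrable lebesgue {0..t} (\<lambda>s. abel_kernel \<alpha> (t - s) * ip (u s) (\<phi> i))
            \<and> ip (g t) (\<phi> i) + \<mu> * lam i * ip (u t) (\<phi> i)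
              + \<zeta> * lam i * (LINT s:{0..t}|lebesgue. abel_kernel \<alpha> (t - s) * ip (u s) (\<phi> i)) = ip (f t) (\<phi> i)"
            using ac elim uc[OF elim(3), of i] by (simp add: G_def)
        qed
      qed
    qed
    define F where "F = Lp_L2_norm \<Omega> p T f"
    have F: "0 \<le> F" "F powr p = \<Phi>"
      using p \<Phi>0 by (auto simp: F_def Lp_L2_norm_def \<Phi>_def[symmetric] powr_powr)
    \<comment> \<open>Turns a bound on p-th powers into one that is linear in the two data norms,
      using X = A^p + F^p \<le> 2 (F + A)^p.\<close>
    have root: "(c * X) powr (1 / p) \<le> (2 * c) powr (1 / p) * (F + A)" if "0 \<le> c" for c
    proof -
      have "A powr p \<le> (F + A) powr p" "F powr p \<le> (F + A) powr p"
        using A0 F p by (auto intro!: powr_mono2)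
      then have "X \<le> 2 * (F + A) powr p" by (simp add: X_def F(2)[symmetric])
      then have "(c * X) powr (1 / p) \<le> (2 * c * (F + A) powr p) powr (1 / p)"
        using p that X0 mult_left_mono[of X "2 * (F + A) powr p" c]
        by (intro powr_mono2) (auto simp: mult_ac)
      also have "\<dots> = (2 * c) powr (1 / p) * (F + A)"
        using p that F A0 by (simp add: powr_mult powr_powr)
      finally show ?thesis .
    qed
    have "Lp_L2_norm \<Omega> p T u + Lp_L2_norm \<Omega> p T g + Lp_H2_norm \<Omega> lam \<phi> p T u
        \<le> (2 * (\<beta> * Q)) powr (1 / p) * (F + A) + (2 * Q) powr (1 / p) * (F + A) + (2 * Q) powr (1 / p) * (F + A)"
      using uLp(2) gLp(2) uH2n root[of "\<beta> * Q"] root[of Q] Q \<beta> by (intro add_mono) auto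
    also have "\<dots> = Q' * (F + A)" by (simp add: Q'_def algebra_simps)
    finally show "\<exists>u g. is_solution \<Omega> lam \<phi> \<mu> \<zeta> \<alpha> p T f u0 u g
        \<and> Lp_L2_norm \<Omega> p T u + Lp_L2_norm \<Omega> p T g + Lp_H2_norm \<Omega> lam \<phi> p T u
            \<le> Q' * (Lp_L2_norm \<Omega> p T f + Hs_norm \<Omega> lam \<phi> 2 u0)"
      using sol by (auto simp: F_def A_def)
  qed
qed

end

theorem theorem3p2:
  fixes \<Omega> :: "(real^'n::finite) set"
    and lam :: "nat \<Rightarrow> real" and \<phi> :: "nat \<Rightarrow> real^'n \<Rightarrow> real"
    and T \<mu> \<zeta> p \<alpha>\<^sub>s Qa :: real
    and \<alpha> \<alpha>' \<alpha>'' :: "real \<Rightarrow> real"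
  assumes "CARD('n) \<le> 3"
    and "open \<Omega>" and "bounded \<Omega>" and "connected \<Omega>" and "\<Omega> \<noteq> {}" and "smooth_boundary \<Omega>"
    and "dirichlet_eigensystem \<Omega> lam \<phi>"
    and "T > 0" and "\<mu> > 0" and "\<zeta> > 0"
    and "0 < \<alpha>\<^sub>s" and "\<forall>t\<in>{0..T}. \<alpha>\<^sub>s \<le> \<alpha> t \<and> \<alpha> t \<le> 1" and "\<alpha> 0 = 1"
    and "\<forall>t\<in>{0..T}. (\<alpha> has_real_derivative \<alpha>' t) (at t within {0..T})
                   \<and> (\<alpha>' has_real_derivative \<alpha>'' t) (at t within {0..T})
                   \<and> \<bar>\<alpha>' t\<bar> \<le> Qa \<and> \<bar>\<alpha>'' t\<bar> \<le> Qa"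
    and "1 < p"
  shows "\<exists>Q>0. \<forall>f u0. Lp_L2 \<Omega> p T f \<and> in_Hs \<Omega> lam \<phi> 2 u0 \<longrightarrow>
           (\<exists>u g. is_solution \<Omega> lam \<phi> \<mu> \<zeta> \<alpha> p T f u0 u g
              \<and> Lp_L2_norm \<Omega> p T u + Lp_L2_norm \<Omega> p T g + Lp_H2_norm \<Omega> lam \<phi> p T u
                  \<le> Q * (Lp_L2_norm \<Omega> p T f + Hs_norm \<Omega> lam \<phi> 2 u0))
         \<and> (\<forall>u g v h. is_solution \<Omega> lam \<phi> \<mu> \<zeta> \<alpha> p T f u0 u g
              \<and> is_solution \<Omega> lam \<phi> \<mu> \<zeta> \<alpha> p T f u0 v h
              \<longrightarrow> (\<forall>t\<in>{0..T}. AE x in lebesgue. x \<in> \<Omega> \<longrightarrow> u t x = v t x))"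
proof -
  have "\<exists>K. bounded_kernel (\<lambda>t. indicator {0<..T} t * abel_kernel \<alpha> t) K T"
    using assms by (intro abel_kernel_bounded[where \<alpha>\<^sub>s=\<alpha>\<^sub>s and \<alpha>'=\<alpha>' and Q=Qa]) auto
  then obtain K where "bounded_kernel (\<lambda>t. indicator {0<..T} t * abel_kernel \<alpha> t) K T" ..
  moreover obtain c where "0 < c" "\<And>i. c \<le> lam i"
    using dirichlet_eigenvalue_lower_bound[of \<Omega> lam \<phi>] assms by blast
  ultimately interpret subdiffusion \<Omega> lam \<phi> "\<lambda>t. indicator {0<..T} t * abel_kernel \<alpha> t" K T \<alpha> \<mu> \<zeta> p c
    using assms by (simp add: subdiffusion_def eigensystem_def subdiffusion_axioms_def)
  show ?thesis
    using solution_exists solution_unique by blast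
qed

end
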